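(* Let $X$ be a graph with a free action of an amenable group $\Gamma$ with finite fundamental domain, let $\sigma$ be a rational (i.e. $\sigma^n=1$ for some positive integer $n$) weakly $\Gamma$-invariant weight function on $X$ with discrete magnetic Laplacian $\Delta_\sigma$, and let $\Delta_\sigma^{(m)}$ be the restricted operators on the regular exhaustion $\{X_m\}$ of $X$ corresponding to a regular exhaustion $\{\Lambda_m\}$ of $\Gamma$. Then for every $\mu\in\mathbb{R}$ satisfying any one of the conditions (1) $\mu\notin\mathrm{spec}(\Delta_\sigma)$, (2) $\mu=0$, (3) $\mu$ is algebraic and $\mu\notin\bigcup_m\mathrm{spec}(\Delta_\sigma^{(m)})$, the Fuglede-Kadison determinant $\det_{\Gamma,\sigma}(\Delta_\sigma-\mu)$ is positive.
   Context: Graphs and group action. $X$ is a combinatorial graph with vertex set $\mathrm{Vert}\,X$ and set $\mathrm{Edge}\,X$ of oriented edges; each unoriented edge gives two oriented edges $e,\overline e$, and $\mathfrak{o}(e),\mathfrak{t}(e)$ are the origin and terminus of $e$. $E^+\subset \mathrm{Edge}\,X$ contains exactly one orientation of each unoriented edge. $\mathcal{O}(v)$ is the valence of $v$ (the number of oriented edges with terminus $v$). $\Gamma$ is a finitely generated amenable discrete group acting on $X$ by graph automorphisms, freely (i.e. freely on the geometric realization), with finitely many orbits of vertices and edges. $\mathcal{F}$ is a fundamental domain: a finite set of vertices and unoriented edges containing exactly one element of each $\Gamma$-orbit. Weight function and DML. A weight function is $\sigma:\mathrm{Edge}\,X\to U(1)$ with $\sigma(\overline e)=\sigma(e)^{-1}$.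 It is weakly $\Gamma$-invariant if for each $\gamma\in\Gamma$ there is $s_\gamma:\mathrm{Vert}\,X\to U(1)$ with $\sigma(\gamma e)=\sigma(e)s_\gamma(\mathfrak{t}(e))\overline{s_\gamma(\mathfrak{o}(e))}$ for all $e$. The discrete magnetic Laplacian (DML) is the bounded self-adjoint operator on $\ell^2(\mathrm{Vert}\,X)$ $$(\Delta_\sigma f)(v)=\mathcal{O}(v)f(v)-\sum_{e\in E^+,\,\mathfrak{t}(e)=v}\sigma(e)f(\mathfrak{o}(e))-\sum_{e\in E^+,\,\mathfrak{o}(e)=v}\overline{\sigma(e)}f(\mathfrak{t}(e)).$$ Trace, spectral density, determinant. For a bounded operator $A$ commuting with all magnetic translations $(T_\gamma f)(x)=s_\gamma(\gamma^{-1}x)f(\gamma^{-1}x)$, $\gamma\in\Gamma$ (for instance any bounded Borel function of $\Delta_\sigma$), the von Neumann trace is $\mathrm{Tr}_{\Gamma,\sigma}(A)=\sum_{v\in\mathcal{F}\cap \mathrm{Vert}\,X}\langle A\delta_v,\delta_v\rangle$. If $A$ is moreover self-adjoint, its spectral density function is $G(\lambda)=\mathrm{Tr}_{\Gamma,\sigma}(\chi_{(-\infty,\lambda]}(A))$, and its Fuglede-Kadison determinant $\det_{\Gamma,\sigma}(A)\ge 0$ is defined by $$\log{\det}_{\Gamma,\sigma}(A)=\int_{0<|\lambda|\le L}\log|\lambda|\,dG(\lambda)$$ for some $L>\|A\|$ whenever the right-hand side is not $-\infty$, and $\det_{\Gamma,\sigma}(A)=0$ if it is $-\infty$. Regular exhaustions.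 A regular exhaustion of $\Gamma$ is an increasing sequence of nonempty finite subsets $\Lambda_m\subset\Lambda_{m+1}$ with $\bigcup_m\Lambda_m=\Gamma$ such that for every $\delta>0$, $\lim_m \#\partial_\delta\Lambda_m/\#\Lambda_m=0$, where $\partial_\delta\Lambda_m=\{\gamma\in\Gamma: d_1(\gamma,\Lambda_m)<\delta,\ d_1(\gamma,\Gamma\setminus\Lambda_m)<\delta\}$ and $d_1$ is the word metric for a finite generating set. The corresponding regular exhaustion of $X$ consists of $X_m$, the largest subgraph of $X$ contained in $\bigcup_{\gamma\in\Lambda_m}\gamma\mathcal{F}$. Restricted DML. $\Delta_\sigma^{(m)}$ is the self-adjoint operator on functions on $\mathrm{Vert}\,X_m$ given (with one fixed choice of boundary condition for all $m$) by: (Dirichlet) $P_m\Delta_\sigma P_m$, where $P_m$ is the orthogonal projection onto functions supported on $\mathrm{Vert}\,X_m$; or (Neumann) the DML of the finite graph $X_m$ itself with weight $\sigma|_{X_m}$, i.e. $(\Delta_\sigma^{(m)}f)(v)=\mathcal{O}_m(v)f(v)-\sum_{e\in E^+\cap\mathrm{Edge}\,X_m,\,\mathfrak{t}(e)=v}\sigma(e)f(\mathfrak{o}(e))-\sum_{e\in E^+\cap\mathrm{Edge}\,X_m,\,\mathfrak{o}(e)=v}\overline{\sigma(e)}f(\mathfrak{t}(e))$ for $v\in\mathrm{Vert}\,X_m$, where $\mathcal{O}_m(v)$ is the valence of $v$ in $X_m$. The result is asserted for either choice. *)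

theory Defs
  imports
    "HOL-Analysis.Analysis"
    "HOL-Algebra.Group_Action"
    "HOL-Algebra.Generated_Groups"
    "HOL-Computational_Algebra.Polynomial"
    "Graph_Theory.Graph_Theory"
begin

section \<open>Operators on $\ell^2(W)$\<close>

text \<open>
  The space $\ell^2(W)$ is modelled by the square-summable functions vanishing outside \<open>W\<close>.
  Operators on it are plain functions; only their values on \<^term>\<open>ell2 W\<close> are meaningful.
\<close>

type_synonym 'v operator = "('v \<Rightarrow> complex) \<Rightarrow> ('v \<Rightarrow> complex)"

definition ell2 :: "'v set \<Rightarrow> ('v \<Rightarrow> complex) set" where
  "ell2 W = {f. (\<forall>x. x \<notin> W \<longrightarrow> f x = 0) \<and> (\<lambda>x. (cmod (f x))\<^sup>2) summable_on W}"

definition ell2_inner :: "'v set \<Rightarrow> ('v \<Rightarrow> complex) \<Rightarrow> ('v \<Rightarrow> complex) \<Rightarrow> complex" where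
  "ell2_inner W f g = (\<Sum>\<^sub>\<infinity>x\<in>W. f x * cnj (g x))"

definition ell2_norm :: "'v set \<Rightarrow> ('v \<Rightarrow> complex) \<Rightarrow> real" where
  "ell2_norm W f = sqrt (\<Sum>\<^sub>\<infinity>x\<in>W. (cmod (f x))\<^sup>2)"

definition delta :: "'v \<Rightarrow> 'v \<Rightarrow> complex" where
  "delta v = (\<lambda>x. if x = v then 1 else 0)"

definition bounded_op :: "'v set \<Rightarrow> 'v operator \<Rightarrow> bool" where
  "bounded_op W A \<longleftrightarrow>
     (\<forall>f\<in>ell2 W. A f \<in> ell2 W) \<and>
     (\<forall>f\<in>ell2 W. \<forall>g\<in>ell2 W. A (\<lambda>x. f x + g x) = (\<lambda>x. A f x + A g x)) \<and>
     (\<forall>c. \<forall>f\<in>ell2 W. A (\<lambda>x. c * f x) = (\<lambda>x. c * A f x)) \<and>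
     (\<exists>C. \<forall>f\<in>ell2 W. ell2_norm W (A f) \<le> C * ell2_norm W f)"

definition op_norm :: "'v set \<Rightarrow> 'v operator \<Rightarrow> real" where
  "op_norm W A = Sup {ell2_norm W (A f) | f. f \<in> ell2 W \<and> ell2_norm W f \<le> 1}"

definition shift_op :: "'v operator \<Rightarrow> complex \<Rightarrow> 'v operator" where
  "shift_op A z = (\<lambda>f x. A f x - z * f x)"

definition op_spectrum :: "'v set \<Rightarrow> 'v operator \<Rightarrow> complex set" where
  "op_spectrum W A =
     {z. \<not> (\<exists>B. bounded_op W B \<and>
              (\<forall>f\<in>ell2 W. B (shift_op A z f) = f \<and> shift_op A z (B f) = f))}"

definition orthogonal_projection :: "'v set \<Rightarrow> 'v operator \<Rightarrow> bool" where
  "orthogonal_projection W P \<longleftrightarrow>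
     bounded_op W P \<and>
     (\<forall>f\<in>ell2 W. P (P f) = P f) \<and>
     (\<forall>f\<in>ell2 W. \<forall>g\<in>ell2 W. ell2_inner W (P f) g = ell2_inner W f (P g))"

text \<open>
  Resolution of the identity of a bounded self-adjoint operator:
  $A = \int \lambda \, dE_\lambda$ with $E$ increasing, strongly right continuous, and constant
  outside a bounded interval. By the spectral theorem every bounded self-adjoint \<open>A\<close> has one, and
  its values on \<^term>\<open>ell2 W\<close> are unique: $E_\lambda = \chi_{(-\infty,\lambda]}(A)$.
  The integral is the Lebesgue--Stieltjes integral against
  $\lambda \mapsto \langle E_\lambda f, f\rangle$.
\<close>

definition spectral_family :: "'v set \<Rightarrow> 'v operator \<Rightarrow> (real \<Rightarrow> 'v operator) \<Rightarrow> bool" where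
  "spectral_family W A E \<longleftrightarrow>
     (\<forall>l. orthogonal_projection W (E l)) \<and>
     (\<forall>l k. l \<le> k \<longrightarrow> (\<forall>f\<in>ell2 W. E l (E k f) = E l f \<and> E k (E l f) = E l f)) \<and>
     (\<forall>l. \<forall>f\<in>ell2 W. ((\<lambda>k. ell2_norm W (\<lambda>x. E k f x - E l f x)) \<longlongrightarrow> 0) (at_right l)) \<and>
     (\<exists>a b. \<forall>f\<in>ell2 W. (\<forall>l<a. E l f = (\<lambda>_. 0)) \<and> (\<forall>l\<ge>b. E l f = f)) \<and>
     (\<forall>f\<in>ell2 W. ell2_inner W (A f) f =
        complex_of_real (\<integral>x. x \<partial>interval_measure (\<lambda>l. Re (ell2_inner W (E l f) f))))"

definition spectral_projection :: "'v set \<Rightarrow> 'v operator \<Rightarrow> real \<Rightarrow> 'v operator" where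
  "spectral_projection W A = (SOME E. spectral_family W A E)"

text \<open>Here and below \<open>FV\<close> is the set of vertices of a fundamental domain.\<close>

definition vn_trace :: "'v set \<Rightarrow> 'v set \<Rightarrow> 'v operator \<Rightarrow> complex" where
  "vn_trace W FV A = (\<Sum>v\<in>FV. ell2_inner W (A (delta v)) (delta v))"

definition spectral_density :: "'v set \<Rightarrow> 'v set \<Rightarrow> 'v operator \<Rightarrow> real \<Rightarrow> real" where
  "spectral_density W FV A l = Re (vn_trace W FV (spectral_projection W A l))"

text \<open>
  The integrand is bounded above on the region of integration and the measure of that region is
  finite, so the integral is $-\infty$ exactly if \<^const>\<open>set_integrable\<close> fails. Its value does
  not depend on the choice of \<open>L\<close>.
\<close>

definition fk_det :: "'v set \<Rightarrow> 'v set \<Rightarrow> 'v operator \<Rightarrow> real" where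
  "fk_det W FV A =
     (let L = (SOME L. L > op_norm W A);
          M = interval_measure (spectral_density W FV A);
          R = {x. 0 < \<bar>x\<bar> \<and> \<bar>x\<bar> \<le> L}
      in if set_integrable M R (\<lambda>x. ln \<bar>x\<bar>)
         then exp (set_lebesgue_integral M R (\<lambda>x. ln \<bar>x\<bar>)) else 0)"


section \<open>Graphs with a group action\<close>

text \<open>
  A graph is a bidirected digraph \<open>\<G>\<close>: its arcs are the oriented edges, \<^const>\<open>tail\<close> and
  \<^const>\<open>head\<close> are origin and terminus, and \<open>arev\<close> is the fixed-point free reversal of arcs.
  Loops and multiple edges are allowed. An unoriented edge is the set consisting of an arc and its
  reversal.
\<close>

definition unoriented_edges :: "('v, 'e) pre_digraph \<Rightarrow> ('e \<Rightarrow> 'e) \<Rightarrow> 'e set set" where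
  "unoriented_edges \<G> arev = (\<lambda>e. {e, arev e}) ` arcs \<G>"

definition orientation :: "('v, 'e) pre_digraph \<Rightarrow> ('e \<Rightarrow> 'e) \<Rightarrow> 'e set \<Rightarrow> bool" where
  "orientation \<G> arev Ep \<longleftrightarrow>
     Ep \<subseteq> arcs \<G> \<and> (\<forall>e\<in>arcs \<G>. (e \<in> Ep) \<noteq> (arev e \<in> Ep))"

definition graph_action ::
  "('g, 'm) monoid_scheme \<Rightarrow> ('v, 'e) pre_digraph \<Rightarrow> ('e \<Rightarrow> 'e) \<Rightarrow>
     ('g \<Rightarrow> 'v \<Rightarrow> 'v) \<Rightarrow> ('g \<Rightarrow> 'e \<Rightarrow> 'e) \<Rightarrow> bool" where
  "graph_action G \<G> arev \<alpha> \<beta> \<longleftrightarrow>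
     group_action G (verts \<G>) \<alpha> \<and> group_action G (arcs \<G>) \<beta> \<and>
     (\<forall>g\<in>carrier G. \<forall>e\<in>arcs \<G>.
        tail \<G> (\<beta> g e) = \<alpha> g (tail \<G> e) \<and> head \<G> (\<beta> g e) = \<alpha> g (head \<G> e) \<and>
        arev (\<beta> g e) = \<beta> g (arev e))"

text \<open>
  Freeness on the geometric realization: besides fixing no vertex and no edge, a nontrivial element
  must not reverse an edge, as it would then fix its midpoint.
\<close>

definition free_action ::
  "('g, 'm) monoid_scheme \<Rightarrow> ('v, 'e) pre_digraph \<Rightarrow> ('e \<Rightarrow> 'e) \<Rightarrow>
     ('g \<Rightarrow> 'v \<Rightarrow> 'v) \<Rightarrow> ('g \<Rightarrow> 'e \<Rightarrow> 'e) \<Rightarrow> bool" where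
  "free_action G \<G> arev \<alpha> \<beta> \<longleftrightarrow>
     (\<forall>g\<in>carrier G. g \<noteq> \<one>\<^bsub>G\<^esub> \<longrightarrow>
        (\<forall>v\<in>verts \<G>. \<alpha> g v \<noteq> v) \<and> (\<forall>e\<in>arcs \<G>. \<beta> g e \<noteq> e \<and> \<beta> g e \<noteq> arev e))"

definition fundamental_domain ::
  "('g, 'm) monoid_scheme \<Rightarrow> ('v, 'e) pre_digraph \<Rightarrow> ('e \<Rightarrow> 'e) \<Rightarrow>
     ('g \<Rightarrow> 'v \<Rightarrow> 'v) \<Rightarrow> ('g \<Rightarrow> 'e \<Rightarrow> 'e) \<Rightarrow> 'v set \<Rightarrow> 'e set set \<Rightarrow> bool" where
  "fundamental_domain G \<G> arev \<alpha> \<beta> FV FE \<longleftrightarrow>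
     finite FV \<and> FV \<subseteq> verts \<G> \<and> finite FE \<and> FE \<subseteq> unoriented_edges \<G> arev \<and>
     (\<forall>v\<in>verts \<G>. \<exists>!w. w \<in> FV \<and> (\<exists>g\<in>carrier G. w = \<alpha> g v)) \<and>
     (\<forall>u\<in>unoriented_edges \<G> arev. \<exists>!w. w \<in> FE \<and> (\<exists>g\<in>carrier G. w = \<beta> g ` u))"


section \<open>Amenability and regular exhaustions\<close>

definition amenable :: "('g, 'm) monoid_scheme \<Rightarrow> bool" where
  "amenable G \<longleftrightarrow>
     (\<exists>p :: 'g set \<Rightarrow> real.
        (\<forall>A\<subseteq>carrier G. 0 \<le> p A) \<and> p (carrier G) = 1 \<and>
        (\<forall>A\<subseteq>carrier G. \<forall>B\<subseteq>carrier G. A \<inter> B = {} \<longrightarrow> p (A \<union> B) = p A + p B) \<and>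
        (\<forall>g\<in>carrier G. \<forall>A\<subseteq>carrier G. p (g <#\<^bsub>G\<^esub> A) = p A))"

text \<open>
  The left-invariant word metric. This is the convention for which Folner sets of the group give
  small boundaries in \<open>\<G>\<close>: if \<open>\<gamma>\<F>\<close> and \<open>\<gamma>'\<F>\<close> are adjacent then $\gamma^{-1}\gamma'$ lies in a fixed
  finite set.
\<close>

definition word_dist :: "('g, 'm) monoid_scheme \<Rightarrow> 'g set \<Rightarrow> 'g \<Rightarrow> 'g \<Rightarrow> nat" where
  "word_dist G S g h =
     (LEAST n. \<exists>w. length w = n \<and> set w \<subseteq> S \<union> (\<lambda>s. inv\<^bsub>G\<^esub> s) ` S \<and>
        foldr (\<lambda>x y. x \<otimes>\<^bsub>G\<^esub> y) w \<one>\<^bsub>G\<^esub> = inv\<^bsub>G\<^esub> g \<otimes>\<^bsub>G\<^esub> h)"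

text \<open>The distance to the empty set is \<open>\<infinity>\<close>.\<close>

definition word_setdist :: "('g, 'm) monoid_scheme \<Rightarrow> 'g set \<Rightarrow> 'g \<Rightarrow> 'g set \<Rightarrow> ereal" where
  "word_setdist G S g A = (INF a\<in>A. ereal (real (word_dist G S g a)))"

definition word_boundary ::
  "('g, 'm) monoid_scheme \<Rightarrow> 'g set \<Rightarrow> real \<Rightarrow> 'g set \<Rightarrow> 'g set" where
  "word_boundary G S d A =
     {g \<in> carrier G. word_setdist G S g A < ereal d \<and>
                     word_setdist G S g (carrier G - A) < ereal d}"

definition regular_exhaustion ::
  "('g, 'm) monoid_scheme \<Rightarrow> 'g set \<Rightarrow> (nat \<Rightarrow> 'g set) \<Rightarrow> bool" where
  "regular_exhaustion G S \<Lambda> \<longleftrightarrow>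
     (\<forall>m. finite (\<Lambda> m) \<and> \<Lambda> m \<noteq> {} \<and> \<Lambda> m \<subseteq> \<Lambda> (Suc m)) \<and>
     (\<Union>m. \<Lambda> m) = carrier G \<and>
     (\<forall>d>0. (\<lambda>m. real (card (word_boundary G S d (\<Lambda> m))) / real (card (\<Lambda> m)))
              \<longlonglongrightarrow> 0)"

text \<open>The largest subgraph of \<open>\<G>\<close> contained in the union of the translates \<open>\<gamma>\<F>\<close>, \<open>\<gamma> \<in> \<Lambda>\<close>.\<close>

definition translates_subgraph ::
  "('v, 'e) pre_digraph \<Rightarrow> ('e \<Rightarrow> 'e) \<Rightarrow> ('g \<Rightarrow> 'v \<Rightarrow> 'v) \<Rightarrow> ('g \<Rightarrow> 'e \<Rightarrow> 'e) \<Rightarrow>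
     'v set \<Rightarrow> 'e set set \<Rightarrow> 'g set \<Rightarrow> ('v, 'e) pre_digraph" where
  "translates_subgraph \<G> arev \<alpha> \<beta> FV FE \<Lambda> =
     (let V = (\<Union>g\<in>\<Lambda>. \<alpha> g ` FV)
      in \<lparr> verts = V,
           arcs = {e \<in> arcs \<G>. {e, arev e} \<in> (\<Union>g\<in>\<Lambda>. (\<lambda>u. \<beta> g ` u) ` FE) \<and>
                               tail \<G> e \<in> V \<and> head \<G> e \<in> V},
           tail = tail \<G>, head = head \<G> \<rparr>)"

lemma translates_subgraph_greatest:
  assumes \<G>: "bidirected_digraph \<G> arev" and act: "graph_action G \<G> arev \<alpha> \<beta>"
    and F: "fundamental_domain G \<G> arev \<alpha> \<beta> FV FE" and L: "\<Lambda> \<subseteq> carrier G"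
  defines "Y \<equiv> translates_subgraph \<G> arev \<alpha> \<beta> FV FE \<Lambda>"
  shows "subgraph Y \<G>" and "\<And>e. e \<in> arcs Y \<Longrightarrow> arev e \<in> arcs Y"
    and "\<And>H. subgraph H \<G> \<Longrightarrow> verts H \<subseteq> (\<Union>g\<in>\<Lambda>. \<alpha> g ` FV) \<Longrightarrow>
           (\<And>e. e \<in> arcs H \<Longrightarrow> {e, arev e} \<in> (\<Union>g\<in>\<Lambda>. (\<lambda>u. \<beta> g ` u) ` FE)) \<Longrightarrow>
           subgraph H Y"
proof -
  interpret \<G>: bidirected_digraph \<G> arev by (rule \<G>)
  define V0 where "V0 = (\<Union>g\<in>\<Lambda>. \<alpha> g ` FV)"
  define E0 where "E0 = (\<Union>g\<in>\<Lambda>. (\<lambda>u. \<beta> g ` u) ` FE)"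
  have Y: "verts Y = V0" "tail Y = tail \<G>" "head Y = head \<G>"
      "arcs Y = {e \<in> arcs \<G>. {e, arev e} \<in> E0 \<and> tail \<G> e \<in> V0 \<and> head \<G> e \<in> V0}"
    by (simp_all only: Y_def translates_subgraph_def Let_def pre_digraph.select_convs V0_def E0_def)
  have ga: "group_action G (verts \<G>) \<alpha>" using act by (simp only: graph_action_def)
  have FV: "FV \<subseteq> verts \<G>" using F by (simp only: fundamental_domain_def)
  have V: "V0 \<subseteq> verts \<G>"
  proof
    fix v assume "v \<in> V0"
    then obtain g w where gw: "g \<in> \<Lambda>" "w \<in> FV" "v = \<alpha> g w" unfolding V0_def by blast
    show "v \<in> verts \<G>"
      by (rule group_action.element_image[OF ga subsetD[OF L gw(1)] subsetD[OF FV gw(2)]])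
        (rule gw(3)[symmetric])
  qed
  have wf: "wf_digraph Y"
    by (rule wf_digraph.intro) (simp_all add: Y)
  show "subgraph Y \<G>"
    using V wf \<G>.wf_digraph_axioms by (auto simp: subgraph_def compatible_def Y)
  show "arev e \<in> arcs Y" if "e \<in> arcs Y" for e
    using that by (simp add: Y insert_commute)
  show "subgraph H Y" if H: "subgraph H \<G>" "verts H \<subseteq> (\<Union>g\<in>\<Lambda>. \<alpha> g ` FV)"
      "\<And>e. e \<in> arcs H \<Longrightarrow> {e, arev e} \<in> (\<Union>g\<in>\<Lambda>. (\<lambda>u. \<beta> g ` u) ` FE)" for H
  proof -
    have HV: "verts H \<subseteq> V0" and HE: "\<And>e. e \<in> arcs H \<Longrightarrow> {e, arev e} \<in> E0"
      using H(2,3) by (simp_all only: V0_def E0_def)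
    have t: "tail H = tail \<G>" "head H = head \<G>" "arcs H \<subseteq> arcs \<G>" "wf_digraph H"
      using H(1) by (simp_all add: subgraph_def compatible_def)
    have "arcs H \<subseteq> arcs Y"
      using wf_digraph.tail_in_verts[OF t(4)] wf_digraph.head_in_verts[OF t(4)] t(1-3) HV HE
      by (auto simp: Y)
    then show ?thesis
      using HV t wf by (simp add: subgraph_def compatible_def Y)
  qed
qed


section \<open>Weight functions and discrete magnetic Laplacians\<close>

definition weight_function ::
  "('v, 'e) pre_digraph \<Rightarrow> ('e \<Rightarrow> 'e) \<Rightarrow> ('e \<Rightarrow> complex) \<Rightarrow> bool" where
  "weight_function \<G> arev \<sigma> \<longleftrightarrow>
     (\<forall>e\<in>arcs \<G>. cmod (\<sigma> e) = 1 \<and> \<sigma> (arev e) = inverse (\<sigma> e))"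

definition weakly_invariant ::
  "('g, 'm) monoid_scheme \<Rightarrow> ('v, 'e) pre_digraph \<Rightarrow> ('g \<Rightarrow> 'e \<Rightarrow> 'e) \<Rightarrow>
     ('e \<Rightarrow> complex) \<Rightarrow> bool" where
  "weakly_invariant G \<G> \<beta> \<sigma> \<longleftrightarrow>
     (\<forall>g\<in>carrier G. \<exists>s. (\<forall>v\<in>verts \<G>. cmod (s v) = 1) \<and>
        (\<forall>e\<in>arcs \<G>. \<sigma> (\<beta> g e) = \<sigma> e * s (head \<G> e) * cnj (s (tail \<G> e))))"

definition rational_weight :: "('v, 'e) pre_digraph \<Rightarrow> ('e \<Rightarrow> complex) \<Rightarrow> bool" where
  "rational_weight \<G> \<sigma> \<longleftrightarrow> (\<exists>n::nat. 0 < n \<and> (\<forall>e\<in>arcs \<G>. \<sigma> e ^ n = 1))"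

text \<open>
  In a bidirected graph \<^const>\<open>in_degree\<close> is the valence. The graph \<open>Y\<close> will be \<open>\<G>\<close> itself or a
  subgraph of it, while \<open>Ep\<close> is always an orientation of \<open>\<G>\<close>.
\<close>

definition dml :: "('v, 'e) pre_digraph \<Rightarrow> 'e set \<Rightarrow> ('e \<Rightarrow> complex) \<Rightarrow> 'v operator" where
  "dml Y Ep \<sigma> f =
     (\<lambda>v. if v \<in> verts Y
          then of_nat (in_degree Y v) * f v
               - (\<Sum>e\<in>Ep \<inter> in_arcs Y v. \<sigma> e * f (tail Y e))
               - (\<Sum>e\<in>Ep \<inter> out_arcs Y v. cnj (\<sigma> e) * f (head Y e))
          else 0)"

definition cutoff :: "'v set \<Rightarrow> 'v operator" where
  "cutoff W f = (\<lambda>v. if v \<in> W then f v else 0)"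

datatype boundary_condition = Dirichlet | Neumann

text \<open>To be regarded as an operator on \<^term>\<open>ell2 (verts Y)\<close>, for a subgraph \<open>Y\<close> of \<open>\<G>\<close>.\<close>

fun restricted_dml ::
  "boundary_condition \<Rightarrow> ('v, 'e) pre_digraph \<Rightarrow> 'e set \<Rightarrow> ('e \<Rightarrow> complex) \<Rightarrow>
     ('v, 'e) pre_digraph \<Rightarrow> 'v operator" where
  "restricted_dml Dirichlet \<G> Ep \<sigma> Y = (\<lambda>f. cutoff (verts Y) (dml \<G> Ep \<sigma> (cutoff (verts Y) f)))"
| "restricted_dml Neumann \<G> Ep \<sigma> Y = dml Y Ep \<sigma>"

end

theory Submission
  imports Defs
    "HOL-Probability.Probability"
    "Jordan_Normal_Form.Schur_Decomposition"
    "Jordan_Normal_Form.Char_Poly"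
begin

text \<open>
  The determinant of $\Delta_\sigma - \mu$ is positive iff $\log |x|$ is integrable near 0 against the
  spectral density. If $\mu$ is not in the spectrum, this measure has no mass near 0. Otherwise $\mu$ is
  algebraic. Compressing $\Delta_\sigma - \mu$ to the vertices of $X_m$ gives Hermitian matrices of size
  proportional to $\#\Lambda_m$ whose normalised eigenvalue counting measures converge to the spectral
  density in moments, as the vertices near the boundary are negligible. The product of the nonzero
  eigenvalues is a nonzero coefficient of the characteristic polynomial; as the entries lie in
  $\mathbb{Z}[\zeta, \mu]$ for a root of unity $\zeta$ and the matrices are sparse, this coefficient is an
  algebraic number of exponentially bounded size, and hence is bounded below exponentially. So the
  normalised sums of $\log |\lambda|$ over the nonzero eigenvalues $\lambda$ are bounded below, and
  continuous functions increasing to $-\log |x|$ off 0 and vanishing at 0 transfer this bound to the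
  limit.
\<close>

section \<open>Sizes and determinants\<close>

text \<open>Two obstacles shape the proof. The first: \<open>fk_det\<close> refers to a resolution
  of the identity picked by \<open>SOME\<close>, and the definition of such a resolution prescribes
  only the first moment, as a quadratic form. So existence has to be proved (through the moment
  problem on [-C, C]), and an arbitrary resolution has to be shown to have the powers of the
  operator as its higher moments; only then can traces of powers be compared with the matrices. The
  second is arithmetic: mu need not be an algebraic integer, so a coefficient of the characteristic
  polynomial becomes a root of a monic integer polynomial only after multiplication by a power of
  the leading coefficient of an integer equation for mu. The degree of that monic polynomial depends
  on n and mu alone; the size N of the matrix enters only through its l1 norm, which grows like a
  constant to the power N. As N is the number of vertices in a fundamental domain times the
  cardinality of the Folner set, taking logarithms and dividing by that cardinality leaves a
  constant.\<close>

locale ring_size =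
  fixes size_le :: "'a::comm_ring_1 \<Rightarrow> int \<Rightarrow> bool"
  assumes nonneg: "size_le a h \<Longrightarrow> 0 \<le> h"
    and zero: "size_le 0 0" and one: "size_le 1 1"
    and uminus: "size_le a h \<Longrightarrow> size_le (- a) h"
    and add: "size_le a h \<Longrightarrow> size_le b k \<Longrightarrow> size_le (a + b) (h + k)"
    and mult: "size_le a h \<Longrightarrow> size_le b k \<Longrightarrow> size_le (a * b) (h * k)"
    and mono: "size_le a h \<Longrightarrow> h \<le> k \<Longrightarrow> size_le a k"
begin

lemma size_sum:
  assumes "\<And>i. i \<in> I \<Longrightarrow> size_le (f i) (h i)"
  shows "size_le (sum f I) (sum h I)"
  using assms by (induction I rule: infinite_finite_induct) (auto intro: zero add)

lemma size_prod:
  assumes "\<And>i. i \<in> I \<Longrightarrow> size_le (f i) (h i)"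
  shows "size_le (prod f I) (prod h I)"
  using assms by (induction I rule: infinite_finite_induct) (auto intro: one mult)

text \<open>The Leibniz expansion is bounded by the permanent of the sizes, which is at most the product
  of the row sums; this is what makes the bound exponential in the dimension for sparse matrices.\<close>

lemma size_det:
  assumes A: "A \<in> carrier_mat n n"
    and h: "\<And>i j. i < n \<Longrightarrow> j < n \<Longrightarrow> size_le (A $$ (i, j)) (h i j)"
  shows "size_le (Determinant.det A) (\<Prod>i<n. \<Sum>j<n. h i j)"
proof -
  let ?P = "{p. p permutes {0..<n}}"
  have "size_le (signof p * (\<Prod>i = 0..<n. A $$ (i, p i))) (1 * (\<Prod>i = 0..<n. h i (p i)))"
    if "p \<in> ?P" for p
  proof (rule mult)
    show "size_le (signof p) 1" using one uminus[OF one] by (auto simp: sign_def)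
    show "size_le (\<Prod>i = 0..<n. A $$ (i, p i)) (\<Prod>i = 0..<n. h i (p i))"
      using that permutes_in_image[of p "{0..<n}"] by (intro size_prod h) force+
  qed
  then have "size_le (Determinant.det A) (\<Sum>p\<in>?P. \<Prod>i = 0..<n. h i (p i))"
    unfolding det_def'[OF A] using size_sum[of ?P] by simp
  moreover have "(\<Sum>p\<in>?P. \<Prod>i = 0..<n. h i (p i)) \<le> (\<Prod>i<n. \<Sum>j<n. h i j)"
  proof -
    \<comment> \<open>Permutations are total functions; restricting them to the index range makes
      them members of the extensional product over which the product of the row sums expands. The
      other members only add nonnegative terms.\<close>
    let ?r = "\<lambda>p. restrict p {0..<n}"
    have inj: "inj_on ?r ?P"
    proof (rule inj_onI)
      fix p q assume pq: "p \<in> ?P" "q \<in> ?P" "?r p = ?r q"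
      show "p = q"
      proof
        fix x
        show "p x = q x"
          using pq(1,2) fun_cong[OF pq(3), of x] by (cases "x \<in> {0..<n}") (auto simp: permutes_not_in)
      qed
    qed
    have sub: "?r ` ?P \<subseteq> PiE {0..<n} (\<lambda>_. {..<n})"
    proof (intro image_subsetI)
      fix p assume "p \<in> ?P"
      then show "?r p \<in> PiE {0..<n} (\<lambda>_. {..<n})"
        using permutes_in_image[of p "{0..<n}"] by auto
    qed
    have "(\<Sum>p\<in>?P. \<Prod>i = 0..<n. h i (p i)) = (\<Sum>g\<in>?r ` ?P. \<Prod>i = 0..<n. h i (g i))"
      by (simp add: sum.reindex[OF inj])
    also have "\<dots> \<le> (\<Sum>g\<in>PiE {0..<n} (\<lambda>_. {..<n}). \<Prod>i = 0..<n. h i (g i))"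
    proof (rule sum_mono2[OF _ sub])
      show "0 \<le> (\<Prod>i = 0..<n. h i (g i))" if "g \<in> PiE {0..<n} (\<lambda>_. {..<n}) - ?r ` ?P" for g
        using that nonneg[OF h] by (intro prod_nonneg) (auto simp: PiE_iff)
    qed (auto intro: finite_PiE)
    also have "\<dots> = (\<Prod>i<n. \<Sum>j<n. h i j)"
      by (subst prod_sum_PiE) (auto simp: lessThan_atLeast0)
    finally show ?thesis .
  qed
  ultimately show ?thesis by (rule mono)
qed

end

section \<open>The l1 norm of integer polynomials\<close>

definition poly_l1 :: "int poly \<Rightarrow> int" where
  "poly_l1 p = (\<Sum>x\<leftarrow>coeffs p. \<bar>x\<bar>)"

lemma poly_l1_0 [simp]: "poly_l1 0 = 0" by (simp add: poly_l1_def)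

lemma poly_l1_pCons [simp]: "poly_l1 (pCons a p) = \<bar>a\<bar> + poly_l1 p"
  by (simp add: poly_l1_def cCons_def)

lemma poly_l1_1 [simp]: "poly_l1 1 = 1" by (simp add: one_pCons)

lemma poly_l1_nonneg: "0 \<le> poly_l1 p"
  by (induction p) auto

lemma poly_l1_add: "poly_l1 (p + q) \<le> poly_l1 p + poly_l1 q"
  by (induction p q rule: poly_induct2) auto

lemma poly_l1_smult: "poly_l1 (Polynomial.smult c p) = \<bar>c\<bar> * poly_l1 p"
  by (induction p) (auto simp: abs_mult algebra_simps)

lemma poly_l1_minus: "poly_l1 (- p) = poly_l1 p"
  by (induction p) auto

lemma poly_l1_mult: "poly_l1 (p * q) \<le> poly_l1 p * poly_l1 q"
proof (induction p)
  case (pCons a p)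
  have "poly_l1 (pCons a p * q) \<le> poly_l1 (Polynomial.smult a q) + poly_l1 (pCons 0 (p * q))"
    unfolding mult_pCons_left by (rule poly_l1_add)
  then show ?case using pCons.IH by (simp add: poly_l1_smult algebra_simps)
qed auto

lemma poly_l1_sum: "poly_l1 (sum f I) \<le> (\<Sum>i\<in>I. poly_l1 (f i))"
  by (induction I rule: infinite_finite_induct) (auto intro: order_trans[OF poly_l1_add])

lemma abs_coeff_le_poly_l1: "\<bar>coeff p k\<bar> \<le> poly_l1 p"
proof (induction p arbitrary: k)
  case (pCons a p)
  then show ?case using poly_l1_nonneg[of p] pCons.IH[of "k - 1"]
    by (cases k) (auto simp: coeff_pCons intro: add_increasing)
qed auto

lemma sum_abs_coeff_le_poly_l1: "(\<Sum>k\<le>n. \<bar>coeff p k\<bar>) \<le> poly_l1 p"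
proof (induction p arbitrary: n)
  case (pCons a p)
  show ?case
  proof (cases n)
    case 0
    then show ?thesis using poly_l1_nonneg[of p] by simp
  next
    case (Suc m)
    show ?thesis unfolding Suc sum.atMost_Suc_shift using pCons.IH[of m] by simp
  qed
qed auto

text \<open>The first of two instances of \<open>ring_size\<close>: it bounds characteristic
  polynomials of integer matrices. The second, \<open>module_size\<close>, bounds the determinant of
  a multiple of X - A for the matrices A of the Laplacian.\<close>

interpretation int_poly_size: ring_size "\<lambda>p h. poly_l1 p \<le> h"
proof
  fix a b :: "int poly" and h k
  show "poly_l1 a \<le> h \<Longrightarrow> 0 \<le> h" using poly_l1_nonneg[of a] by linarith
  show "poly_l1 1 \<le> 1" by (simp add: one_pCons)
  show "poly_l1 a \<le> h \<Longrightarrow> poly_l1 (- a) \<le> h" by (simp add: poly_l1_minus)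
  show "poly_l1 a \<le> h \<Longrightarrow> poly_l1 b \<le> k \<Longrightarrow> poly_l1 (a + b) \<le> h + k"
    using poly_l1_add[of a b] by linarith
  show "poly_l1 a \<le> h \<Longrightarrow> poly_l1 b \<le> k \<Longrightarrow> poly_l1 (a * b) \<le> h * k"
    by (rule order_trans[OF poly_l1_mult]) (intro mult_mono, auto intro: order_trans[OF poly_l1_nonneg])
qed auto

text \<open>The lowest nonvanishing coefficient of \<open>p\<close> has absolute value at least 1.\<close>

lemma int_root_lower_bound:
  fixes z :: complex and p :: "int poly"
  assumes p: "p \<noteq> 0" and root: "poly (map_poly of_int p) z = 0" and z: "z \<noteq> 0"
    and h: "poly_l1 p \<le> h" "1 \<le> h"
  shows "1 / real_of_int h \<le> cmod z"
proof (cases "cmod z \<ge> 1")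
  case True
  then show ?thesis using h by (simp add: order_trans[of _ 1])
next
  case False
  define t where "t = (LEAST k. coeff p k \<noteq> 0)"
  obtain k where "coeff p k \<noteq> 0" using p by (meson leading_coeff_0_iff)
  then have t: "coeff p t \<noteq> 0" and lt: "\<And>k. k < t \<Longrightarrow> coeff p k = 0"
    unfolding t_def by (rule LeastI, metis not_less_Least)
  let ?n = "degree p"
  have tn: "t \<le> ?n" using t by (rule le_degree)
  have "(\<Sum>k\<le>?n. of_int (coeff p k) * z ^ k) = 0"
    using root by (simp add: poly_altdef coeff_map_poly degree_map_poly)
  also have "(\<Sum>k\<le>?n. of_int (coeff p k) * z ^ k) = (\<Sum>k\<in>{t..?n}. of_int (coeff p k) * z ^ k)"
    using lt by (intro sum.mono_neutral_right) auto
  also have "\<dots> = of_int (coeff p t) * z ^ t + (\<Sum>k\<in>{t<..?n}. of_int (coeff p k) * z ^ k)"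
    using tn by (simp add: sum.head)
  finally have "cmod (of_int (coeff p t) * z ^ t) = cmod (\<Sum>k\<in>{t<..?n}. of_int (coeff p k) * z ^ k)"
    by (simp add: add_eq_0_iff norm_minus_commute)
  \<comment> \<open>Since |z| < 1, each power beyond t is at most |z|^(t+1). Cancelling the common
    factor |z|^t then leaves |a_t| <= h |z| for the lowest nonzero coefficient a_t.\<close>
  also have "\<dots> \<le> (\<Sum>k\<in>{t<..?n}. real_of_int \<bar>coeff p k\<bar> * cmod z ^ Suc t)"
  proof (intro sum_norm_le)
    fix k assume k: "k \<in> {t<..?n}"
    have "cmod z ^ k \<le> cmod z ^ Suc t" using False k by (intro power_decreasing) auto
    then show "cmod (of_int (coeff p k) * z ^ k) \<le> real_of_int \<bar>coeff p k\<bar> * cmod z ^ Suc t"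
      by (simp add: norm_mult norm_power mult_left_mono)
  qed
  also have "\<dots> = real_of_int (\<Sum>k\<in>{t<..?n}. \<bar>coeff p k\<bar>) * cmod z ^ Suc t"
    by (simp add: sum_distrib_right)
  also have "\<dots> \<le> real_of_int h * cmod z ^ Suc t"
  proof (rule mult_right_mono)
    have "(\<Sum>k\<in>{t<..?n}. \<bar>coeff p k\<bar>) \<le> (\<Sum>k\<le>?n. \<bar>coeff p k\<bar>)"
      by (rule sum_mono2) auto
    then show "real_of_int (\<Sum>k\<in>{t<..?n}. \<bar>coeff p k\<bar>) \<le> real_of_int h"
      using sum_abs_coeff_le_poly_l1[of p ?n] h by linarith
  qed simp
  finally have *: "\<bar>real_of_int (coeff p t)\<bar> * cmod z ^ t \<le> real_of_int h * cmod z * cmod z ^ t"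
    by (simp add: norm_mult norm_power mult.assoc)
  have "\<bar>real_of_int (coeff p t)\<bar> \<le> real_of_int h * cmod z"
    using mult_right_le_imp_le[OF *] z by simp
  moreover have "1 \<le> \<bar>real_of_int (coeff p t)\<bar>" using t by linarith
  ultimately show ?thesis using h by (simp add: field_simps)
qed

text \<open>The entries of X - G have l1 norm at most delta_ij + |G_ij|, so every row of X - G has
  total size at most 1 + h, and the Leibniz bound \<open>int_poly_size.size_det\<close>
  applies.\<close>

lemma poly_l1_char_poly:
  fixes G :: "int mat"
  assumes G: "G \<in> carrier_mat d d" and h: "\<And>i. i < d \<Longrightarrow> (\<Sum>j<d. \<bar>G $$ (i, j)\<bar>) \<le> h"
  shows "poly_l1 (char_poly G) \<le> (1 + h) ^ d"
proof -
  have "poly_l1 (char_poly G) \<le> (\<Prod>i<d. \<Sum>j<d. (if i = j then 1 else 0) + \<bar>G $$ (i, j)\<bar>)"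
    unfolding char_poly_def
  proof (rule int_poly_size.size_det)
    show "char_poly_matrix G \<in> carrier_mat d d" using G by simp
    show "poly_l1 (char_poly_matrix G $$ (i, j)) \<le> (if i = j then 1 else 0) + \<bar>G $$ (i, j)\<bar>"
      if "i < d" "j < d" for i j
      using that G by (auto simp: char_poly_matrix_def)
  qed
  also have "\<dots> \<le> (\<Prod>i<d. 1 + h)"
  proof (intro prod_mono conjI)
    fix i assume "i \<in> {..<d}"
    then show "(\<Sum>j<d. (if i = j then 1 else 0) + \<bar>G $$ (i, j)\<bar>) \<le> 1 + h"
      using h by (simp add: sum.distrib)
  qed (auto intro!: sum_nonneg)
  finally show ?thesis by simp
qed

text \<open>
  The polynomial \<open>p\<close> acts on the $\mathbb{Z}[X]$-module generated by the \<open>\<omega> i\<close> through a matrix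
  over $\mathbb{Z}[X]$ whose row sums are at most \<open>h\<close> in the $\ell^1$ norm. Unlike bounds for all
  Galois conjugates, this needs no irreducibility and no independence of the \<open>\<omega> i\<close>.
\<close>

definition module_size :: "'i set \<Rightarrow> ('i \<Rightarrow> complex) \<Rightarrow> complex poly \<Rightarrow> int \<Rightarrow> bool" where
  "module_size I \<omega> p h \<longleftrightarrow> 0 \<le> h \<and>
     (\<exists>G :: 'i \<Rightarrow> 'i \<Rightarrow> int poly. \<forall>i\<in>I.
        Polynomial.smult (\<omega> i) p = (\<Sum>j\<in>I. Polynomial.smult (\<omega> j) (map_poly of_int (G i j))) \<and>
        (\<Sum>j\<in>I. poly_l1 (G i j)) \<le> h)"

text \<open>Integer polynomials act by scalar matrices, whatever the generators are.\<close>

lemma module_size_diag: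
  assumes "finite I" "poly_l1 q \<le> h"
  shows "module_size I \<omega> (map_poly of_int q) h"
  unfolding module_size_def
proof (intro conjI exI[of _ "\<lambda>i j. if i = j then q else 0"] ballI)
  fix i assume i: "i \<in> I"
  have "(\<Sum>j\<in>I. Polynomial.smult (\<omega> j) (map_poly of_int (if i = j then q else 0))) =
      (\<Sum>j\<in>I. if i = j then Polynomial.smult (\<omega> j) (map_poly of_int q) else 0)"
    by (intro sum.cong) auto
  then show "Polynomial.smult (\<omega> i) (map_poly of_int q) =
      (\<Sum>j\<in>I. Polynomial.smult (\<omega> j) (map_poly of_int (if i = j then q else 0)))"
    using assms(1) i by simp
  have "(\<Sum>j\<in>I. poly_l1 (if i = j then q else 0)) = (\<Sum>j\<in>I. if i = j then poly_l1 q else 0)"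
    by (intro sum.cong) auto
  then show "(\<Sum>j\<in>I. poly_l1 (if i = j then q else 0)) \<le> h"
    using assms i by simp
qed (use assms poly_l1_nonneg[of q] in linarith)

text \<open>Sums and products of elements are represented by sums and products of their matrices,
  and the maximal row sum of l1 norms is a submultiplicative norm on matrices. Representing matrices
  need not be unique; any of them serves.\<close>

lemma ring_size_module_size:
  assumes "finite I"
  shows "ring_size (module_size I \<omega>)"
proof
  fix a b :: "complex poly" and h k :: int
  show "module_size I \<omega> a h \<Longrightarrow> 0 \<le> h" by (simp add: module_size_def)
  show "module_size I \<omega> 0 0" using module_size_diag[OF assms, of 0] by simp
  show "module_size I \<omega> 1 1" using module_size_diag[OF assms, of 1] by simp
  show "module_size I \<omega> a h \<Longrightarrow> h \<le> k \<Longrightarrow> module_size I \<omega> a k"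
    unfolding module_size_def by (meson order_trans)
  show "module_size I \<omega> (- a) h" if "module_size I \<omega> a h"
  proof -
    from that obtain G where "0 \<le> h" and G: "\<And>i. i \<in> I \<Longrightarrow>
        Polynomial.smult (\<omega> i) a = (\<Sum>j\<in>I. Polynomial.smult (\<omega> j) (map_poly of_int (G i j)))"
        "\<And>i. i \<in> I \<Longrightarrow> (\<Sum>j\<in>I. poly_l1 (G i j)) \<le> h"
      unfolding module_size_def by blast
    then show ?thesis unfolding module_size_def
      by (intro conjI exI[of _ "\<lambda>i j. - G i j"] ballI)
        (auto simp: poly_l1_minus hom_distribs sum_negf)
  qed
  assume A: "module_size I \<omega> a h" and B: "module_size I \<omega> b k"
  from A obtain G where h: "0 \<le> h" and G: "\<And>i. i \<in> I \<Longrightarrow>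
      Polynomial.smult (\<omega> i) a = (\<Sum>j\<in>I. Polynomial.smult (\<omega> j) (map_poly of_int (G i j)))"
      "\<And>i. i \<in> I \<Longrightarrow> (\<Sum>j\<in>I. poly_l1 (G i j)) \<le> h"
    unfolding module_size_def by blast
  from B obtain H where k: "0 \<le> k" and H: "\<And>i. i \<in> I \<Longrightarrow>
      Polynomial.smult (\<omega> i) b = (\<Sum>j\<in>I. Polynomial.smult (\<omega> j) (map_poly of_int (H i j)))"
      "\<And>i. i \<in> I \<Longrightarrow> (\<Sum>j\<in>I. poly_l1 (H i j)) \<le> k"
    unfolding module_size_def by blast
  show "module_size I \<omega> (a + b) (h + k)" unfolding module_size_def
  proof (intro conjI exI[of _ "\<lambda>i j. G i j + H i j"] ballI)
    fix i assume i: "i \<in> I"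
    show "Polynomial.smult (\<omega> i) (a + b) =
        (\<Sum>j\<in>I. Polynomial.smult (\<omega> j) (map_poly of_int (G i j + H i j)))"
      by (simp add: smult_add_right G[OF i] H[OF i] hom_distribs sum.distrib)
    have "(\<Sum>j\<in>I. poly_l1 (G i j + H i j)) \<le> (\<Sum>j\<in>I. poly_l1 (G i j) + poly_l1 (H i j))"
      by (intro sum_mono poly_l1_add)
    then show "(\<Sum>j\<in>I. poly_l1 (G i j + H i j)) \<le> h + k"
      using G(2)[OF i] H(2)[OF i] by (simp add: sum.distrib)
  qed (use h k in simp)
  show "module_size I \<omega> (a * b) (h * k)" unfolding module_size_def
  proof (intro conjI exI[of _ "\<lambda>i l. \<Sum>j\<in>I. G i j * H j l"] ballI)
    fix i assume i: "i \<in> I"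
    have "Polynomial.smult (\<omega> i) (a * b) =
        (\<Sum>j\<in>I. map_poly of_int (G i j) * Polynomial.smult (\<omega> j) b)"
      unfolding mult_smult_left[symmetric] G(1)[OF i] by (simp add: sum_distrib_right)
    also have "\<dots> = (\<Sum>j\<in>I. \<Sum>l\<in>I. Polynomial.smult (\<omega> l) (map_poly of_int (G i j * H j l)))"
      by (intro sum.cong refl) (simp add: H(1) sum_distrib_left hom_distribs)
    also have "\<dots> = (\<Sum>l\<in>I. Polynomial.smult (\<omega> l) (map_poly of_int (\<Sum>j\<in>I. G i j * H j l)))"
      by (subst sum.swap) (simp add: hom_distribs smult_sum2)
    finally show "Polynomial.smult (\<omega> i) (a * b) =
      (\<Sum>l\<in>I. Polynomial.smult (\<omega> l) (map_poly of_int (\<Sum>j\<in>I. G i j * H j l)))" .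
    have "(\<Sum>l\<in>I. poly_l1 (\<Sum>j\<in>I. G i j * H j l)) \<le> (\<Sum>l\<in>I. \<Sum>j\<in>I. poly_l1 (G i j) * poly_l1 (H j l))"
      by (intro sum_mono order_trans[OF poly_l1_sum] poly_l1_mult)
    also have "\<dots> = (\<Sum>j\<in>I. poly_l1 (G i j) * (\<Sum>l\<in>I. poly_l1 (H j l)))"
      by (subst sum.swap) (simp add: sum_distrib_left)
    also have "\<dots> \<le> (\<Sum>j\<in>I. poly_l1 (G i j) * k)"
      by (intro sum_mono mult_left_mono H poly_l1_nonneg)
    also have "\<dots> \<le> h * k"
      using mult_right_mono[OF G(2)[OF i] k] by (simp add: sum_distrib_right)
    finally show "(\<Sum>l\<in>I. poly_l1 (\<Sum>j\<in>I. G i j * H j l)) \<le> h * k" .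
  qed (use h k in simp)
qed

text \<open>Comparing coefficients of X^k in the defining relations shows that the vector of the
  \<open>\<omega> i\<close> is an eigenvector, with eigenvalue \<open>coeff p k\<close>, of the
  integer matrix formed by the k-th coefficients of \<open>G\<close>. So this coefficient is a root
  of the characteristic polynomial of that matrix, and \<open>int_root_lower_bound\<close> applies.
  The exponent \<open>card I\<close> is the number of generators and does not grow with the matrices
  of the Laplacian.\<close>

lemma module_size_coeff_lower_bound:
  assumes I: "finite I" and \<omega>: "\<exists>i\<in>I. \<omega> i \<noteq> 0" and p: "module_size I \<omega> p h"
    and nz: "coeff p k \<noteq> 0"
  shows "1 / (1 + real_of_int h) ^ card I \<le> cmod (coeff p k)"
proof -
  let ?z = "coeff p k" and ?d = "card I"
  from p obtain G where h: "0 \<le> h" and G: "\<And>i. i \<in> I \<Longrightarrow>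
      Polynomial.smult (\<omega> i) p = (\<Sum>j\<in>I. Polynomial.smult (\<omega> j) (map_poly of_int (G i j)))"
      "\<And>i. i \<in> I \<Longrightarrow> (\<Sum>j\<in>I. poly_l1 (G i j)) \<le> h"
    unfolding module_size_def by blast
  obtain f where f: "bij_betw f {0..<?d} I" using ex_bij_betw_nat_finite[OF I] by blast
  define M where "M = mat ?d ?d (\<lambda>(i, j). coeff (G (f i) (f j)) k)"
  define v where "v = vec ?d (\<lambda>i. \<omega> (f i))"
  have M: "M \<in> carrier_mat ?d ?d" by (simp add: M_def)
  have fI: "f i \<in> I" if "i < ?d" for i using f that by (auto simp: bij_betw_def)
  have "eigenvector (map_mat complex_of_int M) v ?z"
    unfolding eigenvector_def
  proof (intro conjI)
    show "v \<in> carrier_vec (dim_row (map_mat complex_of_int M))" by (simp add: v_def M_def)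
    obtain i where "i \<in> I" "\<omega> i \<noteq> 0" using \<omega> by blast
    moreover then obtain m where "m < ?d" "f m = i" using f unfolding bij_betw_def by force
    ultimately have "v $ m \<noteq> 0\<^sub>v ?d $ m" by (simp add: v_def)
    then show "v \<noteq> 0\<^sub>v (dim_row (map_mat complex_of_int M))" by (auto simp: M_def)
    show "map_mat complex_of_int M *\<^sub>v v = ?z \<cdot>\<^sub>v v"
    proof (rule eq_vecI)
      fix i assume "i < dim_vec (?z \<cdot>\<^sub>v v)"
      then have i: "i < ?d" by (simp add: v_def)
      have "(map_mat complex_of_int M *\<^sub>v v) $ i =
          (\<Sum>j = 0..<?d. of_int (coeff (G (f i) (f j)) k) * \<omega> (f j))"
        using i by (simp add: M_def v_def scalar_prod_def)
      also have "\<dots> = (\<Sum>j\<in>I. of_int (coeff (G (f i) j) k) * \<omega> j)"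
        by (rule sum.reindex_bij_betw[OF f])
      also have "\<dots> = coeff (Polynomial.smult (\<omega> (f i)) p) k"
        unfolding G(1)[OF fI[OF i]] by (simp add: coeff_sum coeff_map_poly mult.commute)
      finally show "(map_mat complex_of_int M *\<^sub>v v) $ i = (?z \<cdot>\<^sub>v v) $ i"
        using i by (simp add: v_def mult.commute)
    qed (simp add: M_def v_def)
  qed
  then have ev: "eigenvalue (map_mat complex_of_int M) ?z" by (auto simp: eigenvalue_def)
  have "poly (map_poly of_int (char_poly M)) ?z = 0"
    using ev M eigenvalue_root_char_poly[of "map_mat complex_of_int M" ?d]
    by (simp add: of_int_hom.char_poly_hom[OF M])
  moreover have "char_poly M \<noteq> 0"
    using degree_monic_char_poly[OF M] by auto
  moreover have "poly_l1 (char_poly M) \<le> (1 + h) ^ ?d"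
  proof (rule poly_l1_char_poly[OF M])
    fix i assume i: "i < ?d"
    have "(\<Sum>j<?d. \<bar>M $$ (i, j)\<bar>) = (\<Sum>j = 0..<?d. \<bar>coeff (G (f i) (f j)) k\<bar>)"
      using i by (simp add: M_def lessThan_atLeast0)
    also have "\<dots> = (\<Sum>j\<in>I. \<bar>coeff (G (f i) j) k\<bar>)"
      by (rule sum.reindex_bij_betw[OF f])
    also have "\<dots> \<le> (\<Sum>j\<in>I. poly_l1 (G (f i) j))"
      by (intro sum_mono abs_coeff_le_poly_l1)
    finally show "(\<Sum>j<?d. \<bar>M $$ (i, j)\<bar>) \<le> h" using G(2)[OF fI[OF i]] by linarith
  qed
  ultimately have "1 / real_of_int ((1 + h) ^ ?d) \<le> cmod ?z"
    using nz h by (intro int_root_lower_bound) auto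
  then show ?thesis by simp
qed

lemma of_int_poly_const: "(map_poly of_int [:c:] :: complex poly) = [:of_int c:]"
  by (simp add: poly_eq_iff coeff_map_poly coeff_pCons split: nat.split)

lemma algebraic_int_poly:
  assumes "algebraic (\<mu>::real)"
  obtains f :: "int poly" where "f \<noteq> 0" "(\<Sum>i\<le>degree f. of_int (coeff f i) * \<mu> ^ i) = 0"
proof -
  from assms obtain p where p: "\<forall>i. coeff p i \<in> \<int>" "p \<noteq> 0" "poly p \<mu> = 0"
    unfolding algebraic_def by blast
  \<comment> \<open>The coefficients of \<open>p\<close> are integral, so \<open>floor\<close>
    merely changes their type.\<close>
  define f where "f = map_poly floor p"
  have c: "of_int (coeff f i) = coeff p i" for i
    using p(1) by (simp add: f_def coeff_map_poly)
  have "degree f = degree p"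
  proof (rule antisym)
    show "degree f \<le> degree p"
      using c by (intro degree_le allI impI) (metis coeff_eq_0 of_int_eq_0_iff)
    show "degree p \<le> degree f"
      using c by (intro degree_le allI impI) (metis coeff_eq_0 of_int_0)
  qed
  moreover have "f \<noteq> 0" using c p(2) by (metis coeff_0 leading_coeff_0_iff of_int_0)
  ultimately show ?thesis using p(3) by (intro that[of f]) (auto simp: c poly_altdef)
qed

text \<open>The generators are the products of an n-th root of unity and a power of mu below the
  degree of \<open>f\<close>. Multiplication by a root of unity permutes them. Multiplication by mu
  raises the power and leaves the range only at the top, where \<open>f\<close> expresses
  \<open>lead_coeff f\<close> times the top power through lower ones; this is why mu is accompanied
  by the leading coefficient.\<close>

lemma module_size_roots_of_unity_powers:
  fixes f :: "int poly" and \<mu> :: complex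
  assumes n: "0 < n" and f: "f \<noteq> 0" "(\<Sum>i\<le>degree f. of_int (coeff f i) * \<mu> ^ i) = 0"
  defines "I \<equiv> {z::complex. z ^ n = 1} \<times> {..<degree f}"
    and "\<omega> \<equiv> \<lambda>(z, i). z * \<mu> ^ i"
  shows "finite I" and "\<exists>i\<in>I. \<omega> i \<noteq> 0"
    and "\<And>s. s ^ n = 1 \<Longrightarrow> module_size I \<omega> [:s:] 1"
    and "module_size I \<omega> [:of_int (lead_coeff f) * \<mu>:] (poly_l1 f)"
proof -
  let ?U = "{z::complex. z ^ n = 1}"
  have U: "finite ?U" using n by (intro finite_roots_unity) simp
  then show fI: "finite I" by (simp add: I_def)
  have deg: "0 < degree f"
  proof (rule ccontr)
    assume "\<not> 0 < degree f"
    then have "degree f = 0" by simp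
    then have "coeff f (degree f) = 0" using f(2) by simp
    then show False using f(1) by simp
  qed
  have 1: "(1, 0) \<in> I" using deg by (simp add: I_def)
  then show "\<exists>i\<in>I. \<omega> i \<noteq> 0" by (rule bexI[rotated]) (simp add: \<omega>_def)
  show "module_size I \<omega> [:s:] 1" if s: "s ^ n = 1" for s
    unfolding module_size_def
  proof (intro conjI exI[of _ "\<lambda>x y. if y = (s * fst x, snd x) then 1 else 0"] ballI)
    fix x assume x: "x \<in> I"
    then have y: "(s * fst x, snd x) \<in> I" using s by (auto simp: I_def power_mult_distrib)
    have "(\<Sum>j\<in>I. Polynomial.smult (\<omega> j) (map_poly of_int (if j = (s * fst x, snd x) then 1 else 0))) =
      (\<Sum>j\<in>I. if j = (s * fst x, snd x) then [:\<omega> j:] else 0)"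
      by (intro sum.cong) auto
    then show "Polynomial.smult (\<omega> x) [:s:] =
       (\<Sum>j\<in>I. Polynomial.smult (\<omega> j) (map_poly of_int (if j = (s * fst x, snd x) then 1 else 0)))"
      using y fI by (simp add: \<omega>_def split: prod.splits)
    have "(\<Sum>j\<in>I. poly_l1 (if j = (s * fst x, snd x) then 1 else 0)) =
      (\<Sum>j\<in>I. if j = (s * fst x, snd x) then 1 else 0)"
      by (intro sum.cong) auto
    then show "(\<Sum>j\<in>I. poly_l1 (if j = (s * fst x, snd x) then 1 else 0)) \<le> 1"
      using y fI by simp
  qed simp
  \<comment> \<open>On each block with fixed z this is the companion matrix of \<open>f\<close>
    times its leading coefficient: a shift, except for the last row, which carries the negated lower
    coefficients.\<close>
  define G where "G = (\<lambda>(z :: complex, i) (w :: complex, j). if w = z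
    then (if i + 1 < degree f then (if j = i + 1 then lead_coeff f else 0) else - coeff f j) else 0)"
  show "module_size I \<omega> [:of_int (lead_coeff f) * \<mu>:] (poly_l1 f)"
    unfolding module_size_def
  proof (intro conjI exI[of _ "\<lambda>x y. [:G x y:]"] ballI poly_l1_nonneg)
    fix x assume x: "x \<in> I"
    obtain z i where xz: "x = (z, i)" by force
    have z: "z \<in> ?U" and i: "i < degree f" using x xz by (auto simp: I_def)
    have sum1: "(\<Sum>y\<in>I. F y (G x y)) = (\<Sum>j<degree f. F (z, j) (G x (z, j)))"
      if "\<And>y. F y 0 = 0" for F :: "complex \<times> nat \<Rightarrow> int \<Rightarrow> 'z::comm_monoid_add"
    proof -
      have "(\<Sum>y\<in>I. F y (G x y)) = (\<Sum>w\<in>?U. \<Sum>j<degree f. F (w, j) (G x (w, j)))"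
        unfolding I_def by (simp add: sum.cartesian_product)
      also have "\<dots> = (\<Sum>w\<in>?U. if w = z then \<Sum>j<degree f. F (z, j) (G x (z, j)) else 0)"
        using that by (intro sum.cong) (auto simp: G_def xz)
      finally show ?thesis using U z by simp
    qed
    have const: "(\<Sum>j\<in>J. [:g j:]) = [:sum g J:]" for g :: "nat \<Rightarrow> complex" and J
      by (induction J rule: infinite_finite_induct) auto
    have "of_int (lead_coeff f) * \<mu> * \<omega> x = (\<Sum>j<degree f. of_int (G x (z, j)) * \<omega> (z, j))"
    proof (cases "i + 1 < degree f")
      case True
      have "(\<Sum>j<degree f. of_int (G x (z, j)) * \<omega> (z, j)) =
          (\<Sum>j<degree f. if j = i + 1 then of_int (lead_coeff f) * \<omega> (z, j) else 0)"
        using True by (intro sum.cong) (auto simp: G_def xz)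
      then show ?thesis using True by (simp add: \<omega>_def xz)
    next
      case False
      then have i1: "Suc i = degree f" using i by simp
      have "(\<Sum>j<degree f. of_int (coeff f j) * \<mu> ^ j) + of_int (lead_coeff f) * \<mu> ^ degree f = 0"
        using f(2) deg by (simp add: lessThan_Suc_atMost[symmetric])
      then have "of_int (lead_coeff f) * \<mu> ^ degree f = - (\<Sum>j<degree f. of_int (coeff f j) * \<mu> ^ j)"
        by (simp add: add_eq_0_iff2)
      then have "z * (of_int (lead_coeff f) * \<mu> ^ Suc i) =
          z * - (\<Sum>j<degree f. of_int (coeff f j) * \<mu> ^ j)"
        unfolding i1 by simp
      then show ?thesis using False
        by (simp add: G_def xz \<omega>_def sum_distrib_left sum_negf algebra_simps)
    qed
    then show "Polynomial.smult (\<omega> x) [:of_int (lead_coeff f) * \<mu>:] =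
        (\<Sum>y\<in>I. Polynomial.smult (\<omega> y) (map_poly of_int [:G x y:]))"
      using sum1[of "\<lambda>y c. [:of_int c * \<omega> y:]"] const[of "\<lambda>j. of_int (G x (z, j)) * \<omega> (z, j)"]
      by (simp add: of_int_poly_const mult.commute)
    have "(\<Sum>y\<in>I. poly_l1 [:G x y:]) = (\<Sum>j<degree f. \<bar>G x (z, j)\<bar>)"
      using sum1[of "\<lambda>y c. \<bar>c\<bar>"] by simp
    also have "\<dots> \<le> poly_l1 f"
    proof (cases "i + 1 < degree f")
      case True
      have "(\<Sum>j<degree f. \<bar>G x (z, j)\<bar>) = (\<Sum>j<degree f. if j = i + 1 then \<bar>lead_coeff f\<bar> else 0)"
        using True by (intro sum.cong) (auto simp: G_def xz)
      then show ?thesis using True abs_coeff_le_poly_l1[of f "degree f"] by simp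
    next
      case False
      have "(\<Sum>j<degree f. \<bar>G x (z, j)\<bar>) = (\<Sum>j<degree f. \<bar>coeff f j\<bar>)"
        using False by (intro sum.cong) (auto simp: G_def xz)
      also have "\<dots> \<le> (\<Sum>j\<le>degree f. \<bar>coeff f j\<bar>)" by (rule sum_mono2) auto
      finally show ?thesis using sum_abs_coeff_le_poly_l1[of f "degree f"] by linarith
    qed
    finally show "(\<Sum>y\<in>I. poly_l1 [:G x y:]) \<le> poly_l1 f" .
  qed
qed

text \<open>Clearing the leading coefficient of a polynomial annihilating \<open>\<mu>\<close> turns the entries of
  $X - A$ into elements of bounded size, whence the exponential lower bound.\<close>

lemma algebraic_char_poly_coeff_bound:
  fixes \<mu> :: real and n D :: nat
  assumes "algebraic \<mu>" and n: "0 < n"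
  shows "\<exists>K\<ge>1. \<forall>N A dg E (\<sigma> :: 'e \<Rightarrow> complex) k. A \<in> carrier_mat N N \<longrightarrow>
    (\<forall>i<N. \<forall>j<N. A $$ (i, j) = (if i = j then of_nat (dg i) - complex_of_real \<mu> else 0)
        - (\<Sum>e\<in>E i j. \<sigma> e) \<and> (\<forall>e\<in>E i j. \<sigma> e ^ n = 1)) \<longrightarrow>
    (\<forall>i<N. dg i \<le> D \<and> (\<Sum>j<N. card (E i j)) \<le> D) \<longrightarrow>
    coeff (char_poly A) k \<noteq> 0 \<longrightarrow> 1 \<le> K ^ N * cmod (coeff (char_poly A) k)"
proof -
  obtain f :: "int poly" where f: "f \<noteq> 0" "(\<Sum>i\<le>degree f. of_int (coeff f i) * \<mu> ^ i) = 0"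
    by (rule algebraic_int_poly[OF assms(1)])
  have f': "(\<Sum>i\<le>degree f. of_int (coeff f i) * complex_of_real \<mu> ^ i) = 0"
    using arg_cong[OF f(2), of complex_of_real] by simp
  define I where "I = {z::complex. z ^ n = 1} \<times> {..<degree f}"
  define \<omega> where "\<omega> = (\<lambda>(z :: complex, i). z * complex_of_real \<mu> ^ i)"
  note I = module_size_roots_of_unity_powers[OF n f(1) f', folded I_def \<omega>_def]
  interpret ms: ring_size "module_size I \<omega>" by (rule ring_size_module_size[OF I(1)])
  let ?a = "lead_coeff f"
  \<comment> \<open>The four terms bound one row of X - A after multiplication by \<open>?a\<close>:
    the variable X, the valence, mu together with \<open>?a\<close>, and the at most D arcs of the
    row, whose weights have size 1.\<close>
  define H where "H = \<bar>?a\<bar> + \<bar>?a\<bar> * int D + poly_l1 f + \<bar>?a\<bar> * int D"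
  \<comment> \<open>Multiplying each of the N rows by \<open>?a\<close> scales the coefficients by
    the N-th power of \<open>?a\<close>, which the first factor undoes; the exponent
    \<open>card I\<close> comes from the lower bound for coefficients.\<close>
  define K where "K = real_of_int \<bar>?a\<bar> * (1 + real_of_int H) ^ card I"
  have a: "1 \<le> \<bar>?a\<bar>" using f(1) leading_coeff_0_iff[of f] by linarith
  have H: "1 \<le> H" 
  proof -
    have "0 \<le> \<bar>?a\<bar> * int D" by simp
    then show ?thesis using a poly_l1_nonneg[of f] unfolding H_def by linarith
  qed
  have K: "1 \<le> K" unfolding K_def
    using a H mult_mono[of 1 "real_of_int \<bar>?a\<bar>" 1 "(1 + real_of_int H) ^ card I"] by simp
  show ?thesis
  proof (intro exI[of _ K] conjI allI impI K)
    fix N A dg and E :: "nat \<Rightarrow> nat \<Rightarrow> 'e set" and \<sigma> k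
    assume A: "A \<in> carrier_mat N N"
      and ent: "\<forall>i<N. \<forall>j<N. A $$ (i, j) = (if i = j then of_nat (dg i) - complex_of_real \<mu> else 0)
        - (\<Sum>e\<in>E i j. \<sigma> e) \<and> (\<forall>e\<in>E i j. \<sigma> e ^ n = 1)"
      and deg: "\<forall>i<N. dg i \<le> D \<and> (\<Sum>j<N. card (E i j)) \<le> D"
      and nz: "coeff (char_poly A) k \<noteq> 0"
    show "1 \<le> K ^ N * cmod (coeff (char_poly A) k)"
    \<comment> \<open>The empty matrix is treated apart because the estimate 1 + H^N <= (1 + H)^N
      used below needs N >= 1.\<close>
    proof (cases "N = 0")
      case True
      then have "char_poly A = 1" using A by (simp add: char_poly_def char_poly_matrix_def)
      then show ?thesis using True nz by (cases k) auto
    next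
      case False
      let ?M = "[:of_int ?a:] \<cdot>\<^sub>m char_poly_matrix A"
      define h where "h = (\<lambda>i j. (if i = j then \<bar>?a\<bar> + (\<bar>?a\<bar> * int D + poly_l1 f) else 0)
        + \<bar>?a\<bar> * int (card (E i j)))"
      have ca: "module_size I \<omega> [:of_int c:] \<bar>c\<bar>" for c
        using module_size_diag[OF I(1), of "[:c:]" "\<bar>c\<bar>"] by (simp add: of_int_poly_const)
      have X: "module_size I \<omega> [:0, 1:] 1"
        using module_size_diag[OF I(1), of "[:0, 1:]" 1] by (simp add: map_poly_pCons)
      have const: "(\<Sum>e\<in>J. [:g e:]) = [:\<Sum>e\<in>J. g e:]" for g :: "'e \<Rightarrow> complex" and J
        by (induction J rule: infinite_finite_induct) auto
      have "module_size I \<omega> (Determinant.det ?M) (\<Prod>i<N. \<Sum>j<N. h i j)"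
      proof (rule ms.size_det)
        show "?M \<in> carrier_mat N N" using A by simp
        fix i j assume ij: "i < N" "j < N"
        have S: "module_size I \<omega> ([:of_int ?a:] * (\<Sum>e\<in>E i j. [:\<sigma> e:]))
            (\<bar>?a\<bar> * (\<Sum>e\<in>E i j. 1))"
          using ent ij by (intro ms.mult ca ms.size_sum I(3)) auto
        have D: "module_size I \<omega> ([:of_int ?a:] * [:0, 1:] -
            ([:of_int ?a:] * [:of_int (int (dg i)):] - [:of_int ?a * complex_of_real \<mu>:]))
            (\<bar>?a\<bar> * 1 + (\<bar>?a\<bar> * int D + poly_l1 f))"
          unfolding diff_conv_add_uminus
          using deg ij by (intro ms.add ms.mult ms.uminus ca X I(4) ms.mono[OF ca]) auto
        show "module_size I \<omega> (?M $$ (i, j)) (h i j)"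
        proof (cases "i = j")
          case True
          have "?M $$ (i, j) = ([:of_int ?a:] * [:0, 1:] -
            ([:of_int ?a:] * [:of_int (int (dg i)):] - [:of_int ?a * complex_of_real \<mu>:])) +
            [:of_int ?a:] * (\<Sum>e\<in>E i j. [:\<sigma> e:])"
          proof -
            have "A $$ (j, j) = of_nat (dg j) - complex_of_real \<mu> - (\<Sum>e\<in>E j j. \<sigma> e)"
              using ent ij True by auto
            then show ?thesis using A ij True
              by (simp add: char_poly_matrix_def const) (simp add: algebra_simps)
          qed
          then show ?thesis using ms.add[OF D S] True by (simp add: h_def)
        next
          case False
          have "?M $$ (i, j) = [:of_int ?a:] * (\<Sum>e\<in>E i j. [:\<sigma> e:])"
            using A ij ent False by (simp add: char_poly_matrix_def const)
          then show ?thesis using S False by (simp add: h_def)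
        qed
      qed
      moreover have "(\<Prod>i<N. \<Sum>j<N. h i j) \<le> (\<Prod>i<N. H)"
      proof (intro prod_mono conjI)
        fix i assume i: "i \<in> {..<N}"
        show "0 \<le> (\<Sum>j<N. h i j)"
          using poly_l1_nonneg[of f] by (intro sum_nonneg) (auto simp: h_def)
        have "(\<Sum>j<N. card (E i j)) \<le> D" using deg i by blast
        then have "int (\<Sum>j<N. card (E i j)) \<le> int D" by (simp only: of_nat_le_iff)
        then have "\<bar>?a\<bar> * int (\<Sum>j<N. card (E i j)) \<le> \<bar>?a\<bar> * int D"
          by (rule mult_left_mono) simp
        then show "(\<Sum>j<N. h i j) \<le> H"
          using i by (simp add: h_def H_def sum.distrib sum_distrib_left mult.commute)
      qed
      ultimately have "module_size I \<omega> (Determinant.det ?M) (H ^ N)"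
        using ms.mono by simp
      moreover have "Determinant.det ?M = [:of_int ?a:] ^ N * char_poly A"
        using A by (simp add: det_smult char_poly_def char_poly_matrix_def)
      moreover have "[:of_int ?a:] ^ N = [:complex_of_int ?a ^ N:]"
        by (simp add: poly_const_pow)
      ultimately have *: "module_size I \<omega> (Polynomial.smult (of_int ?a ^ N) (char_poly A)) (H ^ N)"
        by simp
      have "1 / (1 + real_of_int (H ^ N)) ^ card I \<le> cmod (of_int ?a ^ N * coeff (char_poly A) k)"
        using module_size_coeff_lower_bound[OF I(1,2) *, of k] nz f(1) by simp
      then have "1 \<le> (1 + real_of_int H ^ N) ^ card I * (\<bar>of_int ?a\<bar> ^ N * cmod (coeff (char_poly A) k))"
        using H by (simp add: norm_mult norm_power field_simps add_pos_pos)
      also have "\<dots> \<le> ((1 + real_of_int H) ^ N) ^ card I *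
          (\<bar>of_int ?a\<bar> ^ N * cmod (coeff (char_poly A) k))"
      proof (intro mult_right_mono power_mono)
        have "1 + real_of_int H ^ M \<le> (1 + real_of_int H) ^ M" if "M \<ge> 1" for M
          using that
        proof (induction M rule: dec_induct)
          case (step M)
          have "1 + real_of_int H ^ Suc M \<le> (1 + real_of_int H) * (1 + real_of_int H ^ M)"
            using H by (simp add: algebra_simps)
          also have "\<dots> \<le> (1 + real_of_int H) * (1 + real_of_int H) ^ M"
            using step H by (intro mult_left_mono) auto
          finally show ?case by simp
        qed simp
        then show "1 + real_of_int H ^ N \<le> (1 + real_of_int H) ^ N" using False by simp
      qed (use H in auto)
      also have "\<dots> = K ^ N * cmod (coeff (char_poly A) k)"
        by (simp add: K_def power_mult_distrib mult_ac flip: power_mult)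
      finally show ?thesis .
    qed
  qed
qed

section \<open>Characteristic polynomials of Hermitian matrices\<close>

text \<open>The factors with root 0 contribute X^t, and the constant term of the product of the
  others is the product of their -e.\<close>

lemma coeff_prod_linear_factors:
  fixes es :: "complex list"
  defines "t \<equiv> length (filter (\<lambda>e. e = 0) es)"
  shows "(\<forall>k<t. coeff (\<Prod>e\<leftarrow>es. [:- e, 1:]) k = 0) \<and>
    coeff (\<Prod>e\<leftarrow>es. [:- e, 1:]) t = (\<Prod>e\<leftarrow>filter (\<lambda>e. e \<noteq> 0) es. - e)"
  unfolding t_def
proof (induction es)
  case (Cons e es)
  let ?P = "\<Prod>e\<leftarrow>es. [:- e, 1:]" and ?t = "length (filter (\<lambda>e. e = 0) es)"
  have c: "coeff ([:- e, 1:] * ?P) k = - e * coeff ?P k + (if k = 0 then 0 else coeff ?P (k - 1))" for k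
    by (simp add: coeff_pCons split: nat.split)
  show ?case
  proof (cases "e = 0")
    case True
    then show ?thesis using Cons.IH c by auto
  next
    case False
    then show ?thesis using Cons.IH c by auto
  qed
qed simp

section \<open>Traces of powers and eigenvalues\<close>

lemma upper_triangular_pow:
  fixes B :: "'a::comm_ring_1 mat"
  assumes B: "B \<in> carrier_mat n n" "upper_triangular B"
  shows "upper_triangular (B ^\<^sub>m k) \<and> (\<forall>i<n. (B ^\<^sub>m k) $$ (i, i) = (B $$ (i, i)) ^ k)"
proof (induction k)
  case 0
  then show ?case using B by auto
next
  case (Suc k)
  let ?C = "B ^\<^sub>m k"
  have C: "?C \<in> carrier_mat n n" using B by simp
  have e: "(?C * B) $$ (i, j) = (\<Sum>l = 0..<n. ?C $$ (i, l) * B $$ (l, j))" if "i < n" "j < n" for i j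
    using that B C by (simp add: scalar_prod_def)
  have z: "?C $$ (i, l) * B $$ (l, j) = 0" if "i < n" "l < n" "j < n" "l < i \<or> j < l" for i j l
    using that Suc B C by (auto dest: upper_triangularD)
  have "upper_triangular (?C * B)"
  proof (rule upper_triangularI)
    fix i j assume "j < i" "i < dim_row (?C * B)"
    then have ij: "j < i" "i < n" using C by auto
    show "(?C * B) $$ (i, j) = 0"
      unfolding e[OF ij(2) less_trans[OF ij]] using ij
      by (intro sum.neutral ballI z) auto
  qed
  moreover have "(?C * B) $$ (i, i) = (B $$ (i, i)) ^ Suc k" if i: "i < n" for i
  proof -
    have "(?C * B) $$ (i, i) = (\<Sum>l\<in>{i}. ?C $$ (i, l) * B $$ (l, i))"
      unfolding e[OF i i] using i by (intro sum.mono_neutral_right ballI z) auto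
    then show ?thesis using Suc i by (simp add: mult.commute)
  qed
  ultimately show ?case by simp
qed

lemma sum_diag_mult_commute:
  fixes A B :: "'a::comm_ring_1 mat"
  assumes "A \<in> carrier_mat n n" "B \<in> carrier_mat n n"
  shows "(\<Sum>i<n. (A * B) $$ (i, i)) = (\<Sum>i<n. (B * A) $$ (i, i))"
proof -
  have "(\<Sum>i<n. (A * B) $$ (i, i)) = (\<Sum>i<n. \<Sum>j<n. A $$ (i, j) * B $$ (j, i))"
    using assms by (intro sum.cong) (auto simp: scalar_prod_def lessThan_atLeast0)
  also have "\<dots> = (\<Sum>j<n. \<Sum>i<n. A $$ (i, j) * B $$ (j, i))" by (rule sum.swap)
  also have "\<dots> = (\<Sum>i<n. (B * A) $$ (i, i))"
    using assms by (intro sum.cong) (auto simp: scalar_prod_def lessThan_atLeast0 mult.commute)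
  finally show ?thesis .
qed

text \<open>After Schur triangularisation the trace of the k-th power is unchanged by the
  similarity, and the diagonal of a power of a triangular matrix consists of the powers of its
  diagonal.\<close>

lemma trace_pow_eq_sum_eigenvalues:
  fixes A :: "complex mat"
  assumes A: "A \<in> carrier_mat n n" and es: "char_poly A = (\<Prod>e\<leftarrow>es. [:- e, 1:])"
  shows "(\<Sum>i<n. (A ^\<^sub>m k) $$ (i, i)) = (\<Sum>e\<leftarrow>es. e ^ k)"
proof -
  obtain B P Q where "schur_decomposition A es = (B, P, Q)"
    by (cases "schur_decomposition A es") auto
  note sch = schur_decomposition[OF A es this]
  then have sim: "similar_mat_wit A B P Q" and ut: "upper_triangular B" and diag: "diag_mat B = es"
    by auto
  from similar_mat_witD2[OF A sim] have c: "B \<in> carrier_mat n n" "P \<in> carrier_mat n n"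
      "Q \<in> carrier_mat n n" "Q * P = 1\<^sub>m n"
    by auto
  have Bk: "B ^\<^sub>m k \<in> carrier_mat n n" using c by simp
  have "(\<Sum>i<n. (A ^\<^sub>m k) $$ (i, i)) = (\<Sum>i<n. (P * (B ^\<^sub>m k * Q)) $$ (i, i))"
    using similar_mat_wit_pow_id[OF sim, of k] assoc_mult_mat[OF c(2) Bk c(3)] by simp
  also have "\<dots> = (\<Sum>i<n. ((B ^\<^sub>m k * Q) * P) $$ (i, i))"
    using c Bk by (intro sum_diag_mult_commute) auto
  also have "(B ^\<^sub>m k * Q) * P = B ^\<^sub>m k"
    using assoc_mult_mat[OF Bk c(3,2)] c(4) right_mult_one_mat[OF Bk] by simp
  also have "(\<Sum>i<n. (B ^\<^sub>m k) $$ (i, i)) = (\<Sum>i<n. (B $$ (i, i)) ^ k)"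
    using upper_triangular_pow[OF c(1) ut, of k] by simp
  also have "\<dots> = (\<Sum>e\<leftarrow>es. e ^ k)"
    using c(1) by (simp add: diag[symmetric] diag_mat_def interv_sum_list_conv_sum_set_nat
        lessThan_atLeast0 comp_def)
  finally show ?thesis .
qed

text \<open>Reality follows from the quadratic form at an eigenvector; the bound follows by
  evaluating the eigenvalue equation at a coordinate of maximal modulus.\<close>

lemma hermitian_eigenvalue:
  fixes A :: "complex mat"
  assumes A: "A \<in> carrier_mat n n"
    and herm: "\<And>i j. i < n \<Longrightarrow> j < n \<Longrightarrow> A $$ (j, i) = cnj (A $$ (i, j))"
    and C: "\<And>i. i < n \<Longrightarrow> (\<Sum>j<n. cmod (A $$ (i, j))) \<le> C"
    and ev: "eigenvalue A e"
  shows "e \<in> \<real>" and "cmod e \<le> C"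
proof -
  obtain v where v: "v \<in> carrier_vec n" "v \<noteq> 0\<^sub>v n" "A *\<^sub>v v = e \<cdot>\<^sub>v v"
    using ev A by (auto simp: eigenvalue_def eigenvector_def)
  have Av: "(\<Sum>j<n. A $$ (i, j) * v $ j) = e * v $ i" if "i < n" for i
    using arg_cong[OF v(3), of "\<lambda>w. w $ i"] that A v(1)
    by (simp add: scalar_prod_def lessThan_atLeast0)
  define s where "s = (\<Sum>i<n. cnj (v $ i) * v $ i)"
  define q where "q = (\<Sum>i<n. \<Sum>j<n. cnj (v $ i) * A $$ (i, j) * v $ j)"
  have "q = e * s"
    unfolding q_def s_def sum_distrib_left
    by (intro sum.cong refl) (simp add: Av mult.assoc mult.left_commute[of e] flip: sum_distrib_left)
  moreover have "cnj q = q"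
  proof -
    have "cnj q = (\<Sum>i<n. \<Sum>j<n. v $ i * A $$ (j, i) * cnj (v $ j))"
      unfolding q_def cnj_sum by (intro sum.cong) (auto simp: herm[symmetric])
    also have "\<dots> = q" unfolding q_def by (subst sum.swap) (simp add: mult_ac)
    finally show ?thesis .
  qed
  moreover have s: "s = of_real (\<Sum>i<n. (cmod (v $ i))\<^sup>2)"
    unfolding s_def of_real_sum complex_norm_square by (simp add: mult.commute)
  moreover have "s \<noteq> 0"
  proof
    assume "s = 0"
    then have "(\<Sum>i<n. (cmod (v $ i))\<^sup>2) = 0" using s by (simp flip: of_real_sum)
    then have "\<forall>i<n. v $ i = 0" by (simp add: sum_nonneg_eq_0_iff)
    then show False using v(1,2) by (metis carrier_vecD eq_vecI index_zero_vec)
  qed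
  ultimately have "cnj e = e" by simp
  then show "e \<in> \<real>" by (simp add: Reals_cnj_iff)
  obtain i where i: "i < n" "v $ i \<noteq> 0"
    using v(1,2) by (metis carrier_vecD eq_vecI index_zero_vec)
  define m where "m = Max ((\<lambda>i. cmod (v $ i)) ` {..<n})"
  have le: "cmod (v $ j) \<le> m" if "j < n" for j using that by (simp add: m_def)
  have "m \<in> (\<lambda>i. cmod (v $ i)) ` {..<n}" unfolding m_def using i by (intro Max_in) auto
  then obtain l where l: "l < n" "m = cmod (v $ l)" by auto
  have m: "0 < m" using le[OF i(1)] i(2) by (meson less_le_trans zero_less_norm_iff)
  have "cmod e * m = cmod (\<Sum>j<n. A $$ (l, j) * v $ j)"
    using Av[OF l(1)] l(2) by (simp add: norm_mult)
  also have "\<dots> \<le> (\<Sum>j<n. cmod (A $$ (l, j)) * m)"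
    by (intro sum_norm_le) (auto simp: norm_mult intro!: mult_left_mono le)
  also have "\<dots> \<le> C * m"
    using C[OF l(1)] m by (simp add: mult_right_mono flip: sum_distrib_right)
  finally show "cmod e \<le> C" using m by simp
qed

text \<open>The coefficient in question is the lowest nonvanishing one.\<close>

lemma hermitian_spectrum:
  fixes A :: "complex mat"
  assumes A: "A \<in> carrier_mat n n"
    and herm: "\<And>i j. i < n \<Longrightarrow> j < n \<Longrightarrow> A $$ (j, i) = cnj (A $$ (i, j))"
    and C: "\<And>i. i < n \<Longrightarrow> (\<Sum>j<n. cmod (A $$ (i, j))) \<le> C"
  obtains es :: "real list" where "length es = n" "\<And>e. e \<in> set es \<Longrightarrow> \<bar>e\<bar> \<le> C"
    "\<And>k. (\<Sum>i<n. (A ^\<^sub>m k) $$ (i, i)) = complex_of_real (\<Sum>e\<leftarrow>es. e ^ k)"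
    "\<exists>k. coeff (char_poly A) k \<noteq> 0 \<and>
      cmod (coeff (char_poly A) k) = (\<Prod>e\<leftarrow>filter (\<lambda>e. e \<noteq> 0) es. \<bar>e\<bar>)"
proof -
  obtain cs where cs: "char_poly A = (\<Prod>e\<leftarrow>cs. [:- e, 1:])" "length cs = n"
    using char_poly_factorized[OF A] by blast
  have ev: "c \<in> \<real> \<and> cmod c \<le> C" if "c \<in> set cs" for c
  proof -
    have "poly (char_poly A) c = 0"
      unfolding cs(1) using that by (induction cs) auto
    then have "eigenvalue A c" using eigenvalue_root_char_poly[OF A] by simp
    from hermitian_eigenvalue[OF A herm C this] show ?thesis by simp
  qed
  define es where "es = map Re cs"
  have cs_es: "cs = map complex_of_real es"
    unfolding es_def using ev by (simp add: map_idI of_real_Re)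
  show ?thesis
  proof (rule that[of es])
    show "length es = n" using cs(2) by (simp add: es_def)
    show "\<bar>e\<bar> \<le> C" if "e \<in> set es" for e
      using that ev[of "complex_of_real e"] by (auto simp: cs_es)
    show "(\<Sum>i<n. (A ^\<^sub>m k) $$ (i, i)) = complex_of_real (\<Sum>e\<leftarrow>es. e ^ k)" for k
    proof -
      have "(\<Sum>e\<leftarrow>map complex_of_real es. e ^ k) = complex_of_real (\<Sum>e\<leftarrow>es. e ^ k)"
        by (induction es) auto
      then show ?thesis by (simp add: trace_pow_eq_sum_eigenvalues[OF A cs(1)] cs_es)
    qed
    have "cmod (\<Prod>e\<leftarrow>filter (\<lambda>e. e \<noteq> 0) (map complex_of_real es). - e) =
        (\<Prod>e\<leftarrow>filter (\<lambda>e. e \<noteq> 0) es. \<bar>e\<bar>)"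
      by (induction es) (auto simp: norm_mult)
    moreover have "(\<Prod>e\<leftarrow>filter (\<lambda>e. e \<noteq> 0) es. \<bar>e\<bar>) \<noteq> 0"
      by (induction es) auto
    ultimately show "\<exists>k. coeff (char_poly A) k \<noteq> 0 \<and>
      cmod (coeff (char_poly A) k) = (\<Prod>e\<leftarrow>filter (\<lambda>e. e \<noteq> 0) es. \<bar>e\<bar>)"
      using coeff_prod_linear_factors[of cs] unfolding cs(1) cs_es
      by (metis norm_zero)
  qed
qed

section \<open>The Hausdorff moment problem\<close>

text \<open>The identity (n choose k)(k choose j) = (n choose j)(n-j choose k-j) reduces this to the
  binomial theorem. It will be applied to the polynomials C + X and C - X, whose sum is
  constant.\<close>

lemma binomial_weighted_sum:
  fixes a b :: "'a::comm_ring_1"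
  assumes "j \<le> n"
  shows "(\<Sum>k\<le>n. of_nat (n choose k) * of_nat (k choose j) * (a ^ k * b ^ (n - k))) =
    of_nat (n choose j) * a ^ j * (a + b) ^ (n - j)"
proof -
  have "(\<Sum>k\<le>n. of_nat (n choose k) * of_nat (k choose j) * (a ^ k * b ^ (n - k))) =
    (\<Sum>k\<in>{j..n}. of_nat (n choose k) * of_nat (k choose j) * (a ^ k * b ^ (n - k)))"
    by (rule sum.mono_neutral_right) (auto simp: binomial_eq_0)
  also have "\<dots> = (\<Sum>i\<le>n - j. of_nat (n choose j) * a ^ j * (of_nat (n - j choose i) * a ^ i * b ^ (n - j - i)))"
  proof (rule sum.reindex_bij_witness[of _ "\<lambda>i. i + j" "\<lambda>k. k - j"])
    fix k assume k: "k \<in> {j..n}"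
    then have "(n choose k) * (k choose j) = (n choose j) * (n - j choose (k - j))"
      by (intro choose_mult) auto
    then have c: "(of_nat (n choose k) * of_nat (k choose j) :: 'a) =
        of_nat (n choose j) * of_nat (n - j choose (k - j))"
      by (metis of_nat_mult)
    have p: "a ^ k = a ^ j * a ^ (k - j)" "n - j - (k - j) = n - k"
      using k by (auto simp flip: power_add)
    show "of_nat (n choose j) * a ^ j * (of_nat (n - j choose (k - j)) * a ^ (k - j) * b ^ (n - j - (k - j))) =
        of_nat (n choose k) * of_nat (k choose j) * (a ^ k * b ^ (n - k))"
      unfolding c p by (simp add: mult_ac)
  qed (use assms in auto)
  also have "\<dots> = of_nat (n choose j) * a ^ j * (a + b) ^ (n - j)"
    by (simp add: binomial_ring sum_distrib_left)
  finally show ?thesis .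
qed

text \<open>Both terms are products of j factors of modulus at most 1, so they differ by at most the
  sum of the differences of the factors, each of which is at most 2j/n because n - i >= n/2. This is
  the passage from factorial moments to power moments.\<close>

lemma binomial_ratio_approx:
  assumes k: "k \<le> n" and n: "2 * j < n"
  shows "\<bar>real (k choose j) / real (n choose j) - (real k / real n) ^ j\<bar> \<le> real j * (2 * real j / real n)"
proof -
  have "real (k choose j) / real (n choose j) =
      (\<Prod>i = 0..<j. real k - real i) / (\<Prod>i = 0..<j. real n - real i)"
    by (simp add: binomial_gbinomial gbinomial_prod_rev)
  also have "\<dots> = (\<Prod>i = 0..<j. (real k - real i) / (real n - real i))"
    by (simp add: prod_dividef)
  finally have e: "real (k choose j) / real (n choose j) = (\<Prod>i = 0..<j. (real k - real i) / (real n - real i))" .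
  have "norm ((\<Prod>i = 0..<j. (real k - real i) / (real n - real i)) - (\<Prod>i = 0..<j. real k / real n))
    \<le> (\<Sum>i = 0..<j. norm ((real k - real i) / (real n - real i) - real k / real n))"
  proof (rule norm_prod_diff)
    fix i assume i: "i \<in> {0..<j}"
    then have "\<bar>real k - real i\<bar> \<le> real n - real i" using k n by auto
    then show "norm ((real k - real i) / (real n - real i)) \<le> 1" using n i by simp
    show "norm (real k / real n) \<le> 1" using k n by (simp add: divide_le_eq_1)
  qed
  also have "\<dots> \<le> (\<Sum>i = 0..<j. 2 * real j / real n)"
  proof (rule sum_mono)
    fix i assume i: "i \<in> {0..<j}"
    then have ni: "0 < real n - real i" "real n \<le> 2 * (real n - real i)" using n by auto
    have "(real k - real i) / (real n - real i) - real k / real n =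
        real i * (real k - real n) / (real n * (real n - real i))"
      using ni n by (simp add: field_simps)
    then have "norm ((real k - real i) / (real n - real i) - real k / real n) =
        real i * (real n - real k) / (real n * (real n - real i))"
      using ni k by (simp add: abs_mult)
    also have "\<dots> \<le> real j * real n / (real n * (real n - real i))"
      using i k ni by (intro divide_right_mono mult_mono) auto
    also have "\<dots> = real j / (real n - real i)" using n by simp
    also have "\<dots> \<le> real j / (real n / 2)" using ni n by (intro divide_left_mono) auto
    finally show "norm ((real k - real i) / (real n - real i) - real k / real n) \<le> 2 * real j / real n"
      by (simp add: mult.commute)
  qed
  finally show ?thesis unfolding e by simp
qed

lemma real_distribution_finite:
  fixes w x :: "nat \<Rightarrow> real"
  assumes w: "\<And>k. k \<le> n \<Longrightarrow> 0 \<le> w k" and sum: "(\<Sum>k\<le>n. w k) = 1"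
  defines "D \<equiv> distr (point_measure {..n} w) borel x"
  shows "real_distribution D"
    and "\<And>h. h \<in> borel_measurable borel \<Longrightarrow> (\<integral>t. h t \<partial>D) = (\<Sum>k\<le>n. w k * h (x k))"
    and "\<And>S. S \<in> sets borel \<Longrightarrow> (\<And>k. k \<le> n \<Longrightarrow> x k \<in> S) \<Longrightarrow> measure D S = 1"
proof -
  have x: "x \<in> point_measure {..n} w \<rightarrow>\<^sub>M borel" by (simp add: measurable_point_measure_eq1)
  have "(\<Sum>k\<le>n. ennreal (w k)) = ennreal (\<Sum>k\<le>n. w k)"
    using w by (intro sum_ennreal) auto
  then have "emeasure (point_measure {..n} w) {..n} = 1"
    using sum by (subst emeasure_point_measure_finite) auto
  then interpret P: prob_space "point_measure {..n} w"
    by (intro prob_spaceI) (simp add: space_point_measure)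
  interpret D: prob_space D unfolding D_def by (rule P.prob_space_distr[OF x])
  show "real_distribution D" by (intro_locales, unfold_locales) (simp_all add: D_def)
  show "(\<integral>t. h t \<partial>D) = (\<Sum>k\<le>n. w k * h (x k))" if "h \<in> borel_measurable borel" for h
  proof -
    have "(\<integral>t. h t \<partial>D) = (\<integral>k. h (x k) \<partial>point_measure {..n} w)"
      unfolding D_def by (rule integral_distr[OF x that])
    also have "\<dots> = (\<Sum>k\<le>n. w k * h (x k))"
      using w by (subst lebesgue_integral_point_measure_finite) auto
    finally show ?thesis .
  qed
  show "measure D S = 1" if "S \<in> sets borel" "\<And>k. k \<le> n \<Longrightarrow> x k \<in> S" for S
  proof -
    have "x -` S \<inter> space (point_measure {..n} w) = space (point_measure {..n} w)"
      using that by (auto simp: space_point_measure)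
    then show ?thesis unfolding D_def using that x by (subst measure_distr) (auto simp: P.prob_space)
  qed
qed

text \<open>The Bernstein weights of the functional are discrete distributions on $[-C, C]$, and Helly's
  theorem provides a limit.\<close>

theorem hausdorff_moment:
  fixes L :: "real poly \<Rightarrow> real" and C :: real
  assumes C: "0 < C"
    and add: "\<And>p q. L (p + q) = L p + L q" and smult: "\<And>c p. L (Polynomial.smult c p) = c * L p"
    and one: "L 1 = 1" and pos: "\<And>k j. 0 \<le> L ([:C, 1:] ^ k * [:C, - 1:] ^ j)"
  obtains D where "real_distribution D" "AE x in D. \<bar>x\<bar> \<le> C" "\<And>p. L p = (\<integral>x. poly p x \<partial>D)"
proof -
  have Lsum: "L (\<Sum>i\<in>I. f i) = (\<Sum>i\<in>I. L (f i))" if "finite I" for f :: "nat \<Rightarrow> real poly" and I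
    using that
  proof (induction I)
    case empty
    then show ?case using smult[of 0 0] by simp
  qed (simp add: add)
  \<comment> \<open>\<open>Y\<close> maps [-C, C] affinely onto [0, 1]. The weight
    \<open>w n k\<close> is the value of \<open>L\<close> at the Bernstein polynomial (n choose k)
    Y^k (1 - Y)^(n-k), and \<open>x n k\<close> is the point where Y takes the value k/n.\<close>
  define Y where "Y = [:1 / 2, 1 / (2 * C):]"
  define w where "w = (\<lambda>n k. real (n choose k) / (2 * C) ^ n * L ([:C, 1:] ^ k * [:C, - 1:] ^ (n - k)))"
  define x where "x = (\<lambda>n k. - C + 2 * C * (real k / real n))"
  define D where "D n = distr (point_measure {..n} (w n)) borel (x n)" for n
  have w0: "0 \<le> w n k" for n k using pos C by (simp add: w_def)
  have Y2: "[:C, 1:] = Polynomial.smult (2 * C) Y" using C by (simp add: Y_def)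
  \<comment> \<open>The normalised factorial moments of the weights are exactly L(Y^j), for every n
    >= j; with j = 0 this says that the weights sum to 1.\<close>
  have wj: "(\<Sum>k\<le>n. w n k * (real (k choose j) / real (n choose j))) = L (Y ^ j)" if j: "j \<le> n" for n j
  proof -
    have nz: "real (n choose j) \<noteq> 0" using j by simp
    have "(\<Sum>k\<le>n. of_nat (n choose k) * of_nat (k choose j) * ([:C, 1:] ^ k * [:C, - 1:] ^ (n - k))) =
      of_nat (n choose j) * [:C, 1:] ^ j * [:2 * C:] ^ (n - j)"
      using binomial_weighted_sum[OF j, of "[:C, 1:]" "[:C, - 1:]"] by simp
    also have "\<dots> = Polynomial.smult (real (n choose j) * (2 * C) ^ n) (Y ^ j)"
    proof -
      have "(2 * C) ^ n = (2 * C) ^ j * (2 * C) ^ (n - j)" by (subst power_add[symmetric]) (simp add: j)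
      then show ?thesis
        by (simp add: Y2 smult_power poly_const_pow of_nat_poly mult_ac del: power_mult_distrib)
    qed
    finally have "L (\<Sum>k\<le>n. Polynomial.smult (real (n choose k) * real (k choose j)) ([:C, 1:] ^ k * [:C, - 1:] ^ (n - k)))
        = real (n choose j) * (2 * C) ^ n * L (Y ^ j)"
      by (simp add: smult of_nat_poly mult_ac)
    then have "(\<Sum>k\<le>n. real (n choose k) * real (k choose j) * L ([:C, 1:] ^ k * [:C, - 1:] ^ (n - k)))
        / (real (n choose j) * (2 * C) ^ n) = L (Y ^ j)"
      using C nz by (simp add: Lsum smult)
    then show ?thesis
      by (simp add: w_def sum_divide_distrib mult_ac)
  qed
  have w1: "(\<Sum>k\<le>n. w n k) = 1" for n using wj[of 0 n] one by simp
  note D = real_distribution_finite[where n = n and w = "w n" and x = "x n" for n, OF w0 w1, folded D_def]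
  have xC: "x n k \<in> {- C..C}" if "k \<le> n" for n k
  proof -
    have "0 \<le> real k / real n" "real k / real n \<le> 1" using that by (auto simp: divide_le_eq_1)
    then show ?thesis using C mult_left_mono[of "real k / real n" 1 "2 * C"] by (auto simp: x_def)
  qed
  have "tight D" unfolding tight_def
  proof (intro conjI allI impI)
    show "real_distribution (D n)" for n by (rule D(1))
    fix \<epsilon> :: real assume e: "0 < \<epsilon>"
    show "\<exists>a b. a < b \<and> (\<forall>n. 1 - \<epsilon> < measure (D n) {a<..b})"
    proof (rule exI[of _ "- C - 1"], rule exI[of _ C], intro conjI allI)
      fix n
      have "measure (D n) {- C - 1<..C} = 1"
      proof (rule D(3))
        fix k assume "k \<le> n"
        then show "x n k \<in> {- C - 1<..C}" using xC[of k n] by auto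
      qed simp
      then show "1 - \<epsilon> < measure (D n) {- C - 1<..C}" using e by simp
    qed (use C in simp)
  qed
  from tight_imp_convergent_subsubsequence[OF this, of id] obtain r M where r: "strict_mono r"
    and M: "real_distribution M" "weak_conv_m (\<lambda>n. D (r n)) M"
    by (auto simp: strict_mono_def comp_def)
  interpret M: real_distribution M by (rule M(1))
  have lim: "(\<lambda>n. \<Sum>k\<le>r n. w (r n) k * h (x (r n) k)) \<longlonglongrightarrow> (\<integral>t. h t \<partial>M)"
    if h: "\<And>t. isCont h t" "\<And>t. norm (h t) \<le> B" for h :: "real \<Rightarrow> real" and B
  proof -
    have "(\<lambda>n. \<integral>t. h t \<partial>D (r n)) \<longlonglongrightarrow> (\<integral>t. h t \<partial>M)"
      using D(1) M by (intro weak_conv_imp_integral_bdd_continuous_conv[where B = B] h) auto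
    moreover have "h \<in> borel_measurable borel"
      using h by (intro borel_measurable_continuous_onI continuous_at_imp_continuous_on) auto
    ultimately show ?thesis by (simp add: D(2))
  qed
  \<comment> \<open>Clamping to [-C, C] makes polynomials bounded, as weak convergence demands,
    without changing them at the nodes.\<close>
  define c where "c = (\<lambda>t. max (- C) (min C t))"
  have cC: "\<bar>c t\<bar> \<le> C" "\<bar>t\<bar> \<le> C \<Longrightarrow> c t = t" for t using C by (auto simp: c_def)
  have cx: "c (x n k) = x n k" if "k \<le> n" for n k using xC[OF that] by (auto simp: c_def)
  have isc: "isCont c t" for t unfolding c_def by (intro continuous_intros)
  have meas: "h \<in> borel_measurable M" if "\<And>t. isCont h t" for h :: "real \<Rightarrow> real"
  proof -
    have "h \<in> borel_measurable borel"
      using that by (intro borel_measurable_continuous_onI continuous_at_imp_continuous_on) auto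
    then show ?thesis by simp
  qed
  \<comment> \<open>The function min(1, |t - c t|) vanishes at all nodes, hence has integral 0 in
    the limit, but it is positive off [-C, C].\<close>
  have AE: "AE t in M. \<bar>t\<bar> \<le> C"
  proof -
    let ?h = "\<lambda>t. min 1 \<bar>t - c t\<bar>"
    have ch: "isCont ?h t" for t by (intro continuous_intros isc)
    have "(\<lambda>n. \<Sum>k\<le>r n. w (r n) k * ?h (x (r n) k)) \<longlonglongrightarrow> (\<integral>t. ?h t \<partial>M)"
      by (rule lim[OF ch, of 1]) auto
    moreover have "(\<Sum>k\<le>r n. w (r n) k * ?h (x (r n) k)) = 0" for n
      by (intro sum.neutral) (auto simp: cx)
    ultimately have "(\<integral>t. ?h t \<partial>M) = 0" using LIMSEQ_unique[OF tendsto_const] by force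
    moreover have "integrable M ?h" by (intro M.integrable_const_bound[where B = 1] meas ch) auto
    ultimately have "AE t in M. ?h t = 0" by (subst (asm) integral_nonneg_eq_0_iff_AE) auto
    then show ?thesis
    proof eventually_elim
      case (elim t)
      then have "t = c t" by (auto simp: min_def split: if_splits)
      then show ?case using cC(1)[of t] by simp
    qed
  qed
  have Yj: "L (Y ^ j) = (\<integral>t. poly Y t ^ j \<partial>M)" for j
  proof -
    let ?h = "\<lambda>t. poly Y (c t) ^ j"
    have "poly Y (c t) \<in> {0..1}" for t
      using cC(1)[of t] C by (auto simp: Y_def field_simps abs_le_iff)
    then have bd: "norm (?h t) \<le> 1" for t by (auto simp: power_le_one)
    have "(\<lambda>n. \<Sum>k\<le>r n. w (r n) k * ?h (x (r n) k)) \<longlonglongrightarrow> (\<integral>t. ?h t \<partial>M)"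
      by (rule lim[OF _ bd]) (intro continuous_intros isc isCont_o2[OF isc])
    \<comment> \<open>The integrals are power moments while \<open>wj\<close> gives factorial
      moments; they differ by O(j^2/n).\<close>
    moreover have "(\<lambda>n. (\<Sum>k\<le>r n. w (r n) k * ?h (x (r n) k)) - L (Y ^ j)) \<longlonglongrightarrow> 0"
    proof (rule Lim_null_comparison)
      show "\<forall>\<^sub>F n in sequentially. norm ((\<Sum>k\<le>r n. w (r n) k * ?h (x (r n) k)) - L (Y ^ j))
          \<le> 2 * real j * real j * inverse (real (r n))"
      proof (intro eventually_sequentiallyI[of "2 * j + 1"])
        fix m assume "2 * j + 1 \<le> m"
        then have n: "2 * j < r m" using seq_suble[OF r, of m] by linarith
        define n where "n = r m"
        have yx: "poly Y (c (x n k)) = real k / real n" if "k \<le> n" for k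
          unfolding cx[OF that] using C by (simp add: Y_def x_def field_simps)
        have "L (Y ^ j) = (\<Sum>k\<le>n. w n k * (real (k choose j) / real (n choose j)))"
          using n by (intro wj[symmetric]) (simp add: n_def)
        moreover have "(\<Sum>k\<le>n. w n k * ?h (x n k)) = (\<Sum>k\<le>n. w n k * (real k / real n) ^ j)"
          by (intro sum.cong refl) (simp add: yx)
        ultimately have "(\<Sum>k\<le>n. w n k * ?h (x n k)) - L (Y ^ j) =
            (\<Sum>k\<le>n. w n k * ((real k / real n) ^ j - real (k choose j) / real (n choose j)))"
          by (simp only: right_diff_distrib sum_subtractf)
        also have "norm \<dots> \<le> (\<Sum>k\<le>n. w n k * (real j * (2 * real j / real n)))"
        proof (intro sum_norm_le)
          fix k assume "k \<in> {..n}"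
          then have "\<bar>(real k / real n) ^ j - real (k choose j) / real (n choose j)\<bar> \<le> real j * (2 * real j / real n)"
            using binomial_ratio_approx[of k n j] n by (simp add: n_def abs_minus_commute)
          then show "norm (w n k * ((real k / real n) ^ j - real (k choose j) / real (n choose j)))
             \<le> w n k * (real j * (2 * real j / real n))"
            using mult_left_mono[OF _ w0] by (simp only: real_norm_def abs_mult abs_of_nonneg[OF w0])
        qed
        also have "\<dots> = real j * (2 * real j / real n)" by (simp only: sum_distrib_right[symmetric] w1 mult_1_left)
        finally show "norm ((\<Sum>k\<le>r m. w (r m) k * ?h (x (r m) k)) - L (Y ^ j))
          \<le> 2 * real j * real j * inverse (real (r m))"
          by (simp only: n_def divide_inverse mult_ac)
      qed
      have "(\<lambda>n. inverse (real (r n))) \<longlonglongrightarrow> 0"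
        using LIMSEQ_subseq_LIMSEQ[OF lim_inverse_n r] by (simp add: comp_def)
      then show "(\<lambda>n. 2 * real j * real j * inverse (real (r n))) \<longlonglongrightarrow> 0"
        by (intro tendsto_mult_right_zero)
    qed
    then have "(\<lambda>n. \<Sum>k\<le>r n. w (r n) k * ?h (x (r n) k)) \<longlonglongrightarrow> L (Y ^ j)"
      by (simp add: LIM_zero_iff)
    ultimately have "L (Y ^ j) = (\<integral>t. ?h t \<partial>M)" by (intro LIMSEQ_unique)
    also have "\<dots> = (\<integral>t. poly Y t ^ j \<partial>M)"
      using AE by (intro integral_cong_AE meas) (auto simp: cC intro!: continuous_intros isc isCont_o2[OF isc])
    finally show ?thesis .
  qed
  have int: "integrable M (\<lambda>t. poly p t)" for p
  proof -
    have "compact (poly p ` {- C..C})"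
      by (intro compact_continuous_image continuous_intros) auto
    then obtain B where "\<And>t. t \<in> {- C..C} \<Longrightarrow> norm (poly p t) \<le> B"
      using compact_imp_bounded bounded_iff by (metis imageI)
    then have B: "norm (poly p t) \<le> B" if "\<bar>t\<bar> \<le> C" for t using that by (simp add: abs_le_iff)
    have "AE t in M. norm (poly p t) \<le> B" using AE by eventually_elim (rule B)
    then show ?thesis by (rule M.integrable_const_bound) (intro meas, simp)
  qed
  \<comment> \<open>Polynomials in Y are all polynomials: the inverse substitution is the affine map
    with coefficients -C and 2C.\<close>
  have all: "L (pcompose q Y) = (\<integral>t. poly (pcompose q Y) t \<partial>M)" for q
  proof -
    have e: "pcompose q Y = (\<Sum>i\<le>degree q. Polynomial.smult (coeff q i) (Y ^ i))"
      by (simp add: pcompose_altdef poly_altdef coeff_map_poly degree_map_poly mult_ac)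
    have iY: "integrable M (\<lambda>t. poly Y t ^ i)" for i using int[of "Y ^ i"] by simp
    show ?thesis unfolding e
      by (simp add: Lsum smult poly_sum Yj iY Bochner_Integration.integral_sum)
  qed
  show ?thesis
  proof (rule that[OF M(1) AE])
    fix p
    have "pcompose (pcompose p [:- C, 2 * C:]) Y = pcompose p (pcompose [:- C, 2 * C:] Y)"
      by (rule pcompose_assoc[symmetric])
    also have "pcompose [:- C, 2 * C:] Y = [:0, 1:]" using C by (simp add: Y_def pcompose_pCons)
    finally have "pcompose (pcompose p [:- C, 2 * C:]) Y = p" by (simp add: pcompose_idR)
    then show "L p = (\<integral>x. poly p x \<partial>M)" using all[of "pcompose p [:- C, 2 * C:]"] by simp
  qed
qed

section \<open>The space $\ell^2(W)$\<close>

lemma ell2D: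
  assumes "f \<in> ell2 W"
  shows "x \<notin> W \<Longrightarrow> f x = 0" and "(\<lambda>x. (cmod (f x))\<^sup>2) summable_on W"
  using assms by (auto simp: ell2_def)

lemma ell2_zero: "(\<lambda>_. 0) \<in> ell2 W"
  by (simp add: ell2_def)

lemma ell2_add:
  assumes "f \<in> ell2 W" "g \<in> ell2 W"
  shows "(\<lambda>x. f x + g x) \<in> ell2 W"
proof -
  have "(\<lambda>x. (cmod (f x + g x))\<^sup>2) summable_on W"
  proof (rule summable_on_comparison_test)
    show "(\<lambda>x. 2 * (cmod (f x))\<^sup>2 + 2 * (cmod (g x))\<^sup>2) summable_on W"
      using assms by (intro summable_on_add summable_on_cmult_right ell2D)
    fix x
    have "(cmod (f x + g x))\<^sup>2 \<le> (cmod (f x) + cmod (g x))\<^sup>2"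
      by (intro power_mono norm_triangle_ineq) auto
    also have "\<dots> \<le> 2 * (cmod (f x))\<^sup>2 + 2 * (cmod (g x))\<^sup>2"
      using sum_squares_bound[of "cmod (f x)" "cmod (g x)"] by (simp add: power2_sum)
    finally show "(cmod (f x + g x))\<^sup>2 \<le> 2 * (cmod (f x))\<^sup>2 + 2 * (cmod (g x))\<^sup>2" .
  qed simp
  then show ?thesis using assms by (auto simp: ell2_def)
qed

lemma ell2_scale: "f \<in> ell2 W \<Longrightarrow> (\<lambda>x. c * f x) \<in> ell2 W"
  by (auto simp: ell2_def norm_mult power_mult_distrib intro: summable_on_cmult_right)

lemma ell2_diff: "f \<in> ell2 W \<Longrightarrow> g \<in> ell2 W \<Longrightarrow> (\<lambda>x. f x - g x) \<in> ell2 W"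
  using ell2_add[of f W "\<lambda>x. - 1 * g x"] ell2_scale[of g W "- 1"] by simp

lemma ell2_sum: "(\<And>i. i \<in> I \<Longrightarrow> f i \<in> ell2 W) \<Longrightarrow> (\<lambda>x. \<Sum>i\<in>I. f i x) \<in> ell2 W"
  by (induction I rule: infinite_finite_induct) (auto intro: ell2_zero ell2_add)

lemma ell2_finite_support:
  assumes "finite F" "F \<subseteq> W" "\<And>x. x \<notin> F \<Longrightarrow> f x = 0"
  shows "f \<in> ell2 W"
proof -
  have "(\<lambda>x. (cmod (f x))\<^sup>2) summable_on F" using assms(1) by simp
  then have "(\<lambda>x. (cmod (f x))\<^sup>2) summable_on W"
    using assms by (subst summable_on_cong_neutral[of F W _ "\<lambda>x. (cmod (f x))\<^sup>2"]) auto
  then show ?thesis using assms by (auto simp: ell2_def)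
qed

lemma ell2_delta: "v \<in> W \<Longrightarrow> delta v \<in> ell2 W"
  by (rule ell2_finite_support[of "{v}"]) (auto simp: delta_def)

lemma ell2_abs_summable:
  assumes "f \<in> ell2 W" "g \<in> ell2 W"
  shows "(\<lambda>x. norm (f x * cnj (g x))) summable_on W"
proof (rule summable_on_comparison_test)
  show "(\<lambda>x. (cmod (f x))\<^sup>2 + (cmod (g x))\<^sup>2) summable_on W"
    using assms by (intro summable_on_add ell2D)
  fix x
  have "2 * (cmod (f x) * cmod (g x)) \<le> (cmod (f x))\<^sup>2 + (cmod (g x))\<^sup>2"
    using sum_squares_bound[of "cmod (f x)" "cmod (g x)"] by simp
  moreover have "0 \<le> cmod (f x) * cmod (g x)" by simp
  ultimately have "cmod (f x) * cmod (g x) \<le> (cmod (f x))\<^sup>2 + (cmod (g x))\<^sup>2" by linarith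
  then show "norm (f x * cnj (g x)) \<le> (cmod (f x))\<^sup>2 + (cmod (g x))\<^sup>2"
    by (simp add: norm_mult)
qed simp

lemma ell2_inner_summable:
  "f \<in> ell2 W \<Longrightarrow> g \<in> ell2 W \<Longrightarrow> (\<lambda>x. f x * cnj (g x)) summable_on W"
  by (rule abs_summable_summable[OF ell2_abs_summable])

lemma ell2_inner_add_left:
  "f \<in> ell2 W \<Longrightarrow> g \<in> ell2 W \<Longrightarrow> h \<in> ell2 W \<Longrightarrow>
    ell2_inner W (\<lambda>x. f x + g x) h = ell2_inner W f h + ell2_inner W g h"
  by (simp add: ell2_inner_def distrib_right infsum_add ell2_inner_summable)

lemma ell2_inner_scale_left: "ell2_inner W (\<lambda>x. c * f x) h = c * ell2_inner W f h"
  by (simp add: ell2_inner_def mult.assoc infsum_cmult_right')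

lemma ell2_inner_commute: "ell2_inner W f g = cnj (ell2_inner W g f)"
  by (simp add: ell2_inner_def mult.commute flip: infsum_cnj)

lemma ell2_inner_zero_left [simp]: "ell2_inner W (\<lambda>_. 0) h = 0"
  by (simp add: ell2_inner_def)

lemma ell2_inner_zero_right [simp]: "ell2_inner W h (\<lambda>_. 0) = 0"
  by (simp add: ell2_inner_def)

lemma ell2_inner_add_right:
  "f \<in> ell2 W \<Longrightarrow> g \<in> ell2 W \<Longrightarrow> h \<in> ell2 W \<Longrightarrow>
    ell2_inner W h (\<lambda>x. f x + g x) = ell2_inner W h f + ell2_inner W h g"
  using arg_cong[OF ell2_inner_add_left[of f W g h], of cnj] by (simp flip: ell2_inner_commute)

lemma ell2_inner_scale_right: "ell2_inner W h (\<lambda>x. c * f x) = cnj c * ell2_inner W h f"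
  using arg_cong[OF ell2_inner_scale_left[of W c f h], of cnj] by (simp flip: ell2_inner_commute)

lemma ell2_inner_diff_left:
  assumes "f \<in> ell2 W" "g \<in> ell2 W" "h \<in> ell2 W"
  shows "ell2_inner W (\<lambda>x. f x - g x) h = ell2_inner W f h - ell2_inner W g h"
  using ell2_inner_add_left[OF assms(1) ell2_scale[OF assms(2), of "- 1"] assms(3)]
    ell2_inner_scale_left[of W "- 1" g h] by simp

lemma ell2_inner_diff_right:
  assumes "f \<in> ell2 W" "g \<in> ell2 W" "h \<in> ell2 W"
  shows "ell2_inner W h (\<lambda>x. f x - g x) = ell2_inner W h f - ell2_inner W h g"
  using ell2_inner_add_right[OF assms(1) ell2_scale[OF assms(2), of "- 1"] assms(3)]
    ell2_inner_scale_right[of W h "- 1" g] by simp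

lemma ell2_inner_sum_left:
  assumes "finite I" "\<And>i. i \<in> I \<Longrightarrow> f i \<in> ell2 W" "h \<in> ell2 W"
  shows "ell2_inner W (\<lambda>x. \<Sum>i\<in>I. f i x) h = (\<Sum>i\<in>I. ell2_inner W (f i) h)"
  using assms by (induction I) (auto simp: ell2_inner_add_left ell2_sum)

lemma ell2_norm_nonneg: "0 \<le> ell2_norm W f"
  unfolding ell2_norm_def by (intro real_sqrt_ge_zero infsum_nonneg) simp

lemma ell2_norm_power2: "(ell2_norm W f)\<^sup>2 = (\<Sum>\<^sub>\<infinity>x\<in>W. (cmod (f x))\<^sup>2)"
  unfolding ell2_norm_def by (simp add: infsum_nonneg)

lemma ell2_inner_self: "f \<in> ell2 W \<Longrightarrow> ell2_inner W f f = complex_of_real ((ell2_norm W f)\<^sup>2)"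
proof -
  assume "f \<in> ell2 W"
  then have "((\<lambda>x. complex_of_real ((cmod (f x))\<^sup>2)) has_sum complex_of_real ((ell2_norm W f)\<^sup>2)) W"
    unfolding ell2_norm_power2 by (intro has_sum_of_real has_sum_infsum ell2D)
  then show "ell2_inner W f f = complex_of_real ((ell2_norm W f)\<^sup>2)"
    unfolding ell2_inner_def complex_norm_square by (rule infsumI)
qed

lemma norm_sq_eq_inner: "f \<in> ell2 W \<Longrightarrow> (ell2_norm W f)\<^sup>2 = Re (ell2_inner W f f)"
  by (simp add: ell2_inner_self)

lemma ell2_norm_zero_fun [simp]: "ell2_norm W (\<lambda>_. 0) = 0"
  by (simp add: ell2_norm_def)

lemma ell2_norm_scale: "ell2_norm W (\<lambda>x. c * f x) = cmod c * ell2_norm W f"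
  by (simp add: ell2_norm_def norm_mult power_mult_distrib infsum_cmult_right' real_sqrt_mult)

lemma ell2_norm_minus_commute: "ell2_norm W (\<lambda>x. f x - g x) = ell2_norm W (\<lambda>x. g x - f x)"
  by (simp add: ell2_norm_def norm_minus_commute)

lemma cmod_le_norm:
  assumes "f \<in> ell2 W" shows "cmod (f x) \<le> ell2_norm W f"
proof (cases "x \<in> W")
  case True
  have "(\<Sum>y\<in>{x}. (cmod (f y))\<^sup>2) \<le> (\<Sum>\<^sub>\<infinity>y\<in>W. (cmod (f y))\<^sup>2)"
    using True assms by (intro finite_sum_le_infsum ell2D) auto
  then have "(cmod (f x))\<^sup>2 \<le> (ell2_norm W f)\<^sup>2" by (simp add: ell2_norm_power2)
  then show ?thesis by (rule power2_le_imp_le) (rule ell2_norm_nonneg)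
qed (use assms ell2_norm_nonneg in \<open>auto simp: ell2D\<close>)

lemma ell2_norm_eq_0: "f \<in> ell2 W \<Longrightarrow> ell2_norm W f = 0 \<Longrightarrow> f = (\<lambda>_. 0)"
  using cmod_le_norm[of f W] by (auto simp: fun_eq_iff)

lemma ell2_inner_delta:
  assumes "v \<in> W" shows "ell2_inner W f (delta v) = f v"
proof -
  have "ell2_inner W f (delta v) = (\<Sum>\<^sub>\<infinity>x\<in>{v}. f x * cnj (delta v x))"
    unfolding ell2_inner_def using assms by (intro infsum_cong_neutral) (auto simp: delta_def)
  then show ?thesis by (simp add: delta_def)
qed

lemma ell2_norm_diff_sq:
  assumes "f \<in> ell2 W" "g \<in> ell2 W"
  shows "(ell2_norm W (\<lambda>x. f x - g x))\<^sup>2 =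
    (ell2_norm W f)\<^sup>2 - 2 * Re (ell2_inner W f g) + (ell2_norm W g)\<^sup>2"
proof -
  have "Re (ell2_inner W g f) = Re (ell2_inner W f g)" by (subst ell2_inner_commute) simp
  then show ?thesis using assms
    by (simp add: norm_sq_eq_inner ell2_inner_diff_left ell2_inner_diff_right ell2_diff)
qed

lemma ell2_norm_add_sq:
  assumes "f \<in> ell2 W" "g \<in> ell2 W"
  shows "(ell2_norm W (\<lambda>x. f x + g x))\<^sup>2 =
    (ell2_norm W f)\<^sup>2 + 2 * Re (ell2_inner W f g) + (ell2_norm W g)\<^sup>2"
proof -
  have "Re (ell2_inner W g f) = Re (ell2_inner W f g)" by (subst ell2_inner_commute) simp
  then show ?thesis using assms
    by (simp add: norm_sq_eq_inner ell2_inner_add_left ell2_inner_add_right ell2_add)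
qed

text \<open>The squared norm of ||g|| f - ||f|| g equals 2 ||f|| ||g|| (||f|| ||g|| - Re <f,
  g>).\<close>

lemma Cauchy_Schwarz_Re:
  assumes f: "f \<in> ell2 W" and g: "g \<in> ell2 W"
  shows "Re (ell2_inner W f g) \<le> ell2_norm W f * ell2_norm W g"
proof (cases "ell2_norm W f = 0 \<or> ell2_norm W g = 0")
  case True
  then have "f = (\<lambda>_. 0) \<or> g = (\<lambda>_. 0)" using ell2_norm_eq_0 f g by blast
  then show ?thesis by auto
next
  case False
  let ?a = "ell2_norm W f" and ?b = "ell2_norm W g"
  have pos: "0 < ?a * ?b" using False ell2_norm_nonneg[of W f] ell2_norm_nonneg[of W g] by simp
  have "0 \<le> (ell2_norm W (\<lambda>x. of_real ?b * f x - of_real ?a * g x))\<^sup>2" by simp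
  also have "\<dots> = 2 * (?a * ?b) * (?a * ?b - Re (ell2_inner W f g))"
    using f g ell2_norm_nonneg[of W f] ell2_norm_nonneg[of W g]
    by (simp add: ell2_norm_diff_sq ell2_scale ell2_norm_scale ell2_inner_scale_left ell2_inner_scale_right)
      (simp add: power2_eq_square algebra_simps)
  finally show ?thesis using pos by (simp add: zero_le_mult_iff)
qed

lemma Cauchy_Schwarz_ell2:
  assumes f: "f \<in> ell2 W" and g: "g \<in> ell2 W"
  shows "cmod (ell2_inner W f g) \<le> ell2_norm W f * ell2_norm W g"
proof (cases "ell2_inner W f g = 0")
  case False
  \<comment> \<open>Multiplying by a phase that turns the inner product into its modulus reduces the
    claim to real parts.\<close>
  define c where "c = cnj (ell2_inner W f g) / cmod (ell2_inner W f g)"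
  have c: "cmod c = 1" using False by (simp add: c_def norm_divide)
  have "c * ell2_inner W f g = (ell2_inner W f g * cnj (ell2_inner W f g)) / of_real (cmod (ell2_inner W f g))"
    by (simp add: c_def mult.commute)
  also have "\<dots> = of_real ((cmod (ell2_inner W f g))\<^sup>2 / cmod (ell2_inner W f g))"
    by (simp only: complex_norm_square[symmetric] of_real_divide)
  also have "\<dots> = of_real (cmod (ell2_inner W f g))"
    using False by (simp add: power2_eq_square)
  finally have "cmod (ell2_inner W f g) = Re (ell2_inner W (\<lambda>x. c * f x) g)"
    by (simp add: ell2_inner_scale_left)
  also have "\<dots> \<le> ell2_norm W f * ell2_norm W g"
    using Cauchy_Schwarz_Re[OF ell2_scale[OF f] g, of c] c by (simp add: ell2_norm_scale)
  finally show ?thesis .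
qed (simp add: ell2_norm_nonneg)

lemma ell2_norm_triangle:
  assumes f: "f \<in> ell2 W" and g: "g \<in> ell2 W"
  shows "ell2_norm W (\<lambda>x. f x + g x) \<le> ell2_norm W f + ell2_norm W g"
proof (rule power2_le_imp_le)
  show "(ell2_norm W (\<lambda>x. f x + g x))\<^sup>2 \<le> (ell2_norm W f + ell2_norm W g)\<^sup>2"
    using Cauchy_Schwarz_Re[OF f g] by (simp add: ell2_norm_add_sq[OF f g] power2_sum)
qed (simp add: ell2_norm_nonneg)

lemma ell2_norm_triangle_diff:
  assumes f: "f \<in> ell2 W" and g: "g \<in> ell2 W" and h: "h \<in> ell2 W"
  shows "ell2_norm W (\<lambda>x. f x - h x) \<le> ell2_norm W (\<lambda>x. f x - g x) + ell2_norm W (\<lambda>x. g x - h x)"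
  using ell2_norm_triangle[OF ell2_diff[OF f g] ell2_diff[OF g h]] by simp

lemma ell2_norm_le_I:
  assumes f: "f \<in> ell2 W" and b: "\<And>F. finite F \<Longrightarrow> F \<subseteq> W \<Longrightarrow> (\<Sum>x\<in>F. (cmod (f x))\<^sup>2) \<le> b\<^sup>2" and "0 \<le> b"
  shows "ell2_norm W f \<le> b"
proof (rule power2_le_imp_le)
  show "(ell2_norm W f)\<^sup>2 \<le> b\<^sup>2"
    unfolding ell2_norm_power2 using b by (intro infsum_le_finite_sums ell2D f) auto
qed fact

lemma ell2_sum_le_norm:
  assumes f: "f \<in> ell2 W" and F: "finite F" "F \<subseteq> W"
  shows "(\<Sum>x\<in>F. (cmod (f x))\<^sup>2) \<le> (ell2_norm W f)\<^sup>2"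
  unfolding ell2_norm_power2 using assms by (intro finite_sum_le_infsum ell2D) auto

text \<open>A Cauchy sequence converges pointwise. The Cauchy estimate holds for partial sums over
  finite sets, where it survives the pointwise limit, and the bound is uniform in the finite
  set.\<close>

lemma ell2_complete:
  fixes u :: "nat \<Rightarrow> 'v \<Rightarrow> complex"
  assumes u: "\<And>n. u n \<in> ell2 W"
    and cauchy: "\<And>e. 0 < e \<Longrightarrow> \<exists>N. \<forall>m\<ge>N. \<forall>n\<ge>N. ell2_norm W (\<lambda>x. u m x - u n x) \<le> e"
  obtains g where "g \<in> ell2 W" "(\<lambda>n. ell2_norm W (\<lambda>x. u n x - g x)) \<longlonglongrightarrow> 0"
proof -
  have "Cauchy (\<lambda>n. u n x)" for x
  proof (rule CauchyI)
    fix e :: real assume e: "0 < e"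
    then obtain N where N: "\<forall>m\<ge>N. \<forall>n\<ge>N. ell2_norm W (\<lambda>x. u m x - u n x) \<le> e / 2"
      using cauchy[of "e / 2"] by auto
    have "norm (u m x - u n x) < e" if "m \<ge> N" "n \<ge> N" for m n
    proof -
      have "ell2_norm W (\<lambda>x. u m x - u n x) \<le> e / 2" using N that by blast
      then show ?thesis using cmod_le_norm[OF ell2_diff[OF u[of m] u[of n]], of x] e by linarith
    qed
    then show "\<exists>N. \<forall>m\<ge>N. \<forall>n\<ge>N. norm (u m x - u n x) < e" by blast
  qed
  then have conv: "(\<lambda>n. u n x) \<longlonglongrightarrow> lim (\<lambda>n. u n x)" for x
    using Cauchy_convergent convergent_LIMSEQ_iff by blast
  define g where "g = (\<lambda>x. lim (\<lambda>n. u n x))"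
  have fin: "(\<Sum>x\<in>F. (cmod (u m x - g x))\<^sup>2) \<le> e\<^sup>2"
    if N: "\<forall>m\<ge>N. \<forall>n\<ge>N. ell2_norm W (\<lambda>x. u m x - u n x) \<le> e" and m: "m \<ge> N" and F: "finite F" "F \<subseteq> W"
    for e m N F
  proof (rule LIMSEQ_le_const2)
    show "(\<lambda>n. \<Sum>x\<in>F. (cmod (u m x - u n x))\<^sup>2) \<longlonglongrightarrow> (\<Sum>x\<in>F. (cmod (u m x - g x))\<^sup>2)"
      unfolding g_def by (intro tendsto_intros conv)
    have "(\<Sum>x\<in>F. (cmod (u m x - u n x))\<^sup>2) \<le> e\<^sup>2" if "n \<ge> N" for n
    proof -
      have "(ell2_norm W (\<lambda>x. u m x - u n x))\<^sup>2 \<le> e\<^sup>2"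
        using N m that by (intro power_mono ell2_norm_nonneg) auto
      then show ?thesis using ell2_sum_le_norm[OF ell2_diff[OF u u] F, of m n] by linarith
    qed
    then show "\<exists>N. \<forall>n\<ge>N. (\<Sum>x\<in>F. (cmod (u m x - u n x))\<^sup>2) \<le> e\<^sup>2" by blast
  qed
  have diff: "(\<lambda>x. u m x - g x) \<in> ell2 W"
    if N: "\<forall>m\<ge>N. \<forall>n\<ge>N. ell2_norm W (\<lambda>x. u m x - u n x) \<le> e" and m: "m \<ge> N" for e m N
  proof -
    have "(\<lambda>x. (cmod (u m x - g x))\<^sup>2) summable_on W"
      using fin[OF N m] by (intro nonneg_bdd_above_summable_on bdd_aboveI2[where M = "e\<^sup>2"]) auto
    moreover have "u m x - g x = 0" if "x \<notin> W" for x
      using u[THEN ell2D(1)] that by (simp add: g_def)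
    ultimately show ?thesis by (simp add: ell2_def)
  qed
  obtain N0 where N0: "\<forall>m\<ge>N0. \<forall>n\<ge>N0. ell2_norm W (\<lambda>x. u m x - u n x) \<le> 1"
    using cauchy[of 1] by auto
  have g: "g \<in> ell2 W"
    using ell2_diff[OF u[of N0] diff[OF N0 order_refl]] by simp
  have "(\<lambda>n. ell2_norm W (\<lambda>x. u n x - g x)) \<longlonglongrightarrow> 0"
  proof (rule LIMSEQ_I)
    fix r :: real assume r: "0 < r"
    then obtain N where N: "\<forall>m\<ge>N. \<forall>n\<ge>N. ell2_norm W (\<lambda>x. u m x - u n x) \<le> r / 2"
      using cauchy[of "r / 2"] by auto
    have "ell2_norm W (\<lambda>x. u n x - g x) \<le> r / 2" if "n \<ge> N" for n
      using r by (intro ell2_norm_le_I fin[OF N that] ell2_diff u g) auto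
    then show "\<exists>no. \<forall>n\<ge>no. norm (ell2_norm W (\<lambda>x. u n x - g x) - 0) < r"
      using r by (intro exI[of _ N]) (force simp: ell2_norm_nonneg)
  qed
  then show ?thesis using that g by blast
qed

lemma ell2_inner_tendsto:
  assumes u: "\<And>n. u n \<in> ell2 W" and f: "f \<in> ell2 W" and g: "g \<in> ell2 W"
    and lim: "((\<lambda>n. ell2_norm W (\<lambda>x. u n x - f x)) \<longlongrightarrow> 0) F"
  shows "((\<lambda>n. ell2_inner W (u n) g) \<longlongrightarrow> ell2_inner W f g) F"
proof (rule Lim_null[THEN iffD2], rule Lim_null_comparison)
  show "\<forall>\<^sub>F n in F. norm (ell2_inner W (u n) g - ell2_inner W f g) \<le>
      ell2_norm W (\<lambda>x. u n x - f x) * ell2_norm W g"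
    using Cauchy_Schwarz_ell2[OF ell2_diff[OF u f] g] by (simp add: ell2_inner_diff_left u f g)
  show "((\<lambda>n. ell2_norm W (\<lambda>x. u n x - f x) * ell2_norm W g) \<longlongrightarrow> 0) F"
    using lim by (rule tendsto_mult_left_zero)
qed

lemma ell2_tendsto_unique:
  assumes u: "\<And>n. u n \<in> ell2 W" and f: "f \<in> ell2 W" and g: "g \<in> ell2 W"
    and "(\<lambda>n. ell2_norm W (\<lambda>x. u n x - f x)) \<longlonglongrightarrow> 0" "(\<lambda>n. ell2_norm W (\<lambda>x. u n x - g x)) \<longlonglongrightarrow> 0"
  shows "f = g"
proof -
  have "(\<lambda>n. ell2_norm W (\<lambda>x. f x - u n x) + ell2_norm W (\<lambda>x. u n x - g x)) \<longlonglongrightarrow> 0 + 0"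
    using assms by (intro tendsto_add) (auto simp: ell2_norm_minus_commute[of W f])
  then have "ell2_norm W (\<lambda>x. f x - g x) \<le> 0 + 0"
    by (rule LIMSEQ_le_const) (auto intro!: ell2_norm_triangle_diff u f g)
  then have "ell2_norm W (\<lambda>x. f x - g x) = 0" using ell2_norm_nonneg[of W "\<lambda>x. f x - g x"] by simp
  from ell2_norm_eq_0[OF ell2_diff[OF f g] this] show ?thesis by (auto simp: fun_eq_iff)
qed

section \<open>Polynomials in a symmetric operator\<close>

definition poly_op :: "'v operator \<Rightarrow> real poly \<Rightarrow> 'v operator" where
  "poly_op A p f = (\<lambda>x. \<Sum>k\<le>degree p. of_real (coeff p k) * (A ^^ k) f x)"

lemma ell2_norm_tendsto_0:
  assumes "\<And>n. ell2_norm W (u n) \<le> b n" "b \<longlonglongrightarrow> 0"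
  shows "(\<lambda>n. ell2_norm W (u n)) \<longlonglongrightarrow> 0"
  by (rule Lim_null_comparison[OF _ assms(2)]) (simp add: assms(1) ell2_norm_nonneg)

locale symmetric_op =
  fixes W :: "'v set" and A :: "'v operator" and C :: real
  assumes bounded: "bounded_op W A"
    and symmetric: "\<And>f g. f \<in> ell2 W \<Longrightarrow> g \<in> ell2 W \<Longrightarrow> ell2_inner W (A f) g = ell2_inner W f (A g)"
    and norm_le: "\<And>f. f \<in> ell2 W \<Longrightarrow> ell2_norm W (A f) \<le> C * ell2_norm W f"
    and C_pos: "0 < C"
begin

lemma closed: "f \<in> ell2 W \<Longrightarrow> A f \<in> ell2 W"
  using bounded by (auto simp: bounded_op_def)

lemma op_add: "f \<in> ell2 W \<Longrightarrow> g \<in> ell2 W \<Longrightarrow> A (\<lambda>x. f x + g x) = (\<lambda>x. A f x + A g x)"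
  using bounded by (auto simp: bounded_op_def)

lemma op_scale: "f \<in> ell2 W \<Longrightarrow> A (\<lambda>x. c * f x) = (\<lambda>x. c * A f x)"
  using bounded by (auto simp: bounded_op_def)

lemma op_zero: "A (\<lambda>_. 0) = (\<lambda>_. 0)"
  using op_scale[OF ell2_zero, of 0] by simp

lemma op_sum:
  "finite I \<Longrightarrow> (\<And>i. i \<in> I \<Longrightarrow> f i \<in> ell2 W) \<Longrightarrow> A (\<lambda>x. \<Sum>i\<in>I. f i x) = (\<lambda>x. \<Sum>i\<in>I. A (f i) x)"
  by (induction I rule: finite_induct) (auto simp: op_zero op_add ell2_sum)

lemma funpow_closed: "f \<in> ell2 W \<Longrightarrow> (A ^^ k) f \<in> ell2 W"
  by (induction k) (auto simp: closed)

lemma poly_op_extend: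
  "degree p \<le> n \<Longrightarrow> poly_op A p f = (\<lambda>x. \<Sum>k\<le>n. of_real (coeff p k) * (A ^^ k) f x)"
  unfolding poly_op_def by (intro ext sum.mono_neutral_left) (auto simp: coeff_eq_0)

lemma poly_op_0 [simp]: "poly_op A 0 f = (\<lambda>_. 0)"
  by (simp add: poly_op_def)

lemma poly_op_pCons:
  assumes f: "f \<in> ell2 W"
  shows "poly_op A (pCons a p) f = (\<lambda>x. of_real a * f x + A (poly_op A p f) x)"
proof -
  have "A (poly_op A p f) = (\<lambda>x. \<Sum>k\<le>degree p. of_real (coeff p k) * (A ^^ Suc k) f x)"
    unfolding poly_op_def using f by (simp add: op_sum op_scale ell2_scale funpow_closed)
  moreover have "poly_op A (pCons a p) f =
      (\<lambda>x. \<Sum>k\<le>Suc (degree p). of_real (coeff (pCons a p) k) * (A ^^ k) f x)"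
    by (rule poly_op_extend) (simp add: degree_pCons_le)
  ultimately show ?thesis by (simp add: sum.atMost_Suc_shift del: sum.atMost_Suc)
qed

lemma poly_op_closed: "f \<in> ell2 W \<Longrightarrow> poly_op A p f \<in> ell2 W"
  by (induction p) (auto simp: poly_op_pCons ell2_zero intro!: ell2_add ell2_scale closed)

lemma poly_op_add_fun:
  "f \<in> ell2 W \<Longrightarrow> g \<in> ell2 W \<Longrightarrow> poly_op A p (\<lambda>x. f x + g x) = (\<lambda>x. poly_op A p f x + poly_op A p g x)"
  by (induction p) (auto simp: poly_op_pCons ell2_add op_add poly_op_closed algebra_simps)

lemma poly_op_scale_fun:
  "f \<in> ell2 W \<Longrightarrow> poly_op A p (\<lambda>x. c * f x) = (\<lambda>x. c * poly_op A p f x)"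
  by (induction p) (auto simp: poly_op_pCons ell2_scale op_scale poly_op_closed algebra_simps)

lemma poly_op_diff_fun:
  assumes "f \<in> ell2 W" "g \<in> ell2 W"
  shows "poly_op A p (\<lambda>x. f x - g x) = (\<lambda>x. poly_op A p f x - poly_op A p g x)"
  using poly_op_add_fun[OF assms(1) ell2_scale[OF assms(2), of "- 1"], of p]
    poly_op_scale_fun[OF assms(2), of p "- 1"] by simp

lemma poly_op_add:
  "f \<in> ell2 W \<Longrightarrow> poly_op A (p + q) f = (\<lambda>x. poly_op A p f x + poly_op A q f x)"
  by (induction p q rule: poly_induct2) (auto simp: poly_op_pCons op_add poly_op_closed algebra_simps)

lemma poly_op_smult:
  "f \<in> ell2 W \<Longrightarrow> poly_op A (Polynomial.smult c p) f = (\<lambda>x. of_real c * poly_op A p f x)"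
  by (induction p) (auto simp: poly_op_pCons op_scale poly_op_closed algebra_simps)

lemma poly_op_diff:
  "f \<in> ell2 W \<Longrightarrow> poly_op A (p - q) f = (\<lambda>x. poly_op A p f x - poly_op A q f x)"
  using poly_op_add[of f p "Polynomial.smult (- 1) q"] poly_op_smult[of f "- 1" q] by simp

lemma poly_op_mult:
  "f \<in> ell2 W \<Longrightarrow> poly_op A (p * q) f = poly_op A p (poly_op A q f)"
  by (induction p) (auto simp: poly_op_pCons poly_op_add poly_op_smult poly_op_closed)

lemma poly_op_1: "f \<in> ell2 W \<Longrightarrow> poly_op A 1 f = f"
  by (simp add: one_pCons poly_op_pCons op_zero)

lemma poly_op_X: "f \<in> ell2 W \<Longrightarrow> poly_op A [:0, 1:] f = A f"
  by (simp add: poly_op_pCons op_zero)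

lemma poly_op_commute: "f \<in> ell2 W \<Longrightarrow> A (poly_op A p f) = poly_op A p (A f)"
  by (metis poly_op_X poly_op_closed poly_op_mult mult.commute)

lemma poly_op_symmetric:
  "f \<in> ell2 W \<Longrightarrow> g \<in> ell2 W \<Longrightarrow> ell2_inner W (poly_op A p f) g = ell2_inner W f (poly_op A p g)"
proof (induction p arbitrary: f g)
  case (pCons a p)
  then show ?case
    by (simp add: poly_op_pCons ell2_inner_add_left ell2_inner_add_right ell2_inner_scale_left ell2_inner_scale_right
        ell2_scale closed poly_op_closed symmetric) (simp add: poly_op_commute)
qed simp

lemma poly_op_inner_real:
  assumes "f \<in> ell2 W"
  shows "ell2_inner W (poly_op A p f) f = of_real (Re (ell2_inner W (poly_op A p f) f))"
proof -
  have "cnj (ell2_inner W (poly_op A p f) f) = ell2_inner W (poly_op A p f) f"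
    using poly_op_symmetric[OF assms assms, of p] ell2_inner_commute[of W f "poly_op A p f"] by simp
  then show ?thesis by (simp add: complex_eq_iff)
qed

section \<open>Positivity and spectral measures of vectors\<close>

definition positive_poly :: "real poly \<Rightarrow> bool" where
  "positive_poly p \<longleftrightarrow> (\<forall>f\<in>ell2 W. 0 \<le> Re (ell2_inner W (poly_op A p f) f))"

text \<open>Polynomials in the operator are symmetric and commute, so the form of q q p at f is the
  form of p at q(A) f.\<close>

lemma positive_poly_mult_square: "positive_poly p \<Longrightarrow> positive_poly (q * q * p)"
  unfolding positive_poly_def
proof
  fix f assume p: "\<forall>f\<in>ell2 W. 0 \<le> Re (ell2_inner W (poly_op A p f) f)" and f: "f \<in> ell2 W"
  have "poly_op A (q * q * p) f = poly_op A q (poly_op A p (poly_op A q f))"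
    using f by (simp add: poly_op_mult poly_op_closed mult.commute[of q p] mult.assoc)
  then show "0 \<le> Re (ell2_inner W (poly_op A (q * q * p) f) f)"
    using p f by (simp add: poly_op_symmetric[of _ f q] poly_op_closed)
qed

lemma positive_poly_add: "positive_poly p \<Longrightarrow> positive_poly q \<Longrightarrow> positive_poly (p + q)"
  by (simp add: positive_poly_def poly_op_add ell2_inner_add_left poly_op_closed)

lemma positive_poly_smult: "0 \<le> c \<Longrightarrow> positive_poly p \<Longrightarrow> positive_poly (Polynomial.smult c p)"
  by (simp add: positive_poly_def poly_op_smult ell2_inner_scale_left)

lemma positive_poly_linear:
  assumes "s = 1 \<or> s = - 1" shows "positive_poly [:C, s:]"
  unfolding positive_poly_def
proof
  fix f assume f: "f \<in> ell2 W"
  have "\<bar>Re (ell2_inner W (A f) f)\<bar> \<le> cmod (ell2_inner W (A f) f)" by (rule abs_Re_le_cmod)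
  also have "\<dots> \<le> ell2_norm W (A f) * ell2_norm W f" by (rule Cauchy_Schwarz_ell2[OF closed[OF f] f])
  also have "\<dots> \<le> C * ell2_norm W f * ell2_norm W f"
    by (intro mult_right_mono norm_le f ell2_norm_nonneg)
  finally have "\<bar>Re (ell2_inner W (A f) f)\<bar> \<le> C * (ell2_norm W f)\<^sup>2" by (simp add: power2_eq_square)
  moreover have "Re (ell2_inner W (poly_op A [:C, s:] f) f) =
      C * (ell2_norm W f)\<^sup>2 + s * Re (ell2_inner W (A f) f)"
    using f by (simp add: poly_op_pCons op_zero op_scale ell2_inner_add_left ell2_inner_scale_left ell2_scale closed ell2_inner_self)
  ultimately show "0 \<le> Re (ell2_inner W (poly_op A [:C, s:] f) f)" using assms by auto
qed

text \<open>Even powers can be pulled out as squares, which leaves exponents 0 and 1. The one case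
  that is not immediate is the product of C + X and C - X. There 2C (C + X)(C - X) = (C + X)^2 (C -
  X) + (C - X)^2 (C + X) writes it as a combination of squares times positive factors, so no square
  root of an operator is required.\<close>

lemma positive_poly_bernstein: "positive_poly ([:C, 1:] ^ k * [:C, - 1:] ^ j)"
proof -
  have one: "positive_poly 1"
    by (simp add: positive_poly_def poly_op_1 ell2_inner_self)
  have prod: "positive_poly ([:C, 1:] * [:C, - 1:])"
  proof -
    have "[:C, 1:] * [:C, - 1:] = Polynomial.smult (1 / (2 * C))
        ([:C, 1:] * [:C, 1:] * [:C, - 1:] + [:C, - 1:] * [:C, - 1:] * [:C, 1:])"
      using C_pos by (simp add: field_simps)
    then show ?thesis
      using C_pos by (simp del: mult_pCons_left mult_pCons_right add: positive_poly_smult positive_poly_add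
          positive_poly_mult_square positive_poly_linear)
  qed
  have *: "positive_poly ([:C, 1:] ^ (k mod 2) * [:C, - 1:] ^ (j mod 2))"
  proof -
    consider "k mod 2 = 0" "j mod 2 = 0" | "k mod 2 = 1" "j mod 2 = 0" | "k mod 2 = 0" "j mod 2 = 1"
      | "k mod 2 = 1" "j mod 2 = 1" by linarith
    then show ?thesis
      by cases (simp_all only: power_0 power_one_right mult_1_left mult_1_right one prod
          positive_poly_linear simp_thms)
  qed
  let ?q = "[:C, 1:] ^ (k div 2) * [:C, - 1:] ^ (j div 2)"
  have e: "p ^ n = p ^ (n div 2) * p ^ (n div 2) * p ^ (n mod 2)" for p :: "real poly" and n
  proof -
    have "n div 2 + n div 2 + n mod 2 = n" by presburger
    then show ?thesis by (simp flip: power_add)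
  qed
  have "[:C, 1:] ^ k * [:C, - 1:] ^ j = ?q * ?q * ([:C, 1:] ^ (k mod 2) * [:C, - 1:] ^ (j mod 2))"
    by (subst e[of _ k], subst e[of _ j]) (simp only: mult_ac)
  then show ?thesis using positive_poly_mult_square[OF *, of ?q] by simp
qed

text \<open>The functional sending p to <p(A) f, f> / ||f||^2 is positive on Bernstein polynomials,
  so \<open>hausdorff_moment\<close> applies. Since D has to be a probability measure, the zero
  vector, which admits no normalisation, is given the point mass at 0.\<close>

lemma spectral_measure:
  assumes f: "f \<in> ell2 W"
  obtains D where "real_distribution D" "AE x in D. \<bar>x\<bar> \<le> C"
    "\<And>p. ell2_inner W (poly_op A p f) f = of_real ((ell2_norm W f)\<^sup>2 * (\<integral>x. poly p x \<partial>D))"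
proof (cases "ell2_norm W f = 0")
  case True
  then have f0: "f = (\<lambda>_. 0)" using ell2_norm_eq_0 f by blast
  interpret R: prob_space "return borel (0::real)" by (rule prob_space_return) simp
  have "real_distribution (return borel 0)" by (intro_locales, unfold_locales) simp_all
  moreover have "AE x in return borel 0. \<bar>x :: real\<bar> \<le> C"
    using C_pos by (subst AE_return) auto
  ultimately show ?thesis by (rule that) (simp add: f0)
next
  case False
  let ?n = "(ell2_norm W f)\<^sup>2"
  have n: "0 < ?n" using False by simp
  define L where "L = (\<lambda>p. Re (ell2_inner W (poly_op A p f) f) / ?n)"
  have "0 \<le> L ([:C, 1:] ^ k * [:C, - 1:] ^ j)" for k j
    using positive_poly_bernstein[of k j] f n by (auto simp: L_def positive_poly_def)
  moreover have "L (p + q) = L p + L q" for p q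
    using f by (simp add: L_def poly_op_add ell2_inner_add_left poly_op_closed add_divide_distrib)
  moreover have "L (Polynomial.smult c p) = c * L p" for c p
    using f by (simp add: L_def poly_op_smult ell2_inner_scale_left)
  moreover have "L 1 = 1" using f n by (simp add: L_def poly_op_1 ell2_inner_self)
  ultimately obtain D where D: "real_distribution D" "AE x in D. \<bar>x\<bar> \<le> C"
      "\<And>p. L p = (\<integral>x. poly p x \<partial>D)"
    using hausdorff_moment[OF C_pos, of L] by metis
  show ?thesis
  proof (rule that[OF D(1,2)])
    fix p
    have "Re (ell2_inner W (poly_op A p f) f) = ?n * L p" using n by (simp add: L_def)
    then show "ell2_inner W (poly_op A p f) f = of_real (?n * (\<integral>x. poly p x \<partial>D))"
      by (subst poly_op_inner_real[OF f]) (simp add: D(3))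
  qed
qed

end

section \<open>Limits of polynomials in the operator\<close>

lemma weierstrass_poly:
  fixes h :: "real \<Rightarrow> real"
  assumes "continuous_on {a..b} h" "0 < e"
  obtains p where "\<And>x. x \<in> {a..b} \<Longrightarrow> \<bar>h x - poly p x\<bar> < e"
proof -
  obtain g where g: "polynomial_function g" "\<forall>x\<in>{a..b}. norm (h x - g x) < e"
    using Stone_Weierstrass_polynomial_function[OF compact_Icc assms] by blast
  then obtain c n where "g = (\<lambda>x. \<Sum>i\<le>n. c i * x ^ i)"
    using real_polynomial_function_eq real_polynomial_function_iff_sum by metis
  then have "g x = poly (\<Sum>i\<le>n. monom (c i) i) x" for x
    by (simp add: poly_sum poly_monom)
  then show ?thesis using g(2) by (intro that) auto
qed

text \<open>The polynomials follow ramps that equal 1 up to and including l and have slope -n beyond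
  it until they reach 0. Placing the ramp to the right of l makes the limit the indicator of the
  closed half-line, as the right continuity of the resolution requires. The error of at most 1 gives
  the bound 2.\<close>

lemma step_function_poly_approx:
  fixes C l :: real
  obtains q where "\<And>n x. \<bar>x\<bar> \<le> C \<Longrightarrow> \<bar>poly (q n) x\<bar> \<le> 2"
    "\<And>x. \<bar>x\<bar> \<le> C \<Longrightarrow> (\<lambda>n. poly (q n) x) \<longlonglongrightarrow> (if x \<le> l then 1 else 0)"
proof -
  define c where "c = (\<lambda>n x. max 0 (min 1 (1 - real n * (x - l))))"
  have "\<exists>p. \<forall>x\<in>{- C..C}. \<bar>c n x - poly p x\<bar> < inverse (real (Suc n))" for n
  proof -
    have "continuous_on {- C..C} (c n)" unfolding c_def by (intro continuous_intros)
    then show ?thesis by (rule weierstrass_poly[of _ _ _ "inverse (real (Suc n))"]) (simp, blast)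
  qed
  then obtain q where q: "\<And>n x. x \<in> {- C..C} \<Longrightarrow> \<bar>c n x - poly (q n) x\<bar> < inverse (real (Suc n))"
    by metis
  have c01: "0 \<le> c n x" "c n x \<le> 1" for n x by (auto simp: c_def)
  show ?thesis
  proof (rule that[of q])
    fix x :: real assume x: "\<bar>x\<bar> \<le> C"
    then have x': "x \<in> {- C..C}" by (simp add: abs_le_iff)
    show "\<bar>poly (q n) x\<bar> \<le> 2" for n
      using q[OF x', of n] c01[of n x] inverse_le_1_iff[of "real (Suc n)"] by linarith
    have "(\<lambda>n. c n x) \<longlonglongrightarrow> (if x \<le> l then 1 else 0)"
    proof (cases "x \<le> l")
      case True
      then have "c n x = 1" for n
        using mult_nonneg_nonpos[of "real n" "x - l"] by (simp add: c_def min_def max_def)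
      then show ?thesis using True by simp
    next
      case False
      obtain N :: nat where N: "1 / (x - l) < real N" using reals_Archimedean2 by blast
      have "c n x = 0" if "n \<ge> N" for n
      proof -
        have "1 / (x - l) \<le> real n" using N that by linarith
        then have "1 \<le> real n * (x - l)" using False by (simp add: field_simps)
        then show ?thesis by (simp add: c_def)
      qed
      then have "eventually (\<lambda>n. c n x = 0) sequentially" by (auto simp: eventually_sequentially)
      then show ?thesis using False by (simp add: tendsto_eventually)
    qed
    moreover have "(\<lambda>n. poly (q n) x - c n x) \<longlonglongrightarrow> 0"
    proof (rule Lim_null_comparison[OF _ LIMSEQ_inverse_real_of_nat])
      show "\<forall>\<^sub>F n in sequentially. norm (poly (q n) x - c n x) \<le> inverse (real (Suc n))"
        using q[OF x'] by (intro always_eventually) (auto simp: abs_minus_commute intro: less_imp_le)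
    qed
    ultimately show "(\<lambda>n. poly (q n) x) \<longlonglongrightarrow> (if x \<le> l then 1 else 0)"
      using tendsto_add by fastforce
  qed
qed

context symmetric_op
begin

lemma poly_op_norm_sq:
  assumes f: "f \<in> ell2 W"
    and D: "\<And>p. ell2_inner W (poly_op A p f) f = of_real ((ell2_norm W f)\<^sup>2 * (\<integral>x. poly p x \<partial>D))"
  shows "(ell2_norm W (poly_op A p f))\<^sup>2 = (ell2_norm W f)\<^sup>2 * (\<integral>x. (poly p x)\<^sup>2 \<partial>D)"
proof -
  have "(ell2_norm W (poly_op A p f))\<^sup>2 = Re (ell2_inner W (poly_op A (p * p) f) f)"
    using f by (simp add: norm_sq_eq_inner poly_op_closed poly_op_mult poly_op_symmetric[of _ f p])
  then show ?thesis by (simp add: D power2_eq_square)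
qed

text \<open>The squared norm of p(A) f is ||f||^2 times the integral of p^2 against the spectral
  measure of f, which lives on [-C, C].\<close>

lemma poly_op_norm_le:
  assumes f: "f \<in> ell2 W" and B: "\<And>x. \<bar>x\<bar> \<le> C \<Longrightarrow> \<bar>poly p x\<bar> \<le> B"
  shows "ell2_norm W (poly_op A p f) \<le> B * ell2_norm W f"
proof -
  obtain D where D: "real_distribution D" "AE x in D. \<bar>x\<bar> \<le> C"
    "\<And>p. ell2_inner W (poly_op A p f) f = of_real ((ell2_norm W f)\<^sup>2 * (\<integral>x. poly p x \<partial>D))"
    by (rule spectral_measure[OF f]) blast
  interpret D: real_distribution D by (rule D(1))
  have B0: "0 \<le> B" using B[of 0] C_pos by simp
  have "(\<integral>x. (poly p x)\<^sup>2 \<partial>D) \<le> (\<integral>x. B\<^sup>2 \<partial>D)"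
  proof (rule integral_mono_AE')
    show "AE x in D. (poly p x)\<^sup>2 \<le> B\<^sup>2"
      using D(2) by eventually_elim (metis B B0 abs_le_square_iff abs_of_nonneg)
  qed auto
  then have "(ell2_norm W (poly_op A p f))\<^sup>2 \<le> (ell2_norm W f)\<^sup>2 * B\<^sup>2"
    using D.prob_space by (simp add: poly_op_norm_sq[OF f D(3)] mult_left_mono)
  then have "(ell2_norm W (poly_op A p f))\<^sup>2 \<le> (B * ell2_norm W f)\<^sup>2"
    by (simp add: power_mult_distrib mult.commute)
  then show ?thesis by (rule power2_le_imp_le) (simp add: B0 ell2_norm_nonneg)
qed

lemma poly_integrals_tendsto:
  fixes p :: "nat \<Rightarrow> real poly"
  assumes D: "real_distribution D" "AE x in D. \<bar>x\<bar> \<le> C"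
    and B: "\<And>n x. \<bar>x\<bar> \<le> C \<Longrightarrow> \<bar>poly (p n) x\<bar> \<le> B"
    and lim: "\<And>x. \<bar>x\<bar> \<le> C \<Longrightarrow> (\<lambda>n. poly (p n) x) \<longlonglongrightarrow> g x"
    and g: "g \<in> borel_measurable borel"
  shows "(\<lambda>n. \<integral>x. poly (p n) x \<partial>D) \<longlonglongrightarrow> (\<integral>x. g x \<partial>D)"
    and "(\<lambda>n. \<integral>x. (poly (p n) x - g x)\<^sup>2 \<partial>D) \<longlonglongrightarrow> 0"
    and "integrable D (\<lambda>x. (poly (p n) x - g x)\<^sup>2)"
proof -
  interpret D: real_distribution D by (rule D(1))
  have p: "poly q \<in> borel_measurable borel" for q :: "real poly"
    by (intro borel_measurable_continuous_onI continuous_intros)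
  have gB: "\<bar>g x\<bar> \<le> B" if "\<bar>x\<bar> \<le> C" for x
    using lim[OF that] B[OF that] by (intro LIMSEQ_le_const2[OF tendsto_rabs]) auto
  have sq: "\<bar>(poly (p n) x - g x)\<^sup>2\<bar> \<le> (2 * B)\<^sup>2" if "\<bar>x\<bar> \<le> C" for n x
  proof -
    have "\<bar>poly (p n) x - g x\<bar> \<le> \<bar>2 * B\<bar>" using B[OF that, of n] gB[OF that] by linarith
    then show ?thesis by (simp only: abs_le_square_iff abs_power2)
  qed
  show "(\<lambda>n. \<integral>x. poly (p n) x \<partial>D) \<longlonglongrightarrow> (\<integral>x. g x \<partial>D)"
  proof (rule integral_dominated_convergence[where w = "\<lambda>_. B"])
    show "AE x in D. (\<lambda>n. poly (p n) x) \<longlonglongrightarrow> g x" using D(2) by eventually_elim (rule lim)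
    show "AE x in D. norm (poly (p n) x) \<le> B" for n using D(2) by eventually_elim (simp add: B)
  qed (use p g in auto)
  have AE: "AE x in D. norm ((poly (p n) x - g x)\<^sup>2) \<le> (2 * B)\<^sup>2" for n
    using D(2) by eventually_elim (use sq in auto)
  show "integrable D (\<lambda>x. (poly (p n) x - g x)\<^sup>2)"
    by (rule D.integrable_const_bound[OF AE]) (use p g in measurable)
  have "(\<lambda>n. \<integral>x. (poly (p n) x - g x)\<^sup>2 \<partial>D) \<longlonglongrightarrow> (\<integral>x. 0 \<partial>D)"
  proof (rule integral_dominated_convergence[where w = "\<lambda>_. (2 * B)\<^sup>2"])
    show "AE x in D. (\<lambda>n. (poly (p n) x - g x)\<^sup>2) \<longlonglongrightarrow> 0"
      using D(2)
    proof eventually_elim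
      case (elim x)
      have "(\<lambda>n. (poly (p n) x - g x)\<^sup>2) \<longlonglongrightarrow> (g x - g x)\<^sup>2"
        by (intro tendsto_intros lim elim)
      then show ?case by simp
    qed
    show "(\<lambda>x. (poly (p n) x - g x)\<^sup>2) \<in> borel_measurable D" for n
      using p[of "p n"] g by measurable
  qed (use AE in auto)
  then show "(\<lambda>n. \<integral>x. (poly (p n) x - g x)\<^sup>2 \<partial>D) \<longlonglongrightarrow> 0" by simp
qed

lemma poly_op_tendsto_0:
  fixes p :: "nat \<Rightarrow> real poly"
  assumes f: "f \<in> ell2 W"
    and B: "\<And>n x. \<bar>x\<bar> \<le> C \<Longrightarrow> \<bar>poly (p n) x\<bar> \<le> B"
    and lim: "\<And>x. \<bar>x\<bar> \<le> C \<Longrightarrow> (\<lambda>n. poly (p n) x) \<longlonglongrightarrow> 0"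
  shows "(\<lambda>n. ell2_norm W (poly_op A (p n) f)) \<longlonglongrightarrow> 0"
proof -
  obtain D where D: "real_distribution D" "AE x in D. \<bar>x\<bar> \<le> C"
    "\<And>p. ell2_inner W (poly_op A p f) f = of_real ((ell2_norm W f)\<^sup>2 * (\<integral>x. poly p x \<partial>D))"
    by (rule spectral_measure[OF f]) blast
  have "(\<lambda>n. \<integral>x. (poly (p n) x - 0)\<^sup>2 \<partial>D) \<longlonglongrightarrow> 0"
    by (rule poly_integrals_tendsto(2)[OF D(1,2) B lim]) auto
  then have "(\<lambda>n. (ell2_norm W f)\<^sup>2 * (\<integral>x. (poly (p n) x)\<^sup>2 \<partial>D)) \<longlonglongrightarrow> (ell2_norm W f)\<^sup>2 * 0"
    by (intro tendsto_intros) simp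
  then have "(\<lambda>n. (ell2_norm W (poly_op A (p n) f))\<^sup>2) \<longlonglongrightarrow> 0"
    by (simp add: poly_op_norm_sq[OF f D(3)])
  then have "(\<lambda>n. sqrt ((ell2_norm W (poly_op A (p n) f))\<^sup>2)) \<longlonglongrightarrow> sqrt 0"
    by (rule tendsto_real_sqrt)
  then show ?thesis by (simp add: ell2_norm_nonneg)
qed

text \<open>Up to the factor ||f||, sending p to p(A) f is isometric for the L^2 norm of the
  spectral measure of f. Bounded pointwise convergence to g is convergence in this L^2, so the
  images form a Cauchy sequence.\<close>

lemma poly_op_converges:
  fixes p :: "nat \<Rightarrow> real poly"
  assumes f: "f \<in> ell2 W"
    and B: "\<And>n x. \<bar>x\<bar> \<le> C \<Longrightarrow> \<bar>poly (p n) x\<bar> \<le> B"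
    and lim: "\<And>x. \<bar>x\<bar> \<le> C \<Longrightarrow> (\<lambda>n. poly (p n) x) \<longlonglongrightarrow> g x"
    and g: "g \<in> borel_measurable borel"
  obtains h where "h \<in> ell2 W" "(\<lambda>n. ell2_norm W (\<lambda>x. poly_op A (p n) f x - h x)) \<longlonglongrightarrow> 0"
proof -
  obtain D where D: "real_distribution D" "AE x in D. \<bar>x\<bar> \<le> C"
    "\<And>p. ell2_inner W (poly_op A p f) f = of_real ((ell2_norm W f)\<^sup>2 * (\<integral>x. poly p x \<partial>D))"
    by (rule spectral_measure[OF f]) blast
  interpret D: real_distribution D by (rule D(1))
  let ?a = "\<lambda>n. \<integral>x. (poly (p n) x - g x)\<^sup>2 \<partial>D" and ?c = "(ell2_norm W f)\<^sup>2"
  note int = poly_integrals_tendsto(3)[where p = p, OF D(1,2) B lim g]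
  have a: "?a \<longlonglongrightarrow> 0" by (rule poly_integrals_tendsto(2)[OF D(1,2) B lim g])
  have diff: "(ell2_norm W (\<lambda>x. poly_op A (p m) f x - poly_op A (p n) f x))\<^sup>2 \<le> ?c * (2 * ?a m + 2 * ?a n)" for m n
  proof -
    have "(\<integral>x. (poly (p m - p n) x)\<^sup>2 \<partial>D) \<le> (\<integral>x. 2 * (poly (p m) x - g x)\<^sup>2 + 2 * (poly (p n) x - g x)\<^sup>2 \<partial>D)"
    proof (rule integral_mono')
      fix x
      have "(s - t)\<^sup>2 \<le> 2 * s\<^sup>2 + 2 * t\<^sup>2" for s t :: real
        using zero_le_power2[of "s + t"] by (simp add: power2_eq_square algebra_simps)
      from this[of "poly (p m) x - g x" "poly (p n) x - g x"]
      show "(poly (p m - p n) x)\<^sup>2 \<le> 2 * (poly (p m) x - g x)\<^sup>2 + 2 * (poly (p n) x - g x)\<^sup>2"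
        by simp
    qed (use int in auto)
    also have "\<dots> = 2 * ?a m + 2 * ?a n" using int by simp
    finally show ?thesis
      using poly_op_norm_sq[OF f D(3), of "p m - p n"] by (simp add: poly_op_diff[OF f] mult_left_mono)
  qed
  have "\<exists>h. h \<in> ell2 W \<and> (\<lambda>n. ell2_norm W (\<lambda>x. poly_op A (p n) f x - h x)) \<longlonglongrightarrow> 0"
  proof (rule ell2_complete[of "\<lambda>n. poly_op A (p n) f" W])
    show "poly_op A (p n) f \<in> ell2 W" for n by (rule poly_op_closed[OF f])
    fix e :: real assume e: "0 < e"
    have "(\<lambda>n. ?c * (4 * ?a n)) \<longlonglongrightarrow> ?c * (4 * 0)" by (intro tendsto_intros a)
    then have "eventually (\<lambda>n. ?c * (4 * ?a n) < e\<^sup>2) sequentially"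
      using e by (intro order_tendstoD) auto
    then obtain N where N: "\<And>n. n \<ge> N \<Longrightarrow> ?c * (4 * ?a n) < e\<^sup>2" by (auto simp: eventually_sequentially)
    have "ell2_norm W (\<lambda>x. poly_op A (p m) f x - poly_op A (p n) f x) \<le> e" if "m \<ge> N" "n \<ge> N" for m n
    proof (rule power2_le_imp_le)
      have half: "x \<le> z" if "x \<le> y" "y + y = s + t" "s < z" "t < z" for x y z s t :: real
        using that add_strict_mono[OF that(3,4)] by linarith
      have "?c * (2 * ?a m + 2 * ?a n) + ?c * (2 * ?a m + 2 * ?a n) = ?c * (4 * ?a m) + ?c * (4 * ?a n)"
        by (simp add: algebra_simps)
      then show "(ell2_norm W (\<lambda>x. poly_op A (p m) f x - poly_op A (p n) f x))\<^sup>2 \<le> e\<^sup>2"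
        by (rule half[OF diff _ N[OF that(1)] N[OF that(2)]])
    qed (use e in simp)
    then show "\<exists>N. \<forall>m\<ge>N. \<forall>n\<ge>N. ell2_norm W (\<lambda>x. poly_op A (p m) f x - poly_op A (p n) f x) \<le> e"
      by blast
  qed blast
  then show ?thesis using that by blast
qed

end

section \<open>The spectral theorem\<close>

text \<open>Both finite measures have the same distribution function. This turns the Stieltjes
  integral in \<open>spectral_family\<close> into an integral against the spectral measure of a
  vector; the factor c will be the squared norm of the vector.\<close>

lemma interval_measure_cdf:
  assumes "real_distribution D" "0 \<le> c"
  shows "interval_measure (\<lambda>l. c * cdf D l) = density D (\<lambda>_. ennreal c)"
proof -
  interpret D: real_distribution D by (rule assms(1))
  have em: "emeasure (density D (\<lambda>_. ennreal c)) S = ennreal (c * measure D S)" if "S \<in> sets borel" for S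
    using that assms(2) by (simp add: emeasure_density nn_integral_cmult_indicator D.emeasure_eq_measure ennreal_mult)
  have mono: "c * cdf D x \<le> c * cdf D y" if "x \<le> y" for x y
    using that assms(2) by (intro mult_left_mono D.cdf_nondecreasing)
  have rc: "continuous (at_right a) (\<lambda>l. c * cdf D l)" for a
    by (intro continuous_intros D.cdf_is_right_cont)
  have bot: "((\<lambda>l. c * cdf D l) \<longlongrightarrow> 0) at_bot"
    using tendsto_mult_left[OF D.cdf_lim_at_bot, of c] by simp
  have top: "((\<lambda>l. c * cdf D l) \<longlongrightarrow> c) at_top"
    using tendsto_mult_left[OF D.cdf_lim_at_top_prob, of c] by simp
  show ?thesis
  proof (rule cdf_unique')
    show "finite_borel_measure (interval_measure (\<lambda>l. c * cdf D l))"
      by (rule finite_borel_measure_interval_measure[OF mono rc bot top assms(2)])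
    show "finite_borel_measure (density D (\<lambda>_. ennreal c))"
    proof (intro finite_borel_measure.intro finite_measureI finite_borel_measure_axioms.intro)
      show "emeasure (density D (\<lambda>_. ennreal c)) (space (density D (\<lambda>_. ennreal c))) \<noteq> \<infinity>"
        using em[of UNIV] by simp
    qed simp
    have "measure (density D (\<lambda>_. ennreal c)) {..x} = c * cdf D x" for x
      unfolding measure_def em[OF atMost_borel] cdf_def
      using assms(2) by (simp add: measure_def[symmetric])
    then show "cdf (interval_measure (\<lambda>l. c * cdf D l)) = cdf (density D (\<lambda>_. ennreal c))"
      by (simp add: cdf_interval_measure[OF mono rc bot] fun_eq_iff cdf_def[of "density _ _"])
  qed
qed

context symmetric_op
begin

text \<open>The spectral projection onto $(-\infty, l]$ is the strong limit of any boundedly convergent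
  sequence of polynomials approximating the indicator function.\<close>

theorem spectral_family_exists: "\<exists>E. spectral_family W A E"
proof -
  have "\<exists>q. (\<forall>n x. \<bar>x\<bar> \<le> C \<longrightarrow> \<bar>poly (q n) x\<bar> \<le> 2) \<and>
      (\<forall>x. \<bar>x\<bar> \<le> C \<longrightarrow> (\<lambda>n. poly (q n) x) \<longlonglongrightarrow> (if x \<le> l then 1 else 0))" for l
    using step_function_poly_approx[of C l] by metis
  then obtain q where q2: "\<And>l n x. \<bar>x\<bar> \<le> C \<Longrightarrow> \<bar>poly (q l n) x\<bar> \<le> 2"
    and qlim: "\<And>l x. \<bar>x\<bar> \<le> C \<Longrightarrow> (\<lambda>n. poly (q l n) x) \<longlonglongrightarrow> (if x \<le> l then 1 else 0)"
    by metis
  define E where "E = (\<lambda>l f. SOME h. h \<in> ell2 W \<and>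
      (\<lambda>n. ell2_norm W (\<lambda>x. poly_op A (q l n) f x - h x)) \<longlonglongrightarrow> 0)"
  have m: "(\<lambda>x. if x \<le> l then 1 else 0 :: real) \<in> borel_measurable borel" for l :: real
    by measurable
  have E: "E l f \<in> ell2 W \<and> (\<lambda>n. ell2_norm W (\<lambda>x. poly_op A (q l n) f x - E l f x)) \<longlonglongrightarrow> 0"
    if "f \<in> ell2 W" for l f
  proof -
    have "\<exists>h. h \<in> ell2 W \<and> (\<lambda>n. ell2_norm W (\<lambda>x. poly_op A (q l n) f x - h x)) \<longlonglongrightarrow> 0"
      by (rule poly_op_converges[OF that, of "q l", OF q2 qlim m]) blast+
    from someI_ex[OF this] show ?thesis by (simp only: E_def)
  qed
  note Ec = E[THEN conjunct1] and Elim = E[THEN conjunct2]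
  \<comment> \<open>\<open>E\<close> is a chosen limit; uniqueness of limits is the tool by which
    each identity for \<open>E\<close> below is deduced from one for polynomials.\<close>
  have Eu: "E l f = h" if "f \<in> ell2 W" "h \<in> ell2 W"
      "(\<lambda>n. ell2_norm W (\<lambda>x. poly_op A (q l n) f x - h x)) \<longlonglongrightarrow> 0" for l f h
    by (rule ell2_tendsto_unique[OF poly_op_closed[OF that(1)] Ec[OF that(1)] that(2) Elim[OF that(1)] that(3)])
  have Eadd: "E l (\<lambda>x. f x + g x) = (\<lambda>x. E l f x + E l g x)" if f: "f \<in> ell2 W" and g: "g \<in> ell2 W" for l f g
  proof (rule Eu[OF ell2_add[OF f g] ell2_add[OF Ec[OF f] Ec[OF g]]])
    have lim: "(\<lambda>n. ell2_norm W (\<lambda>x. poly_op A (q l n) f x - E l f x) +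
        ell2_norm W (\<lambda>x. poly_op A (q l n) g x - E l g x)) \<longlonglongrightarrow> 0"
      using tendsto_add[OF Elim[OF f] Elim[OF g]] by simp
    have le: "ell2_norm W (\<lambda>x. poly_op A (q l n) (\<lambda>x. f x + g x) x - (E l f x + E l g x)) \<le>
        ell2_norm W (\<lambda>x. poly_op A (q l n) f x - E l f x) +
        ell2_norm W (\<lambda>x. poly_op A (q l n) g x - E l g x)" for n
      using ell2_norm_triangle[OF ell2_diff[OF poly_op_closed[OF f, of "q l n"] Ec[OF f, of l]] ell2_diff[OF poly_op_closed[OF g, of "q l n"] Ec[OF g, of l]]]
      by (simp add: poly_op_add_fun[OF f g] add_diff_add)
    show "(\<lambda>n. ell2_norm W (\<lambda>x. poly_op A (q l n) (\<lambda>x. f x + g x) x - (E l f x + E l g x))) \<longlonglongrightarrow> 0"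
      by (rule ell2_norm_tendsto_0[OF le lim])
  qed
  have Escale: "E l (\<lambda>x. c * f x) = (\<lambda>x. c * E l f x)" if f: "f \<in> ell2 W" for l f c
  proof (rule Eu[OF ell2_scale[OF f] ell2_scale[OF Ec[OF f]]])
    have "(\<lambda>n. cmod c * ell2_norm W (\<lambda>x. poly_op A (q l n) f x - E l f x)) \<longlonglongrightarrow> cmod c * 0"
      by (intro tendsto_intros Elim f)
    then show "(\<lambda>n. ell2_norm W (\<lambda>x. poly_op A (q l n) (\<lambda>x. c * f x) x - c * E l f x)) \<longlonglongrightarrow> 0"
      by (simp add: poly_op_scale_fun[OF f] ell2_norm_scale flip: right_diff_distrib)
  qed
  have Enorm: "ell2_norm W (E l f) \<le> 2 * ell2_norm W f" if f: "f \<in> ell2 W" for l f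
  proof -
    have lim: "(\<lambda>n. ell2_norm W (\<lambda>x. poly_op A (q l n) f x - E l f x) + 2 * ell2_norm W f) \<longlonglongrightarrow> 0 + 2 * ell2_norm W f"
      by (intro tendsto_intros Elim f)
    have le: "ell2_norm W (E l f) \<le>
        ell2_norm W (\<lambda>x. poly_op A (q l n) f x - E l f x) + 2 * ell2_norm W f" for n
      using ell2_norm_triangle[OF ell2_diff[OF Ec[OF f] poly_op_closed[OF f]] poly_op_closed[OF f], of l "q l n" "q l n"]
        poly_op_norm_le[OF f q2[where l = l and n = n]] by (simp add: ell2_norm_minus_commute[of W "E l f"])
    show ?thesis using LIMSEQ_le_const[OF lim] le by simp
  qed
  have Ebound: "bounded_op W (E l)" for l
    unfolding bounded_op_def using Ec Eadd Escale Enorm by blast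
  \<comment> \<open>The polynomials q_a q_b - q_(min a b) stay bounded on [-C, C] and tend to 0
    there, because indicators of half-lines multiply in this way. Idempotence and monotonicity of
    the family are both special cases.\<close>
  have Emin: "E a (E b f) = E (min a b) f" if f: "f \<in> ell2 W" for a b f
  proof (rule Eu[OF Ec[OF f] Ec[OF f]])
    let ?u = "\<lambda>n. poly_op A (q b n) f" and ?r = "\<lambda>n. q a n * q b n - q (min a b) n"
    have "(\<lambda>n. ell2_norm W (poly_op A (?r n) f)) \<longlonglongrightarrow> 0"
    proof (rule poly_op_tendsto_0[OF f])
      fix x assume x: "\<bar>x\<bar> \<le> C"
      show "\<bar>poly (?r n) x\<bar> \<le> 2 * 2 + 2" for n
      proof -
        have "\<bar>poly (q a n) x * poly (q b n) x\<bar> \<le> 2 * 2"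
          unfolding abs_mult by (intro mult_mono q2 x) auto
        then show ?thesis using q2[OF x, of "min a b" n] by simp
      qed
      have "(\<lambda>n. poly (?r n) x) \<longlonglongrightarrow> (if x \<le> a then 1 else 0) * (if x \<le> b then 1 else 0) - (if x \<le> min a b then 1 else 0)"
        by (simp only: poly_diff poly_mult) (intro tendsto_intros qlim x)
      then show "(\<lambda>n. poly (?r n) x) \<longlonglongrightarrow> 0" by (auto split: if_splits)
    qed
    from tendsto_add[OF tendsto_mult_left[OF Elim[OF f, of b], of 2] tendsto_add[OF this Elim[OF f, of "min a b"]]]
    have lim: "(\<lambda>n. 2 * ell2_norm W (\<lambda>x. ?u n x - E b f x) + (ell2_norm W (poly_op A (?r n) f) +
        ell2_norm W (\<lambda>x. poly_op A (q (min a b) n) f x - E (min a b) f x))) \<longlonglongrightarrow> 0"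
      by simp
    have le: "ell2_norm W (\<lambda>x. poly_op A (q a n) (E b f) x - E (min a b) f x) \<le>
        2 * ell2_norm W (\<lambda>x. ?u n x - E b f x) + (ell2_norm W (poly_op A (?r n) f) +
        ell2_norm W (\<lambda>x. poly_op A (q (min a b) n) f x - E (min a b) f x))" for n
    proof -
      have u: "?u n \<in> ell2 W" by (rule poly_op_closed[OF f])
      let ?v = "poly_op A (q a n) (?u n)" and ?w = "poly_op A (q (min a b) n) f"
      have v: "?v \<in> ell2 W" "?w \<in> ell2 W" "poly_op A (q a n) (E b f) \<in> ell2 W"
        by (intro poly_op_closed u f Ec)+
      have "ell2_norm W (\<lambda>x. poly_op A (q a n) (E b f) x - ?v x) =
          ell2_norm W (poly_op A (q a n) (\<lambda>x. E b f x - ?u n x))"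
        by (simp add: poly_op_diff_fun[OF Ec[OF f] u])
      also have "\<dots> \<le> 2 * ell2_norm W (\<lambda>x. ?u n x - E b f x)"
        using poly_op_norm_le[OF ell2_diff[OF Ec[OF f, of b] u] q2[where l = a and n = n]]
        by (simp add: ell2_norm_minus_commute[of W "E b f"])
      finally have 1: "ell2_norm W (\<lambda>x. poly_op A (q a n) (E b f) x - ?v x) \<le> 2 * ell2_norm W (\<lambda>x. ?u n x - E b f x)" .
      have 2: "(\<lambda>x. ?v x - ?w x) = poly_op A (?r n) f"
        by (simp add: poly_op_diff[OF f] poly_op_mult[OF f])
      show ?thesis
        using ell2_norm_triangle_diff[OF v(3) v(1) Ec[OF f], of "min a b"] ell2_norm_triangle_diff[OF v(1,2) Ec[OF f], of "min a b"] 1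
        unfolding 2 by linarith
    qed
    show "(\<lambda>n. ell2_norm W (\<lambda>x. poly_op A (q a n) (E b f) x - E (min a b) f x)) \<longlonglongrightarrow> 0"
      by (rule ell2_norm_tendsto_0[OF le lim])
  qed
  have Elim_inner: "(\<lambda>n. ell2_inner W (poly_op A (q l n) f) g) \<longlonglongrightarrow> ell2_inner W (E l f) g"
    if "f \<in> ell2 W" "g \<in> ell2 W" for l f g
    by (rule ell2_inner_tendsto[OF poly_op_closed[OF that(1)] Ec[OF that(1)] that(2) Elim[OF that(1)]])
  have Esym: "ell2_inner W (E l f) g = ell2_inner W f (E l g)" if f: "f \<in> ell2 W" and g: "g \<in> ell2 W" for l f g
  proof (rule LIMSEQ_unique[OF Elim_inner[OF f g]])
    have "(\<lambda>n. cnj (ell2_inner W (poly_op A (q l n) g) f)) \<longlonglongrightarrow> cnj (ell2_inner W (E l g) f)"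
      by (intro tendsto_cnj Elim_inner f g)
    then show "(\<lambda>n. ell2_inner W (poly_op A (q l n) f) g) \<longlonglongrightarrow> ell2_inner W f (E l g)"
      by (simp add: poly_op_symmetric[OF f g] flip: ell2_inner_commute)
  qed
  have proj: "orthogonal_projection W (E l)" for l
    unfolding orthogonal_projection_def using Ebound Emin[of _ l l] Esym by auto
  have below: "E l f = (\<lambda>_. 0)" if f: "f \<in> ell2 W" and "l < - C" for l f
  proof (rule Eu[OF f ell2_zero])
    have "(\<lambda>n. ell2_norm W (poly_op A (q l n) f)) \<longlonglongrightarrow> 0"
    proof (rule poly_op_tendsto_0[OF f])
      fix x assume x: "\<bar>x\<bar> \<le> C"
      show "\<bar>poly (q l n) x\<bar> \<le> 2" for n by (rule q2[OF x])
      have "\<not> x \<le> l" using x \<open>l < - C\<close> by linarith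
      then show "(\<lambda>n. poly (q l n) x) \<longlonglongrightarrow> 0" using qlim[OF x, of l] by simp
    qed
    then show "(\<lambda>n. ell2_norm W (\<lambda>x. poly_op A (q l n) f x - 0)) \<longlonglongrightarrow> 0" by simp
  qed
  have above: "E l f = f" if f: "f \<in> ell2 W" and "C \<le> l" for l f
  proof (rule Eu[OF f f])
    have "(\<lambda>n. ell2_norm W (poly_op A (q l n - 1) f)) \<longlonglongrightarrow> 0"
    proof (rule poly_op_tendsto_0[OF f])
      fix x assume x: "\<bar>x\<bar> \<le> C"
      show "\<bar>poly (q l n - 1) x\<bar> \<le> 3" for n using q2[OF x, of l n] by simp
      show "(\<lambda>n. poly (q l n - 1) x) \<longlonglongrightarrow> 0"
      proof -
        have "x \<le> l" using x \<open>C \<le> l\<close> by linarith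
        then show ?thesis using tendsto_diff[OF qlim[OF x, of l] tendsto_const[of 1]] by simp
      qed
    qed
    then show "(\<lambda>n. ell2_norm W (\<lambda>x. poly_op A (q l n) f x - f x)) \<longlonglongrightarrow> 0"
      by (simp add: poly_op_diff[OF f] poly_op_1[OF f])
  qed
  have cdfE: "\<exists>D. real_distribution D \<and> (\<forall>l. ell2_inner W (E l f) f = of_real ((ell2_norm W f)\<^sup>2 * cdf D l)) \<and>
      ell2_inner W (A f) f = of_real ((ell2_norm W f)\<^sup>2 * (\<integral>x. x \<partial>D))" if f: "f \<in> ell2 W" for f
  proof -
    obtain D where D: "real_distribution D" "AE x in D. \<bar>x\<bar> \<le> C"
      "\<And>p. ell2_inner W (poly_op A p f) f = of_real ((ell2_norm W f)\<^sup>2 * (\<integral>x. poly p x \<partial>D))"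
      by (rule spectral_measure[OF f]) blast
    interpret D: real_distribution D by (rule D(1))
    have "ell2_inner W (E l f) f = of_real ((ell2_norm W f)\<^sup>2 * cdf D l)" for l
    proof (rule LIMSEQ_unique[OF Elim_inner[OF f f]])
      have "(\<integral>x. (if x \<le> l then 1 else 0) \<partial>D) = (\<integral>x. indicat_real {..l} x \<partial>D)"
        by (intro Bochner_Integration.integral_cong) auto
      then have "(\<integral>x. (if x \<le> l then 1 else 0) \<partial>D) = cdf D l" by (simp add: cdf_def)
      moreover have "(\<lambda>n. \<integral>x. poly (q l n) x \<partial>D) \<longlonglongrightarrow> (\<integral>x. (if x \<le> l then 1 else 0) \<partial>D)"
        by (rule poly_integrals_tendsto(1)[OF D(1,2) q2 qlim m])
      ultimately show "(\<lambda>n. ell2_inner W (poly_op A (q l n) f) f) \<longlonglongrightarrow> of_real ((ell2_norm W f)\<^sup>2 * cdf D l)"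
        unfolding D(3) by (intro tendsto_intros) simp
    qed
    moreover have "ell2_inner W (A f) f = of_real ((ell2_norm W f)\<^sup>2 * (\<integral>x. x \<partial>D))"
      using D(3)[of "[:0, 1:]"] by (simp add: poly_op_X[OF f])
    ultimately show ?thesis using D(1) by blast
  qed
  \<comment> \<open>By \<open>Emin\<close> the squared distance of E_k f and E_l f is ||f||^2 times
    the increment of a distribution function between l and k, so strong continuity follows from
    scalar continuity.\<close>
  have rcont: "((\<lambda>k. ell2_norm W (\<lambda>x. E k f x - E l f x)) \<longlongrightarrow> 0) (at_right l)" if f: "f \<in> ell2 W" for l f
  proof -
    obtain D where D: "real_distribution D"
      "\<And>l. ell2_inner W (E l f) f = of_real ((ell2_norm W f)\<^sup>2 * cdf D l)"
      using cdfE[OF f] by blast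
    interpret D: real_distribution D by (rule D(1))
    have in2: "ell2_inner W (E a f) (E b f) = of_real ((ell2_norm W f)\<^sup>2 * cdf D (min a b))" for a b
      using Esym[OF Ec[OF f, of a] f, of b] Emin[OF f, of b a] D(2)[of "min a b"] by (simp add: min.commute)
    have sq: "(ell2_norm W (\<lambda>x. E k f x - E l f x))\<^sup>2 = (ell2_norm W f)\<^sup>2 * (cdf D k - cdf D l)" if "l < k" for k
      using that Ec[OF f] by (simp add: ell2_norm_diff_sq norm_sq_eq_inner in2 min_absorb2 algebra_simps)
    have "((\<lambda>k. (ell2_norm W f)\<^sup>2 * (cdf D k - cdf D l)) \<longlongrightarrow> (ell2_norm W f)\<^sup>2 * (cdf D l - cdf D l)) (at_right l)"
      using D.cdf_is_right_cont[of l] unfolding continuous_within by (intro tendsto_intros)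
    moreover have "\<forall>\<^sub>F k in at_right l. (ell2_norm W f)\<^sup>2 * (cdf D k - cdf D l) = (ell2_norm W (\<lambda>x. E k f x - E l f x))\<^sup>2"
      by (auto simp: eventually_at_filter sq)
    ultimately have "((\<lambda>k. (ell2_norm W (\<lambda>x. E k f x - E l f x))\<^sup>2) \<longlongrightarrow> 0) (at_right l)"
      using Lim_transform_eventually by fastforce
    from tendsto_real_sqrt[OF this] show ?thesis by (simp add: ell2_norm_nonneg)
  qed
  have int: "ell2_inner W (A f) f =
      complex_of_real (\<integral>x. x \<partial>interval_measure (\<lambda>l. Re (ell2_inner W (E l f) f)))" if f: "f \<in> ell2 W" for f
  proof -
    obtain D where D: "real_distribution D"
      "\<And>l. ell2_inner W (E l f) f = of_real ((ell2_norm W f)\<^sup>2 * cdf D l)"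
      "ell2_inner W (A f) f = of_real ((ell2_norm W f)\<^sup>2 * (\<integral>x. x \<partial>D))"
      using cdfE[OF f] by blast
    interpret D: real_distribution D by (rule D(1))
    have "(\<integral>x. x \<partial>density D (\<lambda>_. ennreal ((ell2_norm W f)\<^sup>2))) = (\<integral>x. (ell2_norm W f)\<^sup>2 *\<^sub>R x \<partial>D)"
      by (rule integral_density) auto
    then show ?thesis
      by (simp add: D(2,3) interval_measure_cdf[OF D(1)])
  qed
  have "spectral_family W A E"
    unfolding spectral_family_def
  proof (intro conjI allI impI ballI proj rcont int)
    show "E l (E k f) = E l f" "E k (E l f) = E l f" if "l \<le> k" "f \<in> ell2 W" for l k f
      using that by (simp_all add: Emin min_absorb1 min_absorb2)
    show "\<exists>a b. \<forall>f\<in>ell2 W. (\<forall>l<a. E l f = (\<lambda>_. 0)) \<and> (\<forall>l\<ge>b. E l f = f)"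
      using below above by blast
  qed
  then show ?thesis by blast
qed

end

section \<open>Moments of the spectral density\<close>

text \<open>The distribution function of a finite measure carried by (a, b] with total mass
  \<open>F b\<close>. The mass is not normalised, so that sums of quadratic forms over a fundamental
  domain are covered.\<close>

locale compact_distribution =
  fixes F :: "real \<Rightarrow> real" and a b :: real
  assumes ab: "a < b" and mono: "\<And>x y. x \<le> y \<Longrightarrow> F x \<le> F y"
    and right_cont: "\<And>x. continuous (at_right x) F"
    and below: "\<And>x. x \<le> a \<Longrightarrow> F x = 0" and above: "\<And>x. b \<le> x \<Longrightarrow> F x = F b"
begin

lemma Fb_nonneg: "0 \<le> F b"
  using mono[of a b] below[of a] ab by simp

lemma lim_at_bot: "(F \<longlongrightarrow> 0) at_bot"
  by (rule tendsto_eventually[OF eventually_mono[OF eventually_le_at_bot[of a] below]])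

lemma lim_at_top: "(F \<longlongrightarrow> F b) at_top"
  by (rule tendsto_eventually[OF eventually_mono[OF eventually_ge_at_top[of b] above]])

sublocale M: finite_measure "interval_measure F"
  rewrites "space (interval_measure F) = UNIV"
    and "sets (interval_measure F) = sets borel"
proof -
  show "finite_measure (interval_measure F)"
    using finite_borel_measure_interval_measure[OF mono right_cont lim_at_bot lim_at_top Fb_nonneg]
    by (auto simp: finite_borel_measure_def)
qed auto

lemma measure_Ioc: "x \<le> y \<Longrightarrow> measure (interval_measure F) {x<..y} = F y - F x"
  by (rule measure_interval_measure_Ioc[OF _ mono right_cont])

lemma AE_Ioc: "AE x in interval_measure F. x \<in> {a<..b}"
proof -
  have "emeasure (interval_measure F) UNIV = F b"
    by (rule interval_measure_UNIV[OF mono right_cont lim_at_bot lim_at_top Fb_nonneg])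
  moreover have "emeasure (interval_measure F) {a<..b} = F b"
    using emeasure_interval_measure_Ioc[OF less_imp_le[OF ab] mono right_cont] below[of a] by simp
  ultimately have "emeasure (interval_measure F) (UNIV - {a<..b}) = 0"
    by (subst emeasure_Diff) (auto simp: Fb_nonneg)
  then show ?thesis
    by (intro AE_I[of _ _ "UNIV - {a<..b}"]) auto
qed

lemma integrable_bounded:
  fixes h :: "real \<Rightarrow> real"
  assumes "h \<in> borel_measurable borel" "\<And>x. x \<in> {a..b} \<Longrightarrow> \<bar>h x\<bar> \<le> B"
  shows "integrable (interval_measure F) h"
proof -
  have "AE x in interval_measure F. norm (h x) \<le> B"
    using AE_Ioc by eventually_elim (use assms(2) in auto)
  then show ?thesis using assms(1) by (intro M.integrable_const_bound[where B = B]) auto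
qed

text \<open>The increments of F are the masses of the half-open pieces (t_i, t_(i+1)], so a Riemann
  sum tagged at right end points integrates a step function that differs from h by at most
  e.\<close>

lemma riemann_sum_bound:
  fixes h :: "real \<Rightarrow> real"
  assumes h: "h \<in> borel_measurable borel" "\<And>x. x \<in> {a..b} \<Longrightarrow> \<bar>h x\<bar> \<le> B"
    and t: "t 0 = a" "t N = b" "\<And>i. i < N \<Longrightarrow> t i \<le> t (Suc i)"
    and e: "\<And>i x. i < N \<Longrightarrow> x \<in> {t i<..t (Suc i)} \<Longrightarrow> \<bar>h x - h (t (Suc i))\<bar> \<le> e"
  shows "\<bar>(\<integral>x. h x \<partial>interval_measure F) - (\<Sum>i<N. h (t (Suc i)) * (F (t (Suc i)) - F (t i)))\<bar> \<le> e * F b"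
proof -
  let ?M = "interval_measure F"
  have int: "integrable ?M h" by (rule integrable_bounded[OF h])
  have sint: "set_integrable ?M {x<..y} h" for x y
    unfolding set_integrable_def using int by (intro integrable_mult_indicator) auto
  have step: "\<bar>(LINT x:{t i<..t (Suc i)}|?M. h x) - h (t (Suc i)) * (F (t (Suc i)) - F (t i))\<bar> \<le>
      e * (F (t (Suc i)) - F (t i))" if i: "i < N" for i
  proof -
    let ?I = "{t i<..t (Suc i)}" and ?c = "h (t (Suc i))"
    have c: "set_integrable ?M ?I (\<lambda>x. k)" for k :: real
      unfolding set_integrable_def by (intro integrable_mult_indicator) auto
    have cI: "(LINT x:?I|?M. k) = k * (F (t (Suc i)) - F (t i))" for k :: real
      by (simp add: set_lebesgue_integral_def measure_Ioc[OF t(3)[OF i]] mult.commute)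
    have diff: "set_integrable ?M ?I (\<lambda>x. h x - ?c)" by (rule set_integral_diff(1)[OF sint c])
    have "(LINT x:?I|?M. h x) - ?c * (F (t (Suc i)) - F (t i)) = (LINT x:?I|?M. h x - ?c)"
      by (simp add: set_integral_diff(2)[OF sint c] cI)
    also have "\<bar>\<dots>\<bar> \<le> (LINT x:?I|?M. \<bar>h x - ?c\<bar>)"
      using set_integral_norm_bound[OF diff] by simp
    also have "\<dots> \<le> (LINT x:?I|?M. e)"
      using e[OF i] by (intro set_integral_mono c set_integrable_abs diff) auto
    finally show ?thesis by (simp add: cI)
  qed
  have "t 0 \<le> t j \<and> \<bar>(LINT x:{a<..t j}|?M. h x) - (\<Sum>i<j. h (t (Suc i)) * (F (t (Suc i)) - F (t i)))\<bar> \<le> e * (F (t j) - F a)"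
    if "j \<le> N" for j
    using that
  proof (induction j)
    case 0
    then show ?case by (simp add: t(1) set_lebesgue_integral_def)
  next
    case (Suc j)
    then have j: "j < N" and IH: "t 0 \<le> t j"
      "\<bar>(LINT x:{a<..t j}|?M. h x) - (\<Sum>i<j. h (t (Suc i)) * (F (t (Suc i)) - F (t i)))\<bar> \<le> e * (F (t j) - F a)"
      by auto
    have "{a<..t (Suc j)} = {a<..t j} \<union> {t j<..t (Suc j)}"
      using IH(1) t(1) t(3)[OF j] by auto
    then have "(LINT x:{a<..t (Suc j)}|?M. h x) = (LINT x:{a<..t j}|?M. h x) + (LINT x:{t j<..t (Suc j)}|?M. h x)"
      using sint by (simp only:) (intro set_integral_Un, auto)
    then show ?case
      using IH step[OF j] t(3)[OF j] by (simp add: right_diff_distrib)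
  qed
  from this[of N] have "\<bar>(LINT x:{a<..b}|?M. h x) - (\<Sum>i<N. h (t (Suc i)) * (F (t (Suc i)) - F (t i)))\<bar> \<le> e * F b"
    using t(2) below[of a] by simp
  moreover have "(LINT x:{a<..b}|?M. h x) = (\<integral>x. h x \<partial>?M)"
    unfolding set_lebesgue_integral_def using AE_Ioc h(1)
    by (intro integral_cong_AE) auto
  ultimately show ?thesis by simp
qed

end

text \<open>Rescale T f to a vector k of the same norm as f. By symmetry, 4 Re <T f, k> is the
  difference of the forms at f + k and f - k, and the parallelogram law bounds it by 4 d ||f||^2.
  The point is to pass from quadratic forms, which are all that a resolution of the identity
  prescribes, to operator norms.\<close>

lemma numerical_radius_bound:
  assumes closed: "\<And>f. f \<in> ell2 W \<Longrightarrow> T f \<in> ell2 W"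
    and add: "\<And>f g. f \<in> ell2 W \<Longrightarrow> g \<in> ell2 W \<Longrightarrow> T (\<lambda>x. f x + g x) = (\<lambda>x. T f x + T g x)"
    and scale: "\<And>f c. f \<in> ell2 W \<Longrightarrow> T (\<lambda>x. c * f x) = (\<lambda>x. c * T f x)"
    and sym: "\<And>f g. f \<in> ell2 W \<Longrightarrow> g \<in> ell2 W \<Longrightarrow> ell2_inner W (T f) g = ell2_inner W f (T g)"
    and d: "\<And>f. f \<in> ell2 W \<Longrightarrow> \<bar>Re (ell2_inner W (T f) f)\<bar> \<le> d * (ell2_norm W f)\<^sup>2"
    and f: "f \<in> ell2 W"
  shows "ell2_norm W (T f) \<le> d * ell2_norm W f"
proof (cases "ell2_norm W f = 0 \<or> ell2_norm W (T f) = 0")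
  case True
  moreover have "ell2_norm W (T f) = 0" if "ell2_norm W f = 0"
    using ell2_norm_eq_0[OF f that] scale[OF ell2_zero, of 0] by simp
  moreover have "0 \<le> d" if "ell2_norm W f \<noteq> 0"
  proof -
    have "0 \<le> d * (ell2_norm W f)\<^sup>2" using d[OF f] by linarith
    then show ?thesis using that by (simp add: zero_le_mult_iff)
  qed
  ultimately show ?thesis using ell2_norm_nonneg[of W f] by fastforce
next
  case False
  let ?n = "ell2_norm W f" and ?m = "ell2_norm W (T f)"
  have pos: "0 < ?n" "0 < ?m" using False ell2_norm_nonneg[of W f] ell2_norm_nonneg[of W "T f"] by auto
  define k where "k = (\<lambda>x. complex_of_real (?n / ?m) * T f x)"
  have k: "k \<in> ell2 W" unfolding k_def by (intro ell2_scale closed f)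
  have nk: "ell2_norm W k = ?n" unfolding k_def ell2_norm_scale using pos by (simp add: norm_divide)
  have Tfk: "Re (ell2_inner W (T f) k) = ?n * ?m"
  proof -
    have "ell2_inner W (T f) k = complex_of_real (?n / ?m * ?m\<^sup>2)"
      unfolding k_def ell2_inner_scale_right ell2_inner_self[OF closed[OF f]] by simp
    then show ?thesis using pos by (simp only: Re_complex_of_real power2_eq_square) simp
  qed
  have km: "(\<lambda>x. - 1 * k x) \<in> ell2 W" by (rule ell2_scale[OF k])
  have Tkf: "Re (ell2_inner W (T k) f) = Re (ell2_inner W (T f) k)"
    using sym[OF k f] ell2_inner_commute[of W k "T f"] by simp
  have q: "Re (ell2_inner W (T (\<lambda>x. f x + s * k x)) (\<lambda>x. f x + s * k x)) =
      Re (ell2_inner W (T f) f) + 2 * Re s * Re (ell2_inner W (T f) k) + Re (ell2_inner W (T k) k)"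
    if "s = 1 \<or> s = - 1" for s
    using that f k ell2_scale[OF k, of s] Tkf
    by (auto simp: add scale ell2_inner_add_left ell2_inner_add_right ell2_inner_scale_left ell2_inner_scale_right
        closed ell2_scale ell2_add ell2_inner_diff_left ell2_inner_diff_right ell2_diff)
  have nq: "(ell2_norm W (\<lambda>x. f x + 1 * k x))\<^sup>2 + (ell2_norm W (\<lambda>x. f x + - 1 * k x))\<^sup>2 = 4 * ?n\<^sup>2"
    using ell2_norm_add_sq[OF f k] ell2_norm_diff_sq[OF f k] nk by simp
  have "4 * (?n * ?m) = Re (ell2_inner W (T (\<lambda>x. f x + 1 * k x)) (\<lambda>x. f x + 1 * k x)) -
      Re (ell2_inner W (T (\<lambda>x. f x + - 1 * k x)) (\<lambda>x. f x + - 1 * k x))"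
    using q[of 1] q[of "- 1"] Tfk by simp
  also have "\<dots> \<le> d * (ell2_norm W (\<lambda>x. f x + 1 * k x))\<^sup>2 + d * (ell2_norm W (\<lambda>x. f x + - 1 * k x))\<^sup>2"
    using d[OF ell2_add[OF f ell2_scale[OF k, of 1]]] d[OF ell2_add[OF f ell2_scale[OF k, of "- 1"]]] by linarith
  also have "\<dots> = 4 * (d * ?n * ?n)" using nq by (simp add: power2_eq_square flip: distrib_left)
  finally have "?n * ?m \<le> ?n * (d * ?n)" by (simp add: mult_ac)
  then show ?thesis using pos by simp
qed

section \<open>Moments of an arbitrary resolution of the identity\<close>

context symmetric_op
begin

context
  fixes E
  assumes sf: "spectral_family W A E"
begin

lemma E_closed: "f \<in> ell2 W \<Longrightarrow> E l f \<in> ell2 W"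
  and E_add: "f \<in> ell2 W \<Longrightarrow> g \<in> ell2 W \<Longrightarrow> E l (\<lambda>x. f x + g x) = (\<lambda>x. E l f x + E l g x)"
  and E_scale: "f \<in> ell2 W \<Longrightarrow> E l (\<lambda>x. c * f x) = (\<lambda>x. c * E l f x)"
  and E_symmetric: "f \<in> ell2 W \<Longrightarrow> g \<in> ell2 W \<Longrightarrow> ell2_inner W (E l f) g = ell2_inner W f (E l g)"
  using sf by (auto simp: spectral_family_def orthogonal_projection_def bounded_op_def)

lemma E_min: "f \<in> ell2 W \<Longrightarrow> E l (E k f) = E (min l k) f"
  using sf by (cases "l \<le> k") (auto simp: spectral_family_def min_absorb1 min_absorb2)

lemma E_diff:
  assumes "f \<in> ell2 W" "g \<in> ell2 W"
  shows "E l (\<lambda>x. f x - g x) = (\<lambda>x. E l f x - E l g x)"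
  using E_add[OF assms(1) ell2_scale[OF assms(2), of "- 1"]] E_scale[OF assms(2), of l "- 1"] by simp

lemma E_inner: "f \<in> ell2 W \<Longrightarrow> Re (ell2_inner W (E l f) f) = (ell2_norm W (E l f))\<^sup>2"
  using E_symmetric[OF E_closed[of f l], of f l] E_min[of f l l] by (simp add: norm_sq_eq_inner E_closed)

lemma E_norm_le:
  assumes f: "f \<in> ell2 W" shows "ell2_norm W (E l f) \<le> ell2_norm W f"
proof -
  have "ell2_norm W (E l f) * ell2_norm W (E l f) \<le> ell2_norm W (E l f) * ell2_norm W f"
    using Cauchy_Schwarz_Re[OF E_closed[OF f] f, of l] by (simp add: E_inner[OF f] power2_eq_square)
  then show ?thesis
    using ell2_norm_nonneg[of W "E l f"] ell2_norm_nonneg[of W f] by (auto simp: mult_le_cancel_left)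
qed

lemma E_support: obtains a b where "a < b" "\<And>l f. f \<in> ell2 W \<Longrightarrow> l \<le> a \<Longrightarrow> E l f = (\<lambda>_. 0)"
  "\<And>l f. f \<in> ell2 W \<Longrightarrow> b \<le> l \<Longrightarrow> E l f = f"
proof -
  obtain a b where "\<forall>f\<in>ell2 W. (\<forall>l<a. E l f = (\<lambda>_. 0)) \<and> (\<forall>l\<ge>b. E l f = f)"
    using sf unfolding spectral_family_def by blast
  then show ?thesis by (intro that[of "a - 1" "max a b"]) auto
qed

lemma compact_distribution_E:
  assumes ab: "a < b" and below: "\<And>l f. f \<in> ell2 W \<Longrightarrow> l \<le> a \<Longrightarrow> E l f = (\<lambda>_. 0)"
    and above: "\<And>l f. f \<in> ell2 W \<Longrightarrow> b \<le> l \<Longrightarrow> E l f = f"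
    and fs: "\<And>i. i \<in> I \<Longrightarrow> fs i \<in> ell2 W"
  shows "compact_distribution (\<lambda>l. \<Sum>i\<in>I. Re (ell2_inner W (E l (fs i)) (fs i))) a b"
proof
  show "a < b" by fact
  show "(\<Sum>i\<in>I. Re (ell2_inner W (E x (fs i)) (fs i))) \<le> (\<Sum>i\<in>I. Re (ell2_inner W (E y (fs i)) (fs i)))"
    if "x \<le> y" for x y
  proof (rule sum_mono)
    fix i assume i: "i \<in> I"
    have "ell2_norm W (E x (fs i)) \<le> ell2_norm W (E y (fs i))"
      using E_norm_le[OF E_closed[OF fs[OF i]], of x y] that by (simp add: E_min[OF fs[OF i]] min_absorb1)
    then show "Re (ell2_inner W (E x (fs i)) (fs i)) \<le> Re (ell2_inner W (E y (fs i)) (fs i))"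
      by (simp add: E_inner[OF fs[OF i]] ell2_norm_nonneg power_mono)
  qed
  show "continuous (at_right x) (\<lambda>l. \<Sum>i\<in>I. Re (ell2_inner W (E l (fs i)) (fs i)))" for x
    unfolding continuous_within
  proof (intro tendsto_sum tendsto_Re ell2_inner_tendsto)
    fix i assume i: "i \<in> I"
    show "((\<lambda>k. ell2_norm W (\<lambda>xa. E k (fs i) xa - E x (fs i) xa)) \<longlongrightarrow> 0) (at_right x)"
      using sf fs[OF i] by (auto simp: spectral_family_def)
  qed (auto simp: fs E_closed)
  show "(\<Sum>i\<in>I. Re (ell2_inner W (E x (fs i)) (fs i))) = 0" if "x \<le> a" for x
    using that by (intro sum.neutral) (auto simp: below fs)
  show "(\<Sum>i\<in>I. Re (ell2_inner W (E x (fs i)) (fs i))) = (\<Sum>i\<in>I. Re (ell2_inner W (E b (fs i)) (fs i)))"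
    if "b \<le> x" for x
    using that by (intro sum.cong) (auto simp: above fs)
qed

text \<open>The operators $\sum_i t_{i+1}^k (E_{t_{i+1}} - E_{t_i})$ approximate $A^k$ as the mesh of the
  partition tends to 0.\<close>

definition step_op :: "(nat \<Rightarrow> real) \<Rightarrow> nat \<Rightarrow> nat \<Rightarrow> 'v operator" where
  "step_op t N k f = (\<lambda>x. \<Sum>i<N. of_real (t (Suc i) ^ k) * (E (t (Suc i)) f x - E (t i) f x))"

lemma step_op_closed: "f \<in> ell2 W \<Longrightarrow> step_op t N k f \<in> ell2 W"
  unfolding step_op_def by (intro ell2_sum ell2_scale ell2_diff E_closed)

lemma step_op_inner:
  assumes f: "f \<in> ell2 W" and g: "g \<in> ell2 W"
  shows "ell2_inner W (step_op t N k f) g =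
    (\<Sum>i<N. of_real (t (Suc i) ^ k) * (ell2_inner W (E (t (Suc i)) f) g - ell2_inner W (E (t i) f) g))"
  unfolding step_op_def
  by (subst ell2_inner_sum_left) (auto intro!: ell2_scale ell2_diff E_closed f g sum.cong
      simp: ell2_inner_scale_left ell2_inner_diff_left[OF E_closed[OF f] E_closed[OF f] g])

text \<open>The increments of E over disjoint intervals are mutually orthogonal projections, so
  composing step operators multiplies their coefficients.\<close>

lemma step_op_Suc:
  assumes f: "f \<in> ell2 W" and t: "\<And>i j. i \<le> j \<Longrightarrow> j \<le> N \<Longrightarrow> t i \<le> t j"
  shows "step_op t N 1 (step_op t N k f) = step_op t N (Suc k) f"
proof -
  have E_sum: "E l (\<lambda>x. \<Sum>i\<in>J. g i x) = (\<lambda>x. \<Sum>i\<in>J. E l (g i) x)"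
    if "finite J" "\<And>i. i \<in> J \<Longrightarrow> g i \<in> ell2 W" for l J and g :: "nat \<Rightarrow> 'v \<Rightarrow> complex"
    using that
  proof (induction J rule: finite_induct)
    case empty
    then show ?case using E_scale[OF ell2_zero, of l 0] by simp
  qed (simp add: E_add ell2_sum)
  have Et: "E (t j) (step_op t N k f) =
      (\<lambda>x. \<Sum>i<N. of_real (t (Suc i) ^ k) * (E (min (t j) (t (Suc i))) f x - E (min (t j) (t i)) f x))" for j
    unfolding step_op_def using f
    by (subst E_sum) (auto intro!: ell2_scale ell2_diff E_closed simp: E_scale E_diff E_closed ell2_diff E_min)
  have Q: "E (t (Suc j)) (step_op t N k f) x - E (t j) (step_op t N k f) x =
      of_real (t (Suc j) ^ k) * (E (t (Suc j)) f x - E (t j) f x)" if j: "j < N" for j x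
  proof -
    have "E (t (Suc j)) (step_op t N k f) x - E (t j) (step_op t N k f) x =
      (\<Sum>i<N. if i = j then of_real (t (Suc j) ^ k) * (E (t (Suc j)) f x - E (t j) f x) else 0)"
      unfolding Et sum_subtractf[symmetric]
    proof (intro sum.cong refl)
      fix i assume i: "i \<in> {..<N}"
      consider "i = j" | "Suc i \<le> j" | "Suc j \<le> i" by linarith
      then show "of_real (t (Suc i) ^ k) * (E (min (t (Suc j)) (t (Suc i))) f x - E (min (t (Suc j)) (t i)) f x) -
          of_real (t (Suc i) ^ k) * (E (min (t j) (t (Suc i))) f x - E (min (t j) (t i)) f x) =
          (if i = j then of_real (t (Suc j) ^ k) * (E (t (Suc j)) f x - E (t j) f x) else 0)"
      proof cases
        case 1
        then show ?thesis using t[of j "Suc j"] j by (simp add: min_absorb1 min_absorb2)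
      next
        case 2
        then have "t i \<le> t j" "t (Suc i) \<le> t j" "t i \<le> t (Suc j)" "t (Suc i) \<le> t (Suc j)"
          using j by (auto intro!: t)
        then show ?thesis using 2 by (simp add: min_absorb2)
      next
        case 3
        then have "t j \<le> t i" "t (Suc j) \<le> t i" "t j \<le> t (Suc i)" "t (Suc j) \<le> t (Suc i)"
          using i by (auto intro!: t)
        then show ?thesis using 3 by (simp add: min_absorb1)
      qed
    qed
    then show ?thesis using j by simp
  qed
  show ?thesis
    unfolding step_op_def[of t N 1] step_op_def[of t N "Suc k"]
    by (intro ext sum.cong refl) (simp add: Q mult.assoc)
qed

text \<open>The quadratic form of the difference is the error of a Riemann sum for the integral of
  x, at most the mesh times ||f||^2; \<open>numerical_radius_bound\<close> turns this into a norm
  estimate.\<close>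

lemma step_op_norm_diff:
  assumes ab: "a < b" and below: "\<And>l f. f \<in> ell2 W \<Longrightarrow> l \<le> a \<Longrightarrow> E l f = (\<lambda>_. 0)"
    and above: "\<And>l f. f \<in> ell2 W \<Longrightarrow> b \<le> l \<Longrightarrow> E l f = f"
    and t: "t 0 = a" "t N = b" "\<And>i. i < N \<Longrightarrow> t i \<le> t (Suc i) \<and> t (Suc i) - t i \<le> d"
    and f: "f \<in> ell2 W"
  shows "ell2_norm W (\<lambda>x. step_op t N 1 f x - A f x) \<le> d * ell2_norm W f"
proof (rule numerical_radius_bound[of W "\<lambda>f x. step_op t N 1 f x - A f x", OF _ _ _ _ _ f])
  fix f g assume f: "f \<in> ell2 W" and g: "g \<in> ell2 W"
  show "(\<lambda>x. step_op t N 1 (\<lambda>x. f x + g x) x - A (\<lambda>x. f x + g x) x) =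
      (\<lambda>x. step_op t N 1 f x - A f x + (step_op t N 1 g x - A g x))"
    by (simp add: step_op_def E_add[OF f g] op_add[OF f g] fun_eq_iff distrib_left sum.distrib algebra_simps
        sum_subtractf)
  show "ell2_inner W (\<lambda>x. step_op t N 1 f x - A f x) g = ell2_inner W f (\<lambda>x. step_op t N 1 g x - A g x)"
  proof -
    have "ell2_inner W (step_op t N 1 f) g = cnj (ell2_inner W (step_op t N 1 g) f)"
      unfolding step_op_inner[OF f g] step_op_inner[OF g f]
      by (simp add: E_symmetric f g flip: ell2_inner_commute)
    then show ?thesis
      using ell2_inner_commute[of W f "step_op t N 1 g"]
      by (simp add: ell2_inner_diff_left ell2_inner_diff_right step_op_closed closed f g symmetric)
  qed
next
  fix f assume f: "f \<in> ell2 W"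
  show "(\<lambda>x. step_op t N 1 f x - A f x) \<in> ell2 W" by (intro ell2_diff step_op_closed closed f)
  show "(\<lambda>x. step_op t N 1 (\<lambda>x. c * f x) x - A (\<lambda>x. c * f x) x) = (\<lambda>x. c * (step_op t N 1 f x - A f x))" for c
    by (simp add: step_op_def E_scale[OF f] op_scale[OF f] fun_eq_iff sum_distrib_left algebra_simps)
  \<comment> \<open>The index set \<open>{()}\<close> makes a single form an instance of the summed
    distribution.\<close>
  interpret cd: compact_distribution "\<lambda>l. \<Sum>i\<in>{()}. Re (ell2_inner W (E l f) f)" a b
    by (rule compact_distribution_E[OF ab below above f])
  have "ell2_inner W (A f) f =
      complex_of_real (\<integral>x. x \<partial>interval_measure (\<lambda>l. Re (ell2_inner W (E l f) f)))"
    using sf f by (auto simp: spectral_family_def)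
  then have "Re (ell2_inner W (A f) f) = (\<integral>x. x \<partial>interval_measure (\<lambda>l. Re (ell2_inner W (E l f) f)))"
    by simp
  moreover have "Re (ell2_inner W (step_op t N 1 f) f) =
      (\<Sum>i<N. t (Suc i) * (Re (ell2_inner W (E (t (Suc i)) f) f) - Re (ell2_inner W (E (t i) f) f)))"
    by (simp add: step_op_inner[OF f f])
  moreover have "\<bar>(\<integral>x. x \<partial>interval_measure (\<lambda>l. \<Sum>u\<in>{()}. Re (ell2_inner W (E l f) f))) -
      (\<Sum>i<N. t (Suc i) * ((\<Sum>u\<in>{()}. Re (ell2_inner W (E (t (Suc i)) f) f)) - (\<Sum>u\<in>{()}. Re (ell2_inner W (E (t i) f) f))))\<bar>
      \<le> d * (\<Sum>i\<in>{()}. Re (ell2_inner W (E b f) f))"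
  proof (rule cd.riemann_sum_bound[where B = "\<bar>a\<bar> + \<bar>b\<bar>"])
    show "\<bar>x - t (Suc i)\<bar> \<le> d" if "i < N" "x \<in> {t i<..t (Suc i)}" for i x
      using t(3)[OF that(1)] that(2) by auto
  qed (use t in auto)
  ultimately show "\<bar>Re (ell2_inner W (\<lambda>x. step_op t N 1 f x - A f x) f)\<bar> \<le> d * (ell2_norm W f)\<^sup>2"
    by (simp add: ell2_inner_diff_left step_op_closed closed f abs_minus_commute above norm_sq_eq_inner)
qed

text \<open>Refine partitions of [a, b]. On the one hand the k-th step operators tend strongly to
  A^k: the case k = 1 is \<open>step_op_norm_diff\<close>, and \<open>step_op_Suc\<close> carries
  the induction. On the other hand their quadratic forms, summed over \<open>I\<close>, are Riemann
  sums for the integral of x^k against F.\<close>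

theorem spectral_family_moments:
  assumes I: "finite I" and fs: "\<And>i. i \<in> I \<Longrightarrow> fs i \<in> ell2 W"
  defines "F \<equiv> \<lambda>l. \<Sum>i\<in>I. Re (ell2_inner W (E l (fs i)) (fs i))"
  obtains a b where "compact_distribution F a b"
    "\<And>k. (\<integral>x. x ^ k \<partial>interval_measure F) = (\<Sum>i\<in>I. Re (ell2_inner W ((A ^^ k) (fs i)) (fs i)))"
proof -
  obtain a b where ab: "a < b" and below: "\<And>l f. f \<in> ell2 W \<Longrightarrow> l \<le> a \<Longrightarrow> E l f = (\<lambda>_. 0)"
    and above: "\<And>l f. f \<in> ell2 W \<Longrightarrow> b \<le> l \<Longrightarrow> E l f = f"
    using E_support by blast
  interpret cd: compact_distribution F a b
    unfolding F_def by (rule compact_distribution_E[OF ab below above fs])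
  define d where "d = (\<lambda>n. (b - a) / real (Suc n))"
  define t where "t = (\<lambda>n i. a + real i * d n)"
  have d0: "0 < d n" for n using ab by (simp add: d_def)
  have t0: "t n 0 = a" "t n (Suc n) = b" for n by (simp_all add: t_def d_def)
  have tS: "t n (Suc i) = t n i + d n" for n i by (simp add: t_def algebra_simps)
  have tmono: "t n i \<le> t n j" if "i \<le> j" for n i j
    using that d0[of n] by (simp add: t_def)
  have dlim: "d \<longlonglongrightarrow> 0"
    using tendsto_mult_right_zero[OF LIMSEQ_inverse_real_of_nat, of "b - a"]
    unfolding d_def by (simp add: divide_inverse)
  have conv: "(\<lambda>n. ell2_norm W (\<lambda>x. step_op (t n) (Suc n) k f x - (A ^^ k) f x)) \<longlonglongrightarrow> 0"
    if f: "f \<in> ell2 W" for k f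
  proof (induction k)
    case 0
    have "step_op (t n) (Suc n) 0 f x = f x" for n x
    proof -
      have "step_op (t n) (Suc n) 0 f x = (\<Sum>i<Suc n. E (t n (Suc i)) f x - E (t n i) f x)"
        by (simp add: step_op_def)
      also have "\<dots> = E (t n (Suc n)) f x - E (t n 0) f x" by (rule sum_lessThan_telescope)
      finally show ?thesis by (simp add: t0 above below f)
    qed
    then show ?case by simp
  next
    case (Suc k)
    let ?s = "\<lambda>n. step_op (t n) (Suc n) k f" and ?e = "\<lambda>n. ell2_norm W (\<lambda>x. step_op (t n) (Suc n) k f x - (A ^^ k) f x)"
    have Ak: "(A ^^ k) f \<in> ell2 W" by (rule funpow_closed[OF f])
    have s: "?s n \<in> ell2 W" for n by (rule step_op_closed[OF f])
    have "(\<lambda>n. d n * (?e n + ell2_norm W ((A ^^ k) f)) + C * ?e n) \<longlonglongrightarrow> 0 * (0 + ell2_norm W ((A ^^ k) f)) + C * 0"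
      by (intro tendsto_intros dlim Suc)
    then have lim: "(\<lambda>n. d n * (?e n + ell2_norm W ((A ^^ k) f)) + C * ?e n) \<longlonglongrightarrow> 0" by simp
    have "ell2_norm W (\<lambda>x. step_op (t n) (Suc n) (Suc k) f x - (A ^^ Suc k) f x) \<le>
        d n * (?e n + ell2_norm W ((A ^^ k) f)) + C * ?e n" for n
    proof -
      have 1: "ell2_norm W (\<lambda>x. step_op (t n) (Suc n) 1 (?s n) x - A (?s n) x) \<le> d n * ell2_norm W (?s n)"
        using tS d0[of n] by (intro step_op_norm_diff[OF ab below above]) (auto simp: t0 s less_imp_le)
      have "ell2_norm W (?s n) \<le> ?e n + ell2_norm W ((A ^^ k) f)"
        using ell2_norm_triangle[OF ell2_diff[OF s Ak] Ak, of n] by simp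
      then have 2: "d n * ell2_norm W (?s n) \<le> d n * (?e n + ell2_norm W ((A ^^ k) f))"
        using d0[of n] by (intro mult_left_mono) auto
      have "(\<lambda>x. A (?s n) x - A ((A ^^ k) f) x) = A (\<lambda>x. ?s n x - (A ^^ k) f x)"
        using op_add[OF s[of n] ell2_scale[OF Ak, of "- 1"]] op_scale[OF Ak, of "- 1"] by simp
      then have 3: "ell2_norm W (\<lambda>x. A (?s n) x - A ((A ^^ k) f) x) \<le> C * ?e n"
        using norm_le[OF ell2_diff[OF s Ak], of n] by simp
      have "step_op (t n) (Suc n) (Suc k) f = step_op (t n) (Suc n) 1 (?s n)"
        using tmono by (intro step_op_Suc[symmetric] f) auto
      then show ?thesis
        using ell2_norm_triangle_diff[OF step_op_closed[OF s] closed[OF s] closed[OF Ak], of "t n" "Suc n" 1 n n] 1 2 3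
        by (simp del: power_Suc)
    qed
    then show ?case by (rule ell2_norm_tendsto_0[OF _ lim])
  qed
  have "(\<integral>x. x ^ k \<partial>interval_measure F) = (\<Sum>i\<in>I. Re (ell2_inner W ((A ^^ k) (fs i)) (fs i)))" for k
  proof (rule LIMSEQ_unique)
    show "(\<lambda>n. \<Sum>i\<in>I. Re (ell2_inner W (step_op (t n) (Suc n) k (fs i)) (fs i))) \<longlonglongrightarrow>
        (\<Sum>i\<in>I. Re (ell2_inner W ((A ^^ k) (fs i)) (fs i)))"
      by (intro tendsto_sum tendsto_Re ell2_inner_tendsto conv step_op_closed funpow_closed fs)
    have eq: "(\<Sum>i\<in>I. Re (ell2_inner W (step_op (t n) (Suc n) k (fs i)) (fs i))) =
        (\<Sum>j<Suc n. t n (Suc j) ^ k * (F (t n (Suc j)) - F (t n j)))" for n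
    proof -
      have "(\<Sum>i\<in>I. Re (ell2_inner W (step_op (t n) (Suc n) k (fs i)) (fs i))) =
        (\<Sum>i\<in>I. \<Sum>j<Suc n. t n (Suc j) ^ k * (Re (ell2_inner W (E (t n (Suc j)) (fs i)) (fs i)) - Re (ell2_inner W (E (t n j) (fs i)) (fs i))))"
        by (intro sum.cong refl) (simp add: step_op_inner fs Re_sum del: of_real_power sum.lessThan_Suc)
      then show ?thesis
        unfolding F_def by (subst (asm) sum.swap) (simp add: sum_subtractf sum_distrib_left right_diff_distrib del: sum.lessThan_Suc)
    qed
    define c where "c = max \<bar>a\<bar> \<bar>b\<bar>"
    have c: "\<bar>x\<bar> \<le> c" if "x \<in> {a..b}" for x using that by (auto simp: c_def)
    \<comment> \<open>A Lipschitz bound for x^k on [-c, c]; replacing c by max 1 c keeps the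
      constant monotone in k, which simplifies the induction.\<close>
    have lip: "\<bar>x ^ k - y ^ k\<bar> \<le> real k * (max 1 c) ^ k * \<bar>x - y\<bar>" if "\<bar>x\<bar> \<le> c" "\<bar>y\<bar> \<le> c" for x y
    proof (induction k)
      case (Suc k)
      have "\<bar>x ^ Suc k - y ^ Suc k\<bar> = \<bar>x * (x ^ k - y ^ k) + (x - y) * y ^ k\<bar>" by (simp add: algebra_simps)
      also have "\<dots> \<le> \<bar>x\<bar> * \<bar>x ^ k - y ^ k\<bar> + \<bar>x - y\<bar> * \<bar>y\<bar> ^ k"
        by (rule order_trans[OF abs_triangle_ineq]) (simp add: abs_mult power_abs)
      also have "\<dots> \<le> max 1 c * (real k * (max 1 c) ^ k * \<bar>x - y\<bar>) + \<bar>x - y\<bar> * (max 1 c) ^ Suc k"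
      proof (intro add_mono mult_mono Suc.IH mult_left_mono)
        have "\<bar>y\<bar> ^ k \<le> max 1 c ^ k" using that by (intro power_mono) auto
        also have "\<dots> \<le> max 1 c ^ Suc k" by (intro power_increasing) auto
        finally show "\<bar>y\<bar> ^ k \<le> max 1 c ^ Suc k" .
      qed (use that in auto)
      also have "\<dots> = real (Suc k) * max 1 c ^ Suc k * \<bar>x - y\<bar>" by (simp add: algebra_simps)
      finally show ?case .
    qed simp
    have tI: "t n i \<in> {a..b}" if "i \<le> Suc n" for n i
      using tmono[of 0 i n] tmono[of i "Suc n" n] that by (simp add: t0)
    have bound: "\<bar>(\<integral>x. x ^ k \<partial>interval_measure F) - (\<Sum>j<Suc n. t n (Suc j) ^ k * (F (t n (Suc j)) - F (t n j)))\<bar>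
        \<le> (real k * (max 1 c) ^ k * d n) * F b" for n
    proof (rule cd.riemann_sum_bound[where B = "c ^ k"])
      show "\<bar>x ^ k\<bar> \<le> c ^ k" if "x \<in> {a..b}" for x
        using c[OF that] by (simp add: power_abs power_mono)
      show "\<bar>x ^ k - t n (Suc i) ^ k\<bar> \<le> real k * (max 1 c) ^ k * d n"
        if i: "i < Suc n" and x: "x \<in> {t n i<..t n (Suc i)}" for i x
      proof -
        have "x \<in> {a..b}" using tI[of i n] tI[of "Suc i" n] i x by auto
        then have "\<bar>x ^ k - t n (Suc i) ^ k\<bar> \<le> real k * (max 1 c) ^ k * \<bar>x - t n (Suc i)\<bar>"
          using i by (intro lip c tI) auto
        also have "\<dots> \<le> real k * (max 1 c) ^ k * d n"
          using x by (intro mult_left_mono) (auto simp: tS)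
        finally show ?thesis .
      qed
    qed (use d0 in \<open>auto simp: t0 tS less_imp_le\<close>)
    have "(\<lambda>n. (real k * (max 1 c) ^ k * d n) * F b) \<longlonglongrightarrow> (real k * (max 1 c) ^ k * 0) * F b"
      by (intro tendsto_intros dlim)
    then have "(\<lambda>n. (real k * (max 1 c) ^ k * d n) * F b) \<longlonglongrightarrow> 0" by simp
    then have "(\<lambda>n. (\<Sum>j<Suc n. t n (Suc j) ^ k * (F (t n (Suc j)) - F (t n j))) - (\<integral>x. x ^ k \<partial>interval_measure F)) \<longlonglongrightarrow> 0"
      by (rule Lim_null_comparison[rotated]) (simp only: eventually_True real_norm_def abs_minus_commute bound)
    then show "(\<lambda>n. \<Sum>i\<in>I. Re (ell2_inner W (step_op (t n) (Suc n) k (fs i)) (fs i))) \<longlonglongrightarrow>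
        (\<integral>x. x ^ k \<partial>interval_measure F)"
      unfolding eq by (rule LIM_zero_cancel)
  qed
  then show ?thesis using that[OF cd.compact_distribution_axioms] by blast
qed

end

end

section \<open>Periodic operators\<close>

text \<open>Restricting the sum to \<open>N x\<close> keeps it finite for infinite \<open>U\<close>.
  A smaller set \<open>U\<close> cuts off argument and value alike, so
  \<open>kernel_op a N U\<close> is the compression of \<open>kernel_op a N V\<close> to functions
  on \<open>U\<close>.\<close>

definition kernel_op :: "('v \<Rightarrow> 'v \<Rightarrow> complex) \<Rightarrow> ('v \<Rightarrow> 'v set) \<Rightarrow> 'v set \<Rightarrow> 'v operator" where
  "kernel_op a N U f = (\<lambda>x. if x \<in> U then \<Sum>y\<in>N x \<inter> U. a x y * f y else 0)"

locale hermitian_kernel =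
  fixes V :: "'v set" and a :: "'v \<Rightarrow> 'v \<Rightarrow> complex" and N :: "'v \<Rightarrow> 'v set" and C :: real
  assumes N_finite: "\<And>x. x \<in> V \<Longrightarrow> finite (N x)" and N_subset: "\<And>x. x \<in> V \<Longrightarrow> N x \<subseteq> V"
    and N_sym: "\<And>x y. x \<in> V \<Longrightarrow> y \<in> V \<Longrightarrow> y \<in> N x \<Longrightarrow> x \<in> N y"
    and kernel_0: "\<And>x y. x \<in> V \<Longrightarrow> y \<in> V \<Longrightarrow> y \<notin> N x \<Longrightarrow> a x y = 0"
    and herm: "\<And>x y. x \<in> V \<Longrightarrow> y \<in> V \<Longrightarrow> a y x = cnj (a x y)"
    and row: "\<And>x. x \<in> V \<Longrightarrow> (\<Sum>y\<in>N x. cmod (a x y)) \<le> C" and C_pos: "0 < C"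
begin

abbreviation K where "K \<equiv> kernel_op a N"

lemma K_in: "x \<in> U \<Longrightarrow> K U f x = (\<Sum>y\<in>N x \<inter> U. a x y * f y)"
  and K_out: "x \<notin> U \<Longrightarrow> K U f x = 0"
  by (simp_all add: kernel_op_def)

lemma K_V: "x \<in> V \<Longrightarrow> K V f x = (\<Sum>y\<in>N x. a x y * f y)"
  using N_subset[of x] by (simp add: kernel_op_def Int_absorb2)

lemma row_finite:
  assumes "x \<in> V" "finite F" "F \<subseteq> V"
  shows "(\<Sum>y\<in>F. cmod (a x y)) \<le> C"
proof -
  have "(\<Sum>y\<in>F. cmod (a x y)) = (\<Sum>y\<in>F \<inter> N x. cmod (a x y))"
    using assms kernel_0 by (intro sum.mono_neutral_right) auto
  also have "\<dots> \<le> (\<Sum>y\<in>N x. cmod (a x y))"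
    using assms by (intro sum_mono2 N_finite) auto
  finally show ?thesis using row[OF assms(1)] by linarith
qed

text \<open>By Hermitian symmetry the column sums of |a| obey the same bound C as the row sums;
  exchanging the order of summation over finite sets uses the former.\<close>

lemma weighted_sum_le:
  assumes F: "finite F" "F \<subseteq> V" and f: "f \<in> ell2 V"
  shows "(\<Sum>x\<in>F. \<Sum>y\<in>N x. cmod (a x y) * (cmod (f y))\<^sup>2) \<le> C * (ell2_norm V f)\<^sup>2"
proof -
  define Y where "Y = (\<Union>x\<in>F. N x)"
  have Y: "finite Y" "Y \<subseteq> V" using F N_finite N_subset by (auto simp: Y_def)
  have "(\<Sum>x\<in>F. \<Sum>y\<in>N x. cmod (a x y) * (cmod (f y))\<^sup>2) = (\<Sum>x\<in>F. \<Sum>y\<in>Y. cmod (a x y) * (cmod (f y))\<^sup>2)"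
  proof (rule sum.cong[OF refl], rule sum.mono_neutral_left)
    fix x assume x: "x \<in> F"
    show "finite Y" by (rule Y(1))
    show "N x \<subseteq> Y" using x by (auto simp: Y_def)
    show "\<forall>y\<in>Y - N x. cmod (a x y) * (cmod (f y))\<^sup>2 = 0"
    proof
      fix y assume "y \<in> Y - N x"
      then have "a x y = 0" using x F Y by (intro kernel_0) auto
      then show "cmod (a x y) * (cmod (f y))\<^sup>2 = 0" by simp
    qed
  qed
  also have "\<dots> = (\<Sum>y\<in>Y. \<Sum>x\<in>F. cmod (a y x) * (cmod (f y))\<^sup>2)"
  proof -
    have "cmod (a x y) = cmod (a y x)" if "x \<in> F" "y \<in> Y" for x y
      using herm[of x y] that F Y by (simp add: subset_iff)
    then show ?thesis by (subst sum.swap) simp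
  qed
  also have "\<dots> \<le> (\<Sum>y\<in>Y. C * (cmod (f y))\<^sup>2)"
    using F Y row_finite by (intro sum_mono) (simp add: subset_iff mult_right_mono flip: sum_distrib_right)
  also have "\<dots> = C * (\<Sum>y\<in>Y. (cmod (f y))\<^sup>2)" by (simp add: sum_distrib_left)
  also have "\<dots> \<le> C * (ell2_norm V f)\<^sup>2"
    using C_pos by (intro mult_left_mono ell2_sum_le_norm[OF f Y]) simp
  finally show ?thesis .
qed

text \<open>The Schur test: split |a| |f| as sqrt |a| times sqrt |a| |f| and apply Cauchy-Schwarz.
  One factor C comes from the rows, the other from the columns.\<close>

lemma K_sum_le:
  assumes F: "finite F" "F \<subseteq> V" and f: "f \<in> ell2 V"
  shows "(\<Sum>x\<in>F. (cmod (K V f x))\<^sup>2) \<le> (C * ell2_norm V f)\<^sup>2"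
proof -
  have "(cmod (K V f x))\<^sup>2 \<le> C * (\<Sum>y\<in>N x. cmod (a x y) * (cmod (f y))\<^sup>2)" if x: "x \<in> F" for x
  proof -
    have xV: "x \<in> V" using x F by blast
    have "cmod (K V f x) \<le> (\<Sum>y\<in>N x. sqrt (cmod (a x y)) * (sqrt (cmod (a x y)) * cmod (f y)))"
      unfolding K_V[OF xV] by (intro sum_norm_le) (simp add: norm_mult flip: mult.assoc)
    then have "(cmod (K V f x))\<^sup>2 \<le> (\<Sum>y\<in>N x. sqrt (cmod (a x y)) * (sqrt (cmod (a x y)) * cmod (f y)))\<^sup>2"
      by (intro power_mono) auto
    also have "\<dots> \<le> (\<Sum>y\<in>N x. (sqrt (cmod (a x y)))\<^sup>2) * (\<Sum>y\<in>N x. (sqrt (cmod (a x y)) * cmod (f y))\<^sup>2)"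
      by (rule Cauchy_Schwarz_ineq_sum)
    also have "\<dots> = (\<Sum>y\<in>N x. cmod (a x y)) * (\<Sum>y\<in>N x. cmod (a x y) * (cmod (f y))\<^sup>2)"
      by (simp add: power_mult_distrib)
    also have "\<dots> \<le> C * (\<Sum>y\<in>N x. cmod (a x y) * (cmod (f y))\<^sup>2)"
      by (intro mult_right_mono row xV sum_nonneg) auto
    finally show ?thesis .
  qed
  then have "(\<Sum>x\<in>F. (cmod (K V f x))\<^sup>2) \<le> C * (\<Sum>x\<in>F. \<Sum>y\<in>N x. cmod (a x y) * (cmod (f y))\<^sup>2)"
    unfolding sum_distrib_left[of C _ F] by (rule sum_mono)
  also have "\<dots> \<le> C * (C * (ell2_norm V f)\<^sup>2)"
    using C_pos by (intro mult_left_mono weighted_sum_le F f) simp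
  finally show ?thesis by (simp add: power_mult_distrib power2_eq_square mult_ac)
qed

lemma K_closed: assumes f: "f \<in> ell2 V" shows "K V f \<in> ell2 V"
proof -
  have "(\<lambda>x. (cmod (K V f x))\<^sup>2) summable_on V"
    using K_sum_le[OF _ _ f] by (intro nonneg_bdd_above_summable_on bdd_aboveI2[where M = "(C * ell2_norm V f)\<^sup>2"]) auto
  then show ?thesis by (auto simp: ell2_def kernel_op_def)
qed

lemma K_norm_le: "f \<in> ell2 V \<Longrightarrow> ell2_norm V (K V f) \<le> C * ell2_norm V f"
  using C_pos by (intro ell2_norm_le_I K_closed K_sum_le) (auto simp: ell2_norm_nonneg)

text \<open>The double sum over related pairs converges absolutely, because |a| |f| |g| is at most
  |a| |f|^2 + |a| |g|^2 and each part obeys the bound by C. So the pairs may be swapped, which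
  symmetry of the neighbourhoods permits.\<close>

lemma K_symmetric:
  assumes f: "f \<in> ell2 V" and g: "g \<in> ell2 V"
  shows "ell2_inner V (K V f) g = ell2_inner V f (K V g)"
proof -
  define \<phi> where "\<phi> = (\<lambda>(x, y). a x y * f y * cnj (g x))"
  have N_Sigma: "sum h (Sigma F N) = (\<Sum>x\<in>F. \<Sum>y\<in>N x. h (x, y))" if "finite F" "F \<subseteq> V" for F and h :: "'v \<times> 'v \<Rightarrow> real"
    using that N_finite by (subst sum.Sigma) auto
  have "(\<lambda>p. norm (\<phi> p)) summable_on (Sigma V N)"
  proof (intro nonneg_bdd_above_summable_on bdd_aboveI2)
    fix \<Phi> assume "\<Phi> \<in> {F. F \<subseteq> Sigma V N \<and> finite F}"
    then have \<Phi>: "\<Phi> \<subseteq> Sigma V N" "finite \<Phi>" by auto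
    let ?F = "fst ` \<Phi>"
    have F: "finite ?F" "?F \<subseteq> V" using \<Phi> by auto
    have "sum (\<lambda>p. norm (\<phi> p)) \<Phi> \<le> sum (\<lambda>p. norm (\<phi> p)) (Sigma ?F N)"
      using \<Phi> F N_finite by (intro sum_mono2 finite_SigmaI) force+
    also have "\<dots> = (\<Sum>x\<in>?F. \<Sum>y\<in>N x. norm (\<phi> (x, y)))" by (rule N_Sigma[OF F])
    also have "\<dots> \<le> (\<Sum>x\<in>?F. \<Sum>y\<in>N x. cmod (a x y) * (cmod (f y))\<^sup>2 + cmod (a x y) * (cmod (g x))\<^sup>2)"
    proof (intro sum_mono)
      fix x y
      have "2 * (cmod (f y) * cmod (g x)) \<le> (cmod (f y))\<^sup>2 + (cmod (g x))\<^sup>2"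
        using sum_squares_bound[of "cmod (f y)" "cmod (g x)"] by simp
      moreover have "0 \<le> cmod (f y) * cmod (g x)" by simp
      ultimately have "cmod (f y) * cmod (g x) \<le> (cmod (f y))\<^sup>2 + (cmod (g x))\<^sup>2" by linarith
      then have "cmod (a x y) * (cmod (f y) * cmod (g x)) \<le> cmod (a x y) * ((cmod (f y))\<^sup>2 + (cmod (g x))\<^sup>2)"
        by (rule mult_left_mono) simp
      then show "norm (\<phi> (x, y)) \<le> cmod (a x y) * (cmod (f y))\<^sup>2 + cmod (a x y) * (cmod (g x))\<^sup>2"
        by (simp add: \<phi>_def norm_mult distrib_left mult.assoc)
    qed
    also have "\<dots> = (\<Sum>x\<in>?F. \<Sum>y\<in>N x. cmod (a x y) * (cmod (f y))\<^sup>2) + (\<Sum>x\<in>?F. (\<Sum>y\<in>N x. cmod (a x y)) * (cmod (g x))\<^sup>2)"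
      by (simp add: sum.distrib sum_distrib_right)
    also have "\<dots> \<le> C * (ell2_norm V f)\<^sup>2 + (\<Sum>x\<in>?F. C * (cmod (g x))\<^sup>2)"
      using F by (intro add_mono weighted_sum_le f sum_mono mult_right_mono row) auto
    also have "\<dots> \<le> C * (ell2_norm V f)\<^sup>2 + C * (ell2_norm V g)\<^sup>2"
      using C_pos ell2_sum_le_norm[OF g F] by (simp add: mult_left_mono flip: sum_distrib_left)
    finally show "sum (\<lambda>p. norm (\<phi> p)) \<Phi> \<le> C * (ell2_norm V f)\<^sup>2 + C * (ell2_norm V g)\<^sup>2" .
  qed simp
  then have s: "\<phi> summable_on (Sigma V N)" by (rule abs_summable_summable)
  have sw: "prod.swap p \<in> Sigma V N" if "p \<in> Sigma V N" for p
  proof -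
    obtain x y where p: "p = (x, y)" by (cases p)
    have x: "x \<in> V" and y: "y \<in> N x" using that by (simp_all add: p)
    have yV: "y \<in> V" using N_subset[OF x] y by (rule subsetD)
    have "x \<in> N y" by (rule N_sym[OF x yV y])
    then show ?thesis using yV by (simp add: p)
  qed
  have swap: "bij_betw prod.swap (Sigma V N) (Sigma V N)"
  proof (rule bij_betw_byWitness[where f' = prod.swap])
    show "prod.swap ` Sigma V N \<subseteq> Sigma V N" using sw by (rule image_subsetI)
    then show "prod.swap ` Sigma V N \<subseteq> Sigma V N" .
  qed simp_all
  have s': "(\<lambda>p. \<phi> (prod.swap p)) summable_on (Sigma V N)"
    by (rule summable_on_reindex_bij_betw[OF swap, THEN iffD2, OF s])
  have "ell2_inner V (K V f) g = (\<Sum>\<^sub>\<infinity>x\<in>V. \<Sum>\<^sub>\<infinity>y\<in>N x. \<phi> (x, y))"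
    unfolding ell2_inner_def by (intro infsum_cong) (simp add: K_V \<phi>_def sum_distrib_right N_finite)
  also have "\<dots> = (\<Sum>\<^sub>\<infinity>p\<in>Sigma V N. \<phi> p)" by (rule infsum_Sigma_banach[OF s])
  also have "\<dots> = (\<Sum>\<^sub>\<infinity>p\<in>Sigma V N. \<phi> (prod.swap p))" by (rule infsum_reindex_bij_betw[OF swap, symmetric])
  also have "\<dots> = (\<Sum>\<^sub>\<infinity>x\<in>V. \<Sum>\<^sub>\<infinity>y\<in>N x. \<phi> (prod.swap (x, y)))"
    by (rule infsum_Sigma_banach[OF s', symmetric])
  also have "\<dots> = ell2_inner V f (K V g)"
    unfolding ell2_inner_def
  proof (intro infsum_cong)
    fix x assume x: "x \<in> V"
    have "f x * cnj (K V g x) = (\<Sum>y\<in>N x. \<phi> (y, x))"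
      unfolding K_V[OF x] cnj_sum sum_distrib_left
    proof (intro sum.cong refl)
      fix y assume "y \<in> N x"
      then have "y \<in> V" using N_subset[OF x] by blast
      from herm[OF x this] show "f x * cnj (a x y * g y) = \<phi> (y, x)" by (simp add: \<phi>_def mult_ac)
    qed
    then show "(\<Sum>\<^sub>\<infinity>y\<in>N x. \<phi> (prod.swap (x, y))) = f x * cnj (K V g x)"
      using N_finite[OF x] by simp
  qed
  finally show ?thesis .
qed

lemma symmetric_op_K: "symmetric_op V (K V) C"
proof
  show "bounded_op V (K V)"
    unfolding bounded_op_def
  proof (intro conjI ballI allI)
    show "K V (\<lambda>x. f x + g x) = (\<lambda>x. K V f x + K V g x)" for f g
      by (auto simp: kernel_op_def fun_eq_iff distrib_left sum.distrib)
    show "K V (\<lambda>x. c * f x) = (\<lambda>x. c * K V f x)" for c f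
      by (auto simp: kernel_op_def fun_eq_iff sum_distrib_left mult_ac)
    show "\<exists>C. \<forall>f\<in>ell2 V. ell2_norm V (K V f) \<le> C * ell2_norm V f" using K_norm_le by blast
  qed (rule K_closed)
qed (use K_symmetric K_norm_le C_pos in auto)

lemma K_power_delta_bound:
  assumes U: "U \<subseteq> V" shows "cmod ((K U ^^ k) (delta v) x) \<le> C ^ k"
proof (induction k arbitrary: x)
  case 0
  then show ?case by (simp add: delta_def)
next
  case (Suc k)
  show ?case
  proof (cases "x \<in> U")
    case True
    then have x: "x \<in> V" using U by blast
    have "cmod (\<Sum>y\<in>N x \<inter> U. a x y * (K U ^^ k) (delta v) y) \<le> (\<Sum>y\<in>N x \<inter> U. cmod (a x y) * C ^ k)"
      by (intro sum_norm_le) (simp add: norm_mult Suc mult_left_mono)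
    also have "\<dots> \<le> C * C ^ k"
      using C_pos row_finite[OF x, of "N x \<inter> U"] N_finite[OF x] N_subset[OF x]
      by (simp add: mult_right_mono le_infI1 flip: sum_distrib_right)
    finally show ?thesis using True by (simp add: K_in)
  qed (use C_pos in \<open>simp add: K_out\<close>)
qed

text \<open>Balls for the relation given by \<open>N\<close>; inserting \<open>u\<close> makes them
  increase with k even where \<open>u\<close> is not in \<open>N u\<close>.\<close>

primrec nball :: "nat \<Rightarrow> 'v \<Rightarrow> 'v set" where
  "nball 0 v = {v}"
| "nball (Suc k) v = (\<Union>u\<in>nball k v. insert u (N u))"

lemma nball_subset: "v \<in> V \<Longrightarrow> nball k v \<subseteq> V"
  using N_subset by (induction k) auto

lemma nball_finite: "v \<in> V \<Longrightarrow> finite (nball k v)"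
  using N_finite nball_subset[of v] by (induction k) (auto simp: subset_iff)

lemma nball_mono: "nball k v \<subseteq> nball (Suc k) v"
  by auto

lemma K_power_delta_support:
  assumes v: "v \<in> V" and x: "x \<notin> nball k v"
  shows "(K V ^^ k) (delta v) x = 0"
  using x
proof (induction k arbitrary: x)
  case 0
  then show ?case by (simp add: delta_def)
next
  case (Suc k)
  show ?case
  proof (cases "x \<in> V")
    case True
    have "(K V ^^ k) (delta v) y = 0" if "y \<in> N x" for y
    proof (rule Suc.IH)
      show "y \<notin> nball k v"
        using Suc.prems N_sym[OF True _ that] N_subset[OF True] that by auto
    qed
    then show ?thesis using True by (simp add: K_V)
  qed (simp add: K_out)
qed

text \<open>Finite propagation: k applications starting at v never leave the k-ball, so cutting off
  outside a set containing that ball is not felt.\<close>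

lemma K_power_delta_agree:
  assumes v: "v \<in> V" and U: "nball k v \<subseteq> U" "U \<subseteq> V"
  shows "(K U ^^ k) (delta v) = (K V ^^ k) (delta v)"
  using U(1)
proof (induction k)
  case (Suc k)
  have IH: "(K U ^^ k) (delta v) = (K V ^^ k) (delta v)" and sub: "nball k v \<subseteq> U"
    using Suc nball_mono[of k v] by auto
  show ?case
  proof
    fix x
    show "(K U ^^ Suc k) (delta v) x = (K V ^^ Suc k) (delta v) x"
    proof (cases "x \<in> U")
      case True
      then have x: "x \<in> V" using U(2) by blast
      have "(\<Sum>y\<in>N x \<inter> U. a x y * (K V ^^ k) (delta v) y) = (\<Sum>y\<in>N x. a x y * (K V ^^ k) (delta v) y)"
        using sub K_power_delta_support[OF v, of _ k] by (intro sum.mono_neutral_left N_finite x) auto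
      then show ?thesis by (simp only: funpow.simps comp_apply IH K_V[OF x] K_in[OF True])
    next
      case False
      then have "x \<notin> nball (Suc k) v" using Suc.prems by blast
      from K_power_delta_support[OF v this] show ?thesis using False by (simp add: K_out)
    qed
  qed
qed simp

lemma K_power_matrix:
  assumes x: "bij_betw x {..<n} U" and U: "U \<subseteq> V" and ij: "i < n" "j < n"
  shows "(mat n n (\<lambda>(i, j). a (x i) (x j)) ^\<^sub>m k) $$ (i, j) = (K U ^^ k) (delta (x j)) (x i)"
  using ij(1)
proof (induction k arbitrary: i)
  case 0
  then show ?case using x ij by (auto simp: delta_def bij_betw_def inj_on_def)
next
  case (Suc k)
  let ?M = "mat n n (\<lambda>(i, j). a (x i) (x j))"
  have M: "?M \<in> carrier_mat n n" by simp
  \<comment> \<open>Matrix powers add a factor on the right, iteration of the operator adds one on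
    the left.\<close>
  have comm: "?M ^\<^sub>m k * ?M = ?M * ?M ^\<^sub>m k" for k
  proof (induction k)
    case 0
    then show ?case by simp
  next
    case (Suc k)
    have "?M ^\<^sub>m Suc k * ?M = (?M * ?M ^\<^sub>m k) * ?M" using Suc by simp
    also have "\<dots> = ?M * (?M ^\<^sub>m k * ?M)" by (rule assoc_mult_mat[of _ n n _ n _ n]) auto
    finally show ?case by simp
  qed
  have xU: "x i \<in> U" using x Suc.prems by (auto simp: bij_betw_def)
  have "(?M ^\<^sub>m Suc k) $$ (i, j) = (\<Sum>l<n. a (x i) (x l) * (?M ^\<^sub>m k) $$ (l, j))"
    using Suc.prems ij(2) by (simp add: comm scalar_prod_def lessThan_atLeast0)
  also have "\<dots> = (\<Sum>l<n. a (x i) (x l) * (K U ^^ k) (delta (x j)) (x l))"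
    by (intro sum.cong refl) (simp add: Suc.IH)
  also have "\<dots> = (\<Sum>y\<in>U. a (x i) y * (K U ^^ k) (delta (x j)) y)"
    by (rule sum.reindex_bij_betw[OF x])
  also have "\<dots> = (\<Sum>y\<in>N (x i) \<inter> U. a (x i) y * (K U ^^ k) (delta (x j)) y)"
    using bij_betw_finite[OF x] U xU kernel_0 by (intro sum.mono_neutral_right) auto
  finally show ?case using xU by (simp add: K_in)
qed

end

section \<open>Words and boundaries in the group\<close>

lemma (in group) generate_word:
  assumes "S \<subseteq> carrier G" "g \<in> generate G S"
  shows "\<exists>w. set w \<subseteq> S \<union> (\<lambda>s. inv s) ` S \<and> foldr (\<lambda>x y. x \<otimes> y) w \<one> = g"
  using assms(2)
proof (induction rule: generate.induct)
  case one
  show ?case by (rule exI[of _ "[]"]) simp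
next
  case (incl h)
  then show ?case using assms(1) by (intro exI[of _ "[h]"]) auto
next
  case (inv h)
  then show ?case using assms(1) by (intro exI[of _ "[inv h]"]) auto
next
  case (eng h1 h2)
  then obtain w1 w2 where w: "set w1 \<subseteq> S \<union> (\<lambda>s. inv s) ` S" "foldr (\<lambda>x y. x \<otimes> y) w1 \<one> = h1"
    "set w2 \<subseteq> S \<union> (\<lambda>s. inv s) ` S" "foldr (\<lambda>x y. x \<otimes> y) w2 \<one> = h2" by blast
  have c: "S \<union> (\<lambda>s. inv s) ` S \<subseteq> carrier G" using assms(1) by auto
  have closed: "foldr (\<lambda>x y. x \<otimes> y) w z \<in> carrier G" if "set w \<subseteq> carrier G" "z \<in> carrier G" for w z
    using that by (induction w) auto
  have "foldr (\<lambda>x y. x \<otimes> y) w z = foldr (\<lambda>x y. x \<otimes> y) w \<one> \<otimes> z" if "set w \<subseteq> carrier G" "z \<in> carrier G" for w z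
    using that by (induction w) (auto simp: m_assoc closed)
  from this[of w1 h2] have "foldr (\<lambda>x y. x \<otimes> y) (w1 @ w2) \<one> = h1 \<otimes> h2"
    using w c closed[of w2 \<one>] by (simp add: subset_trans[OF w(1) c] subset_trans[OF w(3) c])
  then show ?case using w by (intro exI[of _ "w1 @ w2"]) auto
qed

text \<open>An element near the set arises from one of its points by a word of length less than d;
  that the least length in \<open>word_dist\<close> is attained by a word is due to
  \<open>generate_word\<close>. Finiteness matters because \<open>card\<close> of an infinite set is
  0, so the Folner condition would otherwise bound nothing.\<close>

lemma (in group) finite_word_boundary:
  assumes S: "finite S" "S \<subseteq> carrier G" "generate G S = carrier G" and L: "finite \<Lambda>" "\<Lambda> \<subseteq> carrier G"
  shows "finite (word_boundary G S d \<Lambda>)"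
proof -
  define T where "T = S \<union> (\<lambda>s. inv s) ` S"
  have T: "finite T" "T \<subseteq> carrier G" using S by (auto simp: T_def)
  define W where "W = {w. set w \<subseteq> T \<and> length w \<le> nat \<lceil>d\<rceil>}"
  have W: "finite W" unfolding W_def by (rule finite_lists_length_le[OF T(1)])
  have "word_boundary G S d \<Lambda> \<subseteq> (\<lambda>(h, w). h \<otimes> inv (foldr (\<lambda>x y. x \<otimes> y) w \<one>)) ` (\<Lambda> \<times> W)"
  proof
    fix g assume g: "g \<in> word_boundary G S d \<Lambda>"
    then have gc: "g \<in> carrier G" and "(INF h\<in>\<Lambda>. ereal (real (word_dist G S g h))) < ereal d"
      by (auto simp: word_boundary_def word_setdist_def)
    then obtain h where h: "h \<in> \<Lambda>" "real (word_dist G S g h) < d" by (auto simp: INF_less_iff)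
    have hc: "h \<in> carrier G" using h L by blast
    let ?P = "\<lambda>n. \<exists>w. length w = n \<and> set w \<subseteq> T \<and> foldr (\<lambda>x y. x \<otimes> y) w \<one> = inv g \<otimes> h"
    have "inv g \<otimes> h \<in> generate G S" using gc hc S(3) by simp
    from generate_word[OF S(2) this] have "\<exists>n. ?P n" unfolding T_def by blast
    then have "?P (word_dist G S g h)" unfolding word_dist_def T_def by (rule LeastI_ex)
    then obtain w where w: "length w = word_dist G S g h" "set w \<subseteq> T" "foldr (\<lambda>x y. x \<otimes> y) w \<one> = inv g \<otimes> h"
      by blast
    have "w \<in> W" using w h(2) by (simp add: W_def) linarith
    moreover have "g = h \<otimes> inv (foldr (\<lambda>x y. x \<otimes> y) w \<one>)"
      using gc hc by (simp add: w(3) inv_mult_group m_assoc[symmetric])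
    ultimately show "g \<in> (\<lambda>(h, w). h \<otimes> inv (foldr (\<lambda>x y. x \<otimes> y) w \<one>)) ` (\<Lambda> \<times> W)"
      using h(1) by force
  qed
  then show ?thesis using W L(1) by (meson finite_SigmaI finite_imageI finite_subset)
qed

section \<open>Kernels that are invariant up to phases\<close>

locale periodic_kernel = hermitian_kernel V a N C + group_action G V \<alpha>
  for V :: "'v set" and a N C and G (structure) and \<alpha> +
  fixes FV :: "'v set"
  assumes FV: "finite FV" "FV \<subseteq> V"
    and FV_unique: "\<And>v. v \<in> V \<Longrightarrow> \<exists>!w. w \<in> FV \<and> (\<exists>g\<in>carrier G. w = \<alpha> g v)"
    and free: "\<And>g v. g \<in> carrier G \<Longrightarrow> v \<in> V \<Longrightarrow> \<alpha> g v = v \<Longrightarrow> g = \<one>"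
    and N_image: "\<And>g x. g \<in> carrier G \<Longrightarrow> x \<in> V \<Longrightarrow> N (\<alpha> g x) = \<alpha> g ` N x"
    and covariant: "\<And>g. g \<in> carrier G \<Longrightarrow> \<exists>s. (\<forall>v\<in>V. cmod (s v) = 1) \<and>
      (\<forall>x\<in>V. \<forall>y\<in>V. a (\<alpha> g x) (\<alpha> g y) = s x * cnj (s y) * a x y)"
begin

lemma group_G: "group G"
  using group_hom group_hom.axioms(1) by blast

lemma act_closed: "g \<in> carrier G \<Longrightarrow> x \<in> V \<Longrightarrow> \<alpha> g x \<in> V"
  using element_image by blast

lemma act_inj: "g \<in> carrier G \<Longrightarrow> x \<in> V \<Longrightarrow> y \<in> V \<Longrightarrow> \<alpha> g x = \<alpha> g y \<longleftrightarrow> x = y"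
  using inj_prop by (auto simp: inj_on_def)

lemma act_one: "x \<in> V \<Longrightarrow> \<alpha> \<one> x = x"
  using id_eq_one by (metis restrict_apply)

lemma act_inv: "g \<in> carrier G \<Longrightarrow> x \<in> V \<Longrightarrow> \<alpha> (inv g) (\<alpha> g x) = x"
  using composition_rule[of x "inv g" g] group.inv_closed[OF group_G] group.l_inv[OF group_G] act_one by simp

text \<open>Translating both arguments of the kernel of a power multiplies it by the phases at its
  two ends, those at intermediate points cancelling. On the diagonal the remaining phases cancel as
  well, but the induction needs the off-diagonal statement.\<close>

lemma K_power_covariant:
  assumes g: "g \<in> carrier G" and v: "v \<in> V"
  shows "(K V ^^ k) (delta (\<alpha> g v)) (\<alpha> g v) = (K V ^^ k) (delta v) v"
proof -
  obtain s where s1: "\<And>v. v \<in> V \<Longrightarrow> cmod (s v) = 1"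
    and s: "\<And>x y. x \<in> V \<Longrightarrow> y \<in> V \<Longrightarrow> a (\<alpha> g x) (\<alpha> g y) = s x * cnj (s y) * a x y"
    using covariant[OF g] by blast
  have ss: "cnj (s v) * s v = 1" "s v * cnj (s v) = 1" if "v \<in> V" for v
    using s1[OF that] complex_norm_square[of "s v"] by (auto simp: mult.commute)
  have "(K V ^^ k) (delta (\<alpha> g v)) (\<alpha> g x) = s x * cnj (s v) * (K V ^^ k) (delta v) x" if "x \<in> V" for x
    using that
  proof (induction k arbitrary: x)
    case 0
    then show ?case using act_inj[OF g 0 v] ss[OF v] by (simp add: delta_def)
  next
    case (Suc k)
    have inj: "inj_on (\<alpha> g) (N x)"
      using inj_prop[OF g] N_subset[OF Suc.prems] inj_on_subset by blast
    have "(K V ^^ Suc k) (delta (\<alpha> g v)) (\<alpha> g x) =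
        (\<Sum>y\<in>N x. a (\<alpha> g x) (\<alpha> g y) * (K V ^^ k) (delta (\<alpha> g v)) (\<alpha> g y))"
      using act_closed[OF g Suc.prems] by (simp add: K_V N_image[OF g Suc.prems] sum.reindex[OF inj])
    also have "\<dots> = (\<Sum>y\<in>N x. s x * cnj (s v) * (a x y * (K V ^^ k) (delta v) y))"
    proof (intro sum.cong refl)
      fix y assume "y \<in> N x"
      then have y: "y \<in> V" using N_subset[OF Suc.prems] by blast
      have "a (\<alpha> g x) (\<alpha> g y) * (K V ^^ k) (delta (\<alpha> g v)) (\<alpha> g y) =
          (cnj (s y) * s y) * (s x * cnj (s v) * (a x y * (K V ^^ k) (delta v) y))"
        by (simp add: s[OF Suc.prems y] Suc.IH[OF y])
      then show "a (\<alpha> g x) (\<alpha> g y) * (K V ^^ k) (delta (\<alpha> g v)) (\<alpha> g y) =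
          s x * cnj (s v) * (a x y * (K V ^^ k) (delta v) y)"
        by (simp only: ss[OF y] mult_1_left)
    qed
    also have "\<dots> = s x * cnj (s v) * (K V ^^ Suc k) (delta v) x"
      using Suc.prems by (simp add: K_V sum_distrib_left)
    finally show ?case .
  qed
  from this[OF v] show ?thesis using ss[OF v] by simp
qed

lemma nball_act:
  assumes g: "g \<in> carrier G" and v: "v \<in> V"
  shows "nball k (\<alpha> g v) = \<alpha> g ` nball k v"
proof (induction k)
  case (Suc k)
  have "N (\<alpha> g u) = \<alpha> g ` N u" if "u \<in> nball k v" for u
    using nball_subset[OF v] that by (intro N_image g) blast
  then show ?case by (auto simp: Suc)
qed simp

definition translates :: "_ set \<Rightarrow> 'v set" where
  "translates \<Lambda> = (\<Union>g\<in>\<Lambda>. \<alpha> g ` FV)"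

lemma translates_subset: "\<Lambda> \<subseteq> carrier G \<Longrightarrow> translates \<Lambda> \<subseteq> V"
  using FV(2) act_closed by (auto simp: translates_def)

text \<open>Uniqueness of orbit representatives determines w, and freeness then determines g. This
  makes the number of vertices exactly proportional to the cardinality of the set of translating
  elements.\<close>

lemma translates_bij:
  assumes L: "\<Lambda> \<subseteq> carrier G"
  shows "bij_betw (\<lambda>(g, w). \<alpha> g w) (\<Lambda> \<times> FV) (translates \<Lambda>)"
proof -
  have "g = h \<and> w = w'" if gw: "g \<in> \<Lambda>" "h \<in> \<Lambda>" "w \<in> FV" "w' \<in> FV" "\<alpha> g w = \<alpha> h w'" for g h w w'
  proof -
    have gh: "g \<in> carrier G" "h \<in> carrier G" and wV: "w \<in> V" "w' \<in> V" using gw L FV by auto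
    have ih: "inv h \<in> carrier G" using gh group.inv_closed[OF group_G] by blast
    have w': "w' = \<alpha> (inv h \<otimes> g) w"
      using act_inv[OF gh(2) wV(2)] gw(5) composition_rule[OF wV(1) ih gh(1)] by simp
    have c: "inv h \<otimes> g \<in> carrier G" using ih gh group_G by (simp add: group.is_monoid monoid.m_closed)
    have "w = \<alpha> \<one> w" using act_one[OF wV(1)] by simp
    moreover have "\<one> \<in> carrier G" using group_G by (simp add: group.is_monoid monoid.one_closed)
    ultimately have ww: "w = w'" using FV_unique[OF wV(1)] gw(3,4) w' c by blast
    then have "inv h \<otimes> g = \<one>" using free[OF c wV(1)] w' by simp
    then have "g = h" using group.inv_equality[OF group_G] gh ih group.inv_inv[OF group_G] by metis
    then show ?thesis using ww by simp
  qed
  then have "inj_on (\<lambda>(g, w). \<alpha> g w) (\<Lambda> \<times> FV)" by (auto simp: inj_on_def)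
  then show ?thesis by (auto simp: bij_betw_def translates_def)
qed

lemma orbit_rep:
  assumes "v \<in> V" obtains g w where "g \<in> carrier G" "w \<in> FV" "v = \<alpha> g w"
proof -
  obtain w h where wh: "w \<in> FV" "h \<in> carrier G" "w = \<alpha> h v" using FV_unique[OF assms] by blast
  then show ?thesis
    using act_inv[OF wh(2) assms] group.inv_closed[OF group_G wh(2)] by (intro that[of "inv h" w]) auto
qed

text \<open>The word metric is left invariant, so whether the ball around \<open>\<gamma>w\<close> leaves the translates is
  controlled by finitely many word lengths, independently of \<open>\<gamma>\<close>.\<close>

lemma nball_subset_translates:
  obtains d where "0 < d" "\<And>\<Lambda> g w. \<Lambda> \<subseteq> carrier G \<Longrightarrow> g \<in> \<Lambda> \<Longrightarrow> g \<notin> word_boundary G S d \<Lambda> \<Longrightarrow> w \<in> FV \<Longrightarrow>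
    nball k (\<alpha> g w) \<subseteq> translates \<Lambda>"
proof -
  interpret G: group G by (rule group_G)
  define B where "B = (\<Union>w\<in>FV. nball k w)"
  have "finite (nball k w)" "nball k w \<subseteq> V" if "w \<in> FV" for w
    using that FV(2) by (auto intro!: nball_finite dest: nball_subset[THEN subsetD, rotated])
  then have B: "finite B" "B \<subseteq> V" unfolding B_def using FV(1) by blast+
  have "\<exists>h. h \<in> carrier G \<and> (\<exists>w\<in>FV. u = \<alpha> h w)" if "u \<in> B" for u
    using orbit_rep[of u] B that by (metis subsetD)
  then obtain \<eta> where \<eta>: "\<And>u. u \<in> B \<Longrightarrow> \<eta> u \<in> carrier G" "\<And>u. u \<in> B \<Longrightarrow> \<exists>w\<in>FV. u = \<alpha> (\<eta> u) w"
    by metis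
  \<comment> \<open>The longest word needed to reach a translate that meets the k-ball of a vertex
    in the fundamental domain. Inserting 0 covers an empty \<open>B\<close>.\<close>
  define D where "D = Max (insert 0 ((\<lambda>u. word_dist G S \<one> (\<eta> u)) ` B))"
  have D: "word_dist G S \<one> (\<eta> u) \<le> D" if "u \<in> B" for u
    unfolding D_def using B(1) that by (intro Max_ge) auto
  have dist: "word_dist G S g (g \<otimes> h) = word_dist G S \<one> h" if "g \<in> carrier G" "h \<in> carrier G" for g h
    using that by (simp add: word_dist_def G.m_assoc[symmetric])
  have dist0: "word_dist G S g g = 0" if "g \<in> carrier G" for g
    unfolding word_dist_def using that by (intro Least_eq_0) (auto intro!: exI[of _ "[]"])
  show ?thesis
  \<comment> \<open>Distances in \<open>word_boundary\<close> are compared strictly, whence the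
    additional 1.\<close>
  proof (rule that[of "real D + 1"])
    fix \<Lambda> g w assume L: "\<Lambda> \<subseteq> carrier G" and g: "g \<in> \<Lambda>" and nb: "g \<notin> word_boundary G S (real D + 1) \<Lambda>"
      and w: "w \<in> FV"
    have gc: "g \<in> carrier G" using g L by blast
    show "nball k (\<alpha> g w) \<subseteq> translates \<Lambda>"
    proof
      fix x assume "x \<in> nball k (\<alpha> g w)"
      then obtain u where u: "u \<in> nball k w" "x = \<alpha> g u" using nball_act[OF gc] w FV(2) by blast
      then have uB: "u \<in> B" using w by (auto simp: B_def)
      obtain w' where w': "w' \<in> FV" "u = \<alpha> (\<eta> u) w'" using \<eta>(2)[OF uB] by blast
      have x: "x = \<alpha> (g \<otimes> \<eta> u) w'"
        using composition_rule[OF _ gc \<eta>(1)[OF uB], of w'] w' FV(2) u(2) by auto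
      have "g \<otimes> \<eta> u \<in> \<Lambda>"
      proof (rule ccontr)
        assume n: "g \<otimes> \<eta> u \<notin> \<Lambda>"
        have "word_setdist G S g \<Lambda> \<le> ereal (real (word_dist G S g g))"
          unfolding word_setdist_def by (rule INF_lower[OF g])
        then have 1: "word_setdist G S g \<Lambda> < ereal (real D + 1)"
          by (rule le_less_trans) (simp add: dist0[OF gc])
        have "word_setdist G S g (carrier G - \<Lambda>) \<le> ereal (real (word_dist G S g (g \<otimes> \<eta> u)))"
          unfolding word_setdist_def using n gc \<eta>(1)[OF uB] by (intro INF_lower) auto
        also have "\<dots> < ereal (real D + 1)" using D[OF uB] by (simp add: dist[OF gc \<eta>(1)[OF uB]])
        finally show False using nb 1 gc by (simp add: word_boundary_def)
      qed
      then show "x \<in> translates \<Lambda>" using x w'(1) by (auto simp: translates_def)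
    qed
  qed simp
qed

text \<open>For g off the boundary, finite propagation and covariance make the diagonal entries at
  the translate by g equal to those at the fundamental domain. Each remaining entry is off by at
  most 2 C^k, and the Folner condition makes their proportion tend to 0.\<close>

theorem trace_convergence:
  assumes exh: "regular_exhaustion G S \<Lambda>"
    and S: "finite S" "S \<subseteq> carrier G" "generate G S = carrier G"
  shows "(\<lambda>m. (\<Sum>v\<in>translates (\<Lambda> m). (K (translates (\<Lambda> m)) ^^ k) (delta v) v) / of_nat (card (\<Lambda> m)))
    \<longlonglongrightarrow> (\<Sum>w\<in>FV. (K V ^^ k) (delta w) w)"
proof -
  have fin: "finite (\<Lambda> m)" "\<Lambda> m \<noteq> {}" "\<Lambda> m \<subseteq> carrier G" for m
    using exh by (auto simp: regular_exhaustion_def)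
  obtain d where d: "0 < d" "\<And>\<Lambda> g w. \<Lambda> \<subseteq> carrier G \<Longrightarrow> g \<in> \<Lambda> \<Longrightarrow> g \<notin> word_boundary G S d \<Lambda> \<Longrightarrow> w \<in> FV \<Longrightarrow>
      nball k (\<alpha> g w) \<subseteq> translates \<Lambda>"
    by (rule nball_subset_translates[of S k]) blast
  let ?b = "\<lambda>m. word_boundary G S d (\<Lambda> m)" and ?T = "\<lambda>m. translates (\<Lambda> m)"
  let ?L = "\<Sum>w\<in>FV. (K V ^^ k) (delta w) w"
  let ?c = "2 * C ^ k * real (card FV)"
  have lim: "(\<lambda>m. real (card (?b m)) / real (card (\<Lambda> m))) \<longlonglongrightarrow> 0"
    using exh d(1) by (auto simp: regular_exhaustion_def)
  have le: "cmod ((\<Sum>v\<in>?T m. (K (?T m) ^^ k) (delta v) v) / of_nat (card (\<Lambda> m)) - ?L)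
      \<le> ?c * (real (card (?b m)) / real (card (\<Lambda> m)))" for m
  proof -
    have n0: "real (card (\<Lambda> m)) > 0" using fin[of m] by (simp add: card_gt_0_iff)
    have "(\<Sum>v\<in>?T m. (K (?T m) ^^ k) (delta v) v) =
        (\<Sum>p\<in>\<Lambda> m \<times> FV. (K (?T m) ^^ k) (delta (case p of (g, w) \<Rightarrow> \<alpha> g w)) (case p of (g, w) \<Rightarrow> \<alpha> g w))"
      by (rule sum.reindex_bij_betw[OF translates_bij[OF fin(3)], symmetric])
    also have "\<dots> = (\<Sum>g\<in>\<Lambda> m. \<Sum>w\<in>FV. (K (?T m) ^^ k) (delta (\<alpha> g w)) (\<alpha> g w))"
      unfolding sum.cartesian_product by (intro sum.cong) auto
    finally have "(\<Sum>v\<in>?T m. (K (?T m) ^^ k) (delta v) v) - of_nat (card (\<Lambda> m)) * ?L =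
        (\<Sum>g\<in>\<Lambda> m. \<Sum>w\<in>FV. (K (?T m) ^^ k) (delta (\<alpha> g w)) (\<alpha> g w) - (K V ^^ k) (delta w) w)"
      by (simp add: sum_subtractf)
    also have "\<dots> = (\<Sum>g\<in>\<Lambda> m \<inter> ?b m. \<Sum>w\<in>FV. (K (?T m) ^^ k) (delta (\<alpha> g w)) (\<alpha> g w) - (K V ^^ k) (delta w) w)"
    proof (rule sum.mono_neutral_right)
      show "\<forall>g\<in>\<Lambda> m - \<Lambda> m \<inter> ?b m. (\<Sum>w\<in>FV. (K (?T m) ^^ k) (delta (\<alpha> g w)) (\<alpha> g w) - (K V ^^ k) (delta w) w) = 0"
      proof (intro ballI sum.neutral)
        fix g w assume g: "g \<in> \<Lambda> m - \<Lambda> m \<inter> ?b m" and w: "w \<in> FV"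
        have gw: "g \<in> carrier G" "w \<in> V" using g w fin FV by auto
        have "nball k (\<alpha> g w) \<subseteq> ?T m" using g by (intro d(2) fin w) auto
        then have "(K (?T m) ^^ k) (delta (\<alpha> g w)) = (K V ^^ k) (delta (\<alpha> g w))"
          by (intro K_power_delta_agree act_closed gw translates_subset fin)
        then show "(K (?T m) ^^ k) (delta (\<alpha> g w)) (\<alpha> g w) - (K V ^^ k) (delta w) w = 0"
          using K_power_covariant[OF gw] by simp
      qed
    qed (use fin in auto)
    also have "cmod \<dots> \<le> (\<Sum>g\<in>\<Lambda> m \<inter> ?b m. \<Sum>w\<in>FV. C ^ k + C ^ k)"
      by (intro sum_norm_le order_trans[OF norm_triangle_ineq4] add_mono K_power_delta_bound translates_subset fin) auto
    also have "\<dots> = ?c * real (card (\<Lambda> m \<inter> ?b m))" by simp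
    also have "\<dots> \<le> ?c * real (card (?b m))"
      using C_pos group.finite_word_boundary[OF group_G S fin(1,3)]
      by (intro mult_left_mono) (auto intro!: card_mono)
    finally have *: "cmod ((\<Sum>v\<in>?T m. (K (?T m) ^^ k) (delta v) v) - of_nat (card (\<Lambda> m)) * ?L) \<le> ?c * real (card (?b m))" .
    have "(\<Sum>v\<in>?T m. (K (?T m) ^^ k) (delta v) v) / of_nat (card (\<Lambda> m)) - ?L =
        ((\<Sum>v\<in>?T m. (K (?T m) ^^ k) (delta v) v) - of_nat (card (\<Lambda> m)) * ?L) / of_nat (card (\<Lambda> m))"
      using n0 by (simp add: diff_divide_distrib)
    then show ?thesis using divide_right_mono[OF *, of "real (card (\<Lambda> m))"] by (simp add: norm_divide)
  qed
  have "(\<lambda>m. (\<Sum>v\<in>?T m. (K (?T m) ^^ k) (delta v) v) / of_nat (card (\<Lambda> m)) - ?L) \<longlonglongrightarrow> 0"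
    by (rule Lim_null_comparison[OF always_eventually[OF allI[OF le]] tendsto_mult_right_zero[OF lim]])
  then show ?thesis by (rule LIM_zero_cancel)
qed

end

section \<open>Integrability of the logarithm\<close>

text \<open>The continuous functions $\phi_n \le \log (R/|x|)$ vanish at 0, so that an eigenvalue 0 of the
  approximants does no harm; they converge to $\log (R/|x|)$ for $x \ne 0$.\<close>

definition log_approx :: "real \<Rightarrow> nat \<Rightarrow> real \<Rightarrow> real" where
  "log_approx R n x = x\<^sup>2 / (x\<^sup>2 + inverse (Suc n)) * (ln (R\<^sup>2 / (x\<^sup>2 + inverse (Suc n))) / 2)"

text \<open>The first factor of \<open>log_approx\<close> lies in [0, 1]. The condition x^2 + 1 <=
  R^2 keeps the argument of the logarithm at least 1, since the regularising term is at most 1; so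
  the second factor is nonnegative and at most ln R - ln |x|.\<close>

lemma log_approx_bounds:
  assumes R: "x\<^sup>2 + 1 \<le> R\<^sup>2" and R0: "0 < R"
  shows "0 \<le> log_approx R n x" and "log_approx R n 0 = 0"
    and "x \<noteq> 0 \<Longrightarrow> log_approx R n x \<le> ln R - ln \<bar>x\<bar>"
    and "x \<noteq> 0 \<Longrightarrow> (\<lambda>n. log_approx R n x) \<longlonglongrightarrow> ln R - ln \<bar>x\<bar>"
proof -
  let ?e = "inverse (real (Suc n))"
  have e: "0 < ?e" "?e \<le> 1" by (auto simp: inverse_le_1_iff)
  have pos: "0 < x\<^sup>2 + ?e" using e(1) by (simp add: add_nonneg_pos)
  have "1 \<le> R\<^sup>2 / (x\<^sup>2 + ?e)" using R e(2) pos by (simp add: le_divide_eq)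
  then have ln0: "0 \<le> ln (R\<^sup>2 / (x\<^sup>2 + ?e))" by simp
  show "0 \<le> log_approx R n x" unfolding log_approx_def using ln0 pos by simp
  show "log_approx R n 0 = 0" by (simp add: log_approx_def)
  have lnx: "ln (R\<^sup>2 / x\<^sup>2) / 2 = ln R - ln \<bar>x\<bar>" if "x \<noteq> 0"
  proof -
    have "ln (R\<^sup>2 / x\<^sup>2) = ln ((R / \<bar>x\<bar>)\<^sup>2)" by (simp add: power_divide)
    also have "\<dots> = 2 * ln (R / \<bar>x\<bar>)" using R0 that by (subst ln_realpow) auto
    finally show ?thesis using R0 that by (simp add: ln_div)
  qed
  show "log_approx R n x \<le> ln R - ln \<bar>x\<bar>" if x: "x \<noteq> 0"
  proof -
    have x2: "0 < x\<^sup>2" using x by simp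
    have "log_approx R n x \<le> 1 * (ln (R\<^sup>2 / (x\<^sup>2 + ?e)) / 2)"
      unfolding log_approx_def using ln0 pos e by (intro mult_right_mono) (auto simp: divide_le_eq)
    also have "\<dots> \<le> ln (R\<^sup>2 / x\<^sup>2) / 2"
    proof -
      have "R\<^sup>2 / (x\<^sup>2 + ?e) \<le> R\<^sup>2 / x\<^sup>2" using x2 e(1) mult_pos_pos[OF pos x2] by (intro divide_left_mono) auto
      moreover have "0 < R\<^sup>2 / (x\<^sup>2 + ?e)" using R0 pos by simp
      ultimately show ?thesis by simp
    qed
    finally show ?thesis using lnx[OF x] by simp
  qed
  show "(\<lambda>n. log_approx R n x) \<longlonglongrightarrow> ln R - ln \<bar>x\<bar>" if x: "x \<noteq> 0"
  proof -
    have "(\<lambda>n. log_approx R n x) \<longlonglongrightarrow> x\<^sup>2 / (x\<^sup>2 + 0) * (ln (R\<^sup>2 / (x\<^sup>2 + 0)) / 2)"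
      unfolding log_approx_def using x R0 by (intro tendsto_intros LIMSEQ_inverse_real_of_nat) auto
    then show ?thesis using x lnx[OF x] by simp
  qed
qed

lemma isCont_log_approx: "0 < R \<Longrightarrow> isCont (log_approx R n) x"
proof -
  assume R: "0 < R"
  have pos: "x\<^sup>2 + inverse (real (Suc n)) \<noteq> 0"
    by (metis add_nonneg_pos inverse_positive_iff_positive less_irrefl of_nat_0_less_iff zero_less_Suc zero_le_power2)
  have pos': "0 < x\<^sup>2 + inverse (real (Suc n))" by (simp add: add_nonneg_pos)
  show ?thesis unfolding log_approx_def using R pos pos'
    by (intro continuous_intros) auto
qed

text \<open>Replace the function by a polynomial within distance 1, for which the moments converge.
  The replacement costs at most B on the side of the eigenvalues, by their number, and the total
  mass on the side of the measure.\<close>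

lemma integral_approx_bound:
  fixes M :: "real measure" and es :: "nat \<Rightarrow> real list" and c :: "nat \<Rightarrow> real" and \<phi> :: "real \<Rightarrow> real"
  assumes fm: "finite_measure M" and sets: "sets M = sets borel" and AE: "AE x in M. \<bar>x\<bar> \<le> C"
    and c: "\<And>m. 0 < c m" and es: "\<And>m e. e \<in> set (es m) \<Longrightarrow> \<bar>e\<bar> \<le> C"
    and len: "\<And>m. real (length (es m)) \<le> B * c m"
    and moments: "\<And>k. (\<lambda>m. (\<Sum>e\<leftarrow>es m. e ^ k) / c m) \<longlonglongrightarrow> (\<integral>x. x ^ k \<partial>M)"
    and \<phi>: "continuous_on {- C..C} \<phi>" "\<phi> \<in> borel_measurable borel"
    and bound: "\<And>m. (\<Sum>e\<leftarrow>es m. \<phi> e) \<le> K * c m"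
  shows "integrable M \<phi>" and "(\<integral>x. \<phi> x \<partial>M) \<le> K + B + measure M (space M)"
proof -
  interpret finite_measure M by (rule fm)
  have meas: "h \<in> borel_measurable M" if "h \<in> borel_measurable borel" for h :: "real \<Rightarrow> real"
    using that sets by (simp cong: measurable_cong_sets)
  have bdd: "integrable M h" if h: "continuous_on {- C..C} h" "h \<in> borel_measurable borel" for h :: "real \<Rightarrow> real"
  proof -
    have "compact (h ` {- C..C})" by (intro compact_continuous_image h) auto
    then obtain b where b: "\<forall>y\<in>h ` {- C..C}. norm y \<le> b"
      using compact_imp_bounded bounded_iff by blast
    have "AE x in M. norm (h x) \<le> b"
      using AE
    proof eventually_elim
      case (elim x)
      then have "x \<in> {- C..C}" by (simp add: abs_le_iff)
      then show ?case using b by blast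
    qed
    then show ?thesis using meas[OF h(2)] by (rule integrable_const_bound)
  qed
  show int: "integrable M \<phi>" by (rule bdd[OF \<phi>])
  obtain p where p: "\<And>x. x \<in> {- C..C} \<Longrightarrow> \<bar>\<phi> x - poly p x\<bar> < 1"
    by (rule weierstrass_poly[OF \<phi>(1), of 1]) auto
  have p': "\<bar>\<phi> x - poly p x\<bar> \<le> 1" if "\<bar>x\<bar> \<le> C" for x
  proof -
    have "x \<in> {- C..C}" using that by (simp add: abs_le_iff)
    then show ?thesis using p[of x] by linarith
  qed
  have pint: "integrable M (poly q)" for q :: "real poly"
    by (intro bdd borel_measurable_continuous_onI continuous_intros)
  have xint: "integrable M (\<lambda>x. x ^ k)" for k
    using pint[of "monom 1 k"] by (simp add: poly_monom[abs_def])
  have sum_poly: "(\<Sum>e\<leftarrow>l. poly p e) = (\<Sum>k\<le>degree p. coeff p k * (\<Sum>e\<leftarrow>l. e ^ k))" for l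
    by (induction l) (auto simp: poly_altdef sum.distrib distrib_left)
  have "(\<lambda>m. \<Sum>k\<le>degree p. coeff p k * ((\<Sum>e\<leftarrow>es m. e ^ k) / c m)) \<longlonglongrightarrow>
      (\<Sum>k\<le>degree p. coeff p k * (\<integral>x. x ^ k \<partial>M))"
    by (intro tendsto_intros moments)
  moreover have "(\<Sum>k\<le>degree p. coeff p k * (\<integral>x. x ^ k \<partial>M)) = (\<integral>x. poly p x \<partial>M)"
    unfolding poly_altdef by (simp add: xint Bochner_Integration.integral_sum)
  moreover have "(\<Sum>k\<le>degree p. coeff p k * ((\<Sum>e\<leftarrow>es m. e ^ k) / c m)) = (\<Sum>e\<leftarrow>es m. poly p e) / c m" for m
    by (simp add: sum_poly sum_divide_distrib)
  ultimately have lim: "(\<lambda>m. (\<Sum>e\<leftarrow>es m. poly p e) / c m) \<longlonglongrightarrow> (\<integral>x. poly p x \<partial>M)" by simp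
  have "(\<Sum>e\<leftarrow>es m. poly p e) / c m \<le> K + B" for m
  proof -
    have "(\<Sum>e\<leftarrow>es m. poly p e) \<le> (\<Sum>e\<leftarrow>es m. \<phi> e + 1)"
    proof (rule sum_list_mono)
      fix e assume "e \<in> set (es m)"
      then show "poly p e \<le> \<phi> e + 1" using p'[OF es] by (smt (verit))
    qed
    also have "\<dots> = (\<Sum>e\<leftarrow>es m. \<phi> e) + real (length (es m))"
      by (simp add: sum_list_addf sum_list_triv)
    also have "\<dots> \<le> (K + B) * c m" using bound[of m] len[of m] by (simp add: distrib_right)
    finally show ?thesis using c[of m] by (simp add: divide_le_eq)
  qed
  then have pK: "(\<integral>x. poly p x \<partial>M) \<le> K + B" by (intro LIMSEQ_le_const2[OF lim]) auto
  have "(\<integral>x. \<phi> x \<partial>M) \<le> (\<integral>x. poly p x + 1 \<partial>M)"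
  proof (rule integral_mono_AE)
    show "AE x in M. \<phi> x \<le> poly p x + 1"
      using AE
    proof eventually_elim
      case (elim x)
      then show ?case using p'[of x] by linarith
    qed
    show "integrable M (\<lambda>x. poly p x + 1)" using pint[of p] by simp
  qed (rule int)
  also have "\<dots> = (\<integral>x. poly p x \<partial>M) + measure M (space M)"
    using pint[of p] by simp
  finally show "(\<integral>x. \<phi> x \<partial>M) \<le> K + B + measure M (space M)" using pK by simp
qed

text \<open>Fatou's lemma along \<open>log_approx\<close>. At 0 the limiting function is set to 0,
  so an atom of M at 0 is harmless.\<close>

lemma log_integrable:
  fixes M :: "real measure" and es :: "nat \<Rightarrow> real list" and c :: "nat \<Rightarrow> real"
  assumes fm: "finite_measure M" and sets: "sets M = sets borel" and AE: "AE x in M. \<bar>x\<bar> \<le> C"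
    and c: "\<And>m. 0 < c m" and es: "\<And>m e. e \<in> set (es m) \<Longrightarrow> \<bar>e\<bar> \<le> C"
    and len: "\<And>m. real (length (es m)) \<le> B * c m"
    and moments: "\<And>k. (\<lambda>m. (\<Sum>e\<leftarrow>es m. e ^ k) / c m) \<longlonglongrightarrow> (\<integral>x. x ^ k \<partial>M)"
    and log: "\<And>m. - K * c m \<le> (\<Sum>e\<leftarrow>filter (\<lambda>e. e \<noteq> 0) (es m). ln \<bar>e\<bar>)"
  shows "set_integrable M {x. 0 < \<bar>x\<bar> \<and> \<bar>x\<bar> \<le> L} (\<lambda>x. ln \<bar>x\<bar>)"
proof -
  interpret finite_measure M by (rule fm)
  define R where "R = sqrt (C\<^sup>2 + 1)"
  have R0: "0 < R" unfolding R_def by (simp add: add_nonneg_pos)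
  have R1: "1 \<le> R" unfolding R_def by simp
  have R: "x\<^sup>2 + 1 \<le> R\<^sup>2" if "\<bar>x\<bar> \<le> C" for x
    using that abs_le_square_iff[of x C] by (simp add: R_def)
  define g where "g x = (if x = 0 then 0 else ln R - ln \<bar>x\<bar>)" for x
  have meas: "h \<in> borel_measurable M" if "h \<in> borel_measurable borel" for h :: "real \<Rightarrow> 'z::topological_space"
    using that sets by (simp cong: measurable_cong_sets)
  have pm: "log_approx R n \<in> borel_measurable borel" for n
    by (intro borel_measurable_continuous_onI continuous_at_imp_continuous_on ballI isCont_log_approx R0)
  \<comment> \<open>Zero eigenvalues contribute nothing and the others at most ln R - ln |e|, so the
    bound is uniform in n as well as in m.\<close>
  have sum_le: "(\<Sum>e\<leftarrow>es m. log_approx R n e) \<le> (B * ln R + K) * c m" for m n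
  proof -
    have "(\<Sum>e\<leftarrow>l. log_approx R n e) \<le> real (length l) * ln R - (\<Sum>e\<leftarrow>filter (\<lambda>e. e \<noteq> 0) l. ln \<bar>e\<bar>)"
      if "\<And>e. e \<in> set l \<Longrightarrow> \<bar>e\<bar> \<le> C" for l
      using that
    proof (induction l)
      case (Cons e l)
      then have IH: "(\<Sum>e\<leftarrow>l. log_approx R n e) \<le> real (length l) * ln R - (\<Sum>e\<leftarrow>filter (\<lambda>e. e \<noteq> 0) l. ln \<bar>e\<bar>)"
        and e: "\<bar>e\<bar> \<le> C" by auto
      show ?case
      proof (cases "e = 0")
        case True
        then show ?thesis using IH log_approx_bounds(2)[OF R[OF e] R0]
          by (simp add: algebra_simps) (use ln_ge_zero[OF R1] in linarith)
      next
        case False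
        then show ?thesis using IH log_approx_bounds(3)[OF R[OF e] R0 False, of n]
          by (simp add: algebra_simps)
      qed
    qed simp
    then have "(\<Sum>e\<leftarrow>es m. log_approx R n e) \<le> real (length (es m)) * ln R - (\<Sum>e\<leftarrow>filter (\<lambda>e. e \<noteq> 0) (es m). ln \<bar>e\<bar>)"
      using es by blast
    moreover have "real (length (es m)) * ln R \<le> (B * c m) * ln R"
      using len[of m] R1 by (intro mult_right_mono) auto
    ultimately show ?thesis using log[of m] by (simp add: algebra_simps)
  qed
  define K' where "K' = B * ln R + K + B + measure M (space M)"
  have cont: "continuous_on {- C..C} (log_approx R n)" for n
    by (intro continuous_at_imp_continuous_on ballI isCont_log_approx R0)
  have approx: "integrable M (log_approx R n)" "(\<integral>x. log_approx R n x \<partial>M) \<le> B * ln R + K + B + measure M (space M)" for n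
    by (rule integral_approx_bound[where es = es and c = c and C = C and B = B]; fact)+
  have int_le: "(\<integral>\<^sup>+ x. ennreal (log_approx R n x) \<partial>M) \<le> ennreal K'" for n
  proof -
    have "AE x in M. 0 \<le> log_approx R n x"
      using AE by eventually_elim (rule log_approx_bounds(1)[OF R R0])
    then have "(\<integral>\<^sup>+ x. ennreal (log_approx R n x) \<partial>M) = ennreal (\<integral>x. log_approx R n x \<partial>M)"
      by (intro nn_integral_eq_integral approx(1))
    then show ?thesis using ennreal_leI[OF approx(2)[of n]] by (simp only: K'_def)
  qed
  have gm: "g \<in> borel_measurable borel" unfolding g_def by measurable
  have "(\<integral>\<^sup>+ x. ennreal (g x) \<partial>M) \<le> (\<integral>\<^sup>+ x. liminf (\<lambda>n. ennreal (log_approx R n x)) \<partial>M)"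
  proof (rule nn_integral_mono_AE)
    show "AE x in M. ennreal (g x) \<le> liminf (\<lambda>n. ennreal (log_approx R n x))"
      using AE
    proof eventually_elim
      case (elim x)
      show ?case
      proof (cases "x = 0")
        case False
        have "(\<lambda>n. ennreal (log_approx R n x)) \<longlonglongrightarrow> ennreal (g x)"
          using log_approx_bounds(4)[OF R[OF elim] R0 False] False by (intro tendsto_ennrealI) (simp add: g_def)
        then show ?thesis by (simp add: lim_imp_Liminf)
      qed (simp add: g_def)
    qed
  qed
  also have "\<dots> \<le> liminf (\<lambda>n. \<integral>\<^sup>+ x. ennreal (log_approx R n x) \<partial>M)"
    by (rule nn_integral_liminf) (intro meas measurable_compose[OF pm measurable_ennreal])
  also have "\<dots> \<le> liminf (\<lambda>n. ennreal K')"
    by (rule Liminf_mono) (simp add: int_le)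
  also have "\<dots> = ennreal K'" by (simp add: Liminf_const)
  finally have fin: "(\<integral>\<^sup>+ x. ennreal (g x) \<partial>M) < \<infinity>" by (rule le_less_trans) simp
  have gint: "integrable M g"
  proof (rule integrableI_nonneg[OF meas[OF gm] _ fin])
    show "AE x in M. 0 \<le> g x"
      using AE
    proof eventually_elim
      case (elim x)
      have "0 \<le> g x"
        using log_approx_bounds(1)[OF R[OF elim] R0, of 0] log_approx_bounds(3)[OF R[OF elim] R0, of 0]
        by (auto simp: g_def)
      then show ?case .
    qed
  qed
  let ?S = "{x::real. 0 < \<bar>x\<bar> \<and> \<bar>x\<bar> \<le> L}"
  have "{x. 0 < \<bar>x\<bar> \<and> \<bar>x\<bar> \<le> L} \<in> sets borel" by measurable
  then have S: "(\<lambda>x. indicat_real ?S x *\<^sub>R ln \<bar>x\<bar>) \<in> borel_measurable borel" by measurable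
  show ?thesis unfolding set_integrable_def
  \<comment> \<open>As R >= 1, the dominating function works at every nonzero x and for every
    L.\<close>
  proof (rule Bochner_Integration.integrable_bound[of M "\<lambda>x. ln R + \<bar>g x\<bar>"])
    show "integrable M (\<lambda>x. ln R + \<bar>g x\<bar>)" using gint by simp
    show "(\<lambda>x. indicat_real ?S x *\<^sub>R ln \<bar>x\<bar>) \<in> borel_measurable M" by (rule meas[OF S])
    have "norm (indicat_real ?S x *\<^sub>R ln \<bar>x\<bar>) \<le> norm (ln R + \<bar>g x\<bar>)" for x
    proof (cases "x = 0")
      case False
      have "\<bar>ln \<bar>x\<bar>\<bar> \<le> ln R + \<bar>ln R - ln \<bar>x\<bar>\<bar>" using ln_ge_zero[OF R1] by linarith
      then have "\<bar>ln \<bar>x\<bar>\<bar> \<le> \<bar>ln R + \<bar>g x\<bar>\<bar>" using False by (simp add: g_def)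
      then show ?thesis by (simp add: indicator_def)
    qed simp
    then show "AE x in M. norm (indicat_real ?S x *\<^sub>R ln \<bar>x\<bar>) \<le> norm (ln R + \<bar>g x\<bar>)" by simp
  qed
qed

lemma log_integrable_away_from_0:
  fixes M :: "real measure"
  assumes fm: "finite_measure M" and sets: "sets M = sets borel" and AE: "AE x in M. \<bar>x\<bar> \<le> C" and AE0: "AE x in M. \<delta> \<le> \<bar>x\<bar>"
    and \<delta>: "0 < \<delta>"
  shows "set_integrable M {x. 0 < \<bar>x\<bar> \<and> \<bar>x\<bar> \<le> L} (\<lambda>x. ln \<bar>x\<bar>)"
  unfolding set_integrable_def
proof (rule finite_measure.integrable_const_bound[OF fm, where B = "\<bar>ln \<delta>\<bar> + \<bar>ln C\<bar>"])
  let ?S = "{x::real. 0 < \<bar>x\<bar> \<and> \<bar>x\<bar> \<le> L}"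
  show "AE x in M. norm (indicat_real ?S x *\<^sub>R ln \<bar>x\<bar>) \<le> \<bar>ln \<delta>\<bar> + \<bar>ln C\<bar>"
    using AE AE0
  proof eventually_elim
    case (elim x)
    then have "ln \<delta> \<le> ln \<bar>x\<bar>" "ln \<bar>x\<bar> \<le> ln C" using \<delta> by auto
    then have "\<bar>ln \<bar>x\<bar>\<bar> \<le> \<bar>ln \<delta>\<bar> + \<bar>ln C\<bar>" by linarith
    then show ?case by (auto simp: indicator_def)
  qed
  have "?S \<in> sets borel" by measurable
  then have "(\<lambda>x. indicat_real ?S x *\<^sub>R ln \<bar>x\<bar>) \<in> borel_measurable borel" by measurable
  then show "(\<lambda>x. indicat_real ?S x *\<^sub>R ln \<bar>x\<bar>) \<in> borel_measurable M"
    using sets by (simp cong: measurable_cong_sets)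
qed

text \<open>Test with polynomials approximating the positive part of $s - x^2$.\<close>

lemma AE_away_from_0:
  fixes M :: "real measure"
  assumes fm: "finite_measure M" and sets: "sets M = sets borel" and AE: "AE x in M. \<bar>x\<bar> \<le> C" and C: "0 \<le> C"
    and s: "\<And>p :: real poly. s * (\<integral>x. (poly p x)\<^sup>2 \<partial>M) \<le> (\<integral>x. (x * poly p x)\<^sup>2 \<partial>M)"
  shows "AE x in M. s \<le> x\<^sup>2"
proof -
  interpret finite_measure M by (rule fm)
  define h where "h x = max 0 (s - x\<^sup>2)" for x :: real
  have hc: "continuous_on S h" for S unfolding h_def by (intro continuous_intros)
  have meas: "k \<in> borel_measurable M" if "continuous_on UNIV k" for k :: "real \<Rightarrow> real"
    using borel_measurable_continuous_onI[OF that] sets by (simp cong: measurable_cong_sets)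
  have "\<exists>p. \<forall>x\<in>{- C..C}. \<bar>h x - poly p x\<bar> < inverse (real (Suc n))" for n
    by (rule weierstrass_poly[OF hc, of "inverse (real (Suc n))" "- C" C]) (simp, blast)
  then obtain p where p: "\<And>n x. x \<in> {- C..C} \<Longrightarrow> \<bar>h x - poly (p n) x\<bar> < inverse (real (Suc n))"
    by metis
  have h0: "0 \<le> h x" "h x \<le> \<bar>s\<bar>" for x
    using zero_le_power2[of x] by (simp_all only: h_def)
  have pb: "\<bar>poly (p n) x\<bar> \<le> \<bar>s\<bar> + 1" if "\<bar>x\<bar> \<le> C" for n x
  proof -
    have "\<bar>h x - poly (p n) x\<bar> < inverse (real (Suc n))" using that by (intro p) (simp add: abs_le_iff)
    moreover have "inverse (real (Suc n)) \<le> 1" by (simp add: inverse_le_1_iff)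
    ultimately show ?thesis using h0[of x] by linarith
  qed
  have plim: "(\<lambda>n. poly (p n) x) \<longlonglongrightarrow> h x" if "\<bar>x\<bar> \<le> C" for x
  proof -
    have "\<bar>poly (p n) x - h x\<bar> \<le> inverse (real (Suc n))" for n
      using p[of x n] that by (simp add: abs_le_iff abs_minus_commute less_imp_le)
    then have "(\<lambda>n. poly (p n) x - h x) \<longlonglongrightarrow> 0"
      by (intro Lim_null_comparison[OF _ LIMSEQ_inverse_real_of_nat]) simp
    then show ?thesis by (rule LIM_zero_cancel)
  qed
  have lim: "(\<lambda>n. \<integral>x. r x * (poly (p n) x)\<^sup>2 \<partial>M) \<longlonglongrightarrow> (\<integral>x. r x * (h x)\<^sup>2 \<partial>M)"
    if r: "continuous_on UNIV r" "\<And>x. \<bar>x\<bar> \<le> C \<Longrightarrow> \<bar>r x\<bar> \<le> b" for r b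
  proof (rule integral_dominated_convergence[where w = "\<lambda>_. b * (\<bar>s\<bar> + 1)\<^sup>2"])
    show "AE x in M. (\<lambda>n. r x * (poly (p n) x)\<^sup>2) \<longlonglongrightarrow> r x * (h x)\<^sup>2"
      using AE by eventually_elim (intro tendsto_intros plim)
    show "AE x in M. norm (r x * (poly (p n) x)\<^sup>2) \<le> b * (\<bar>s\<bar> + 1)\<^sup>2" for n
      using AE
    proof eventually_elim
      case (elim x)
      have "(poly (p n) x)\<^sup>2 \<le> (\<bar>s\<bar> + 1)\<^sup>2"
        using pb[OF elim, of n] abs_le_square_iff[of "poly (p n) x" "\<bar>s\<bar> + 1"] by simp
      moreover have "0 \<le> b" using r(2)[OF elim] by linarith
      ultimately show ?case using r(2)[OF elim] by (simp add: abs_mult mult_mono)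
    qed
  qed (auto intro!: meas continuous_intros r(1) hc)
  have l1: "(\<lambda>n. \<integral>x. x\<^sup>2 * (poly (p n) x)\<^sup>2 \<partial>M) \<longlonglongrightarrow> (\<integral>x. x\<^sup>2 * (h x)\<^sup>2 \<partial>M)"
    by (rule lim[where b = "C\<^sup>2"]) (auto intro!: continuous_intros simp: abs_le_square_iff[symmetric] C)
  have l2: "(\<lambda>n. \<integral>x. s * (poly (p n) x)\<^sup>2 \<partial>M) \<longlonglongrightarrow> (\<integral>x. s * (h x)\<^sup>2 \<partial>M)"
    by (rule lim[where b = "\<bar>s\<bar>"]) (auto intro!: continuous_intros)
  have le: "(\<integral>x. s * (h x)\<^sup>2 \<partial>M) \<le> (\<integral>x. x\<^sup>2 * (h x)\<^sup>2 \<partial>M)"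
    using s by (intro LIMSEQ_le[OF l2 l1]) (simp add: power_mult_distrib)
  have int: "integrable M (\<lambda>x. r x * (h x)\<^sup>2)" if r: "continuous_on UNIV r" "\<And>x. \<bar>x\<bar> \<le> C \<Longrightarrow> \<bar>r x\<bar> \<le> b" for r b
  proof (rule integrable_const_bound)
    show "AE x in M. norm (r x * (h x)\<^sup>2) \<le> b * s\<^sup>2"
      using AE
    proof eventually_elim
      case (elim x)
      have "(h x)\<^sup>2 \<le> s\<^sup>2" using h0[of x] abs_le_square_iff[of "h x" s] by simp
      moreover have "0 \<le> b" using r(2)[OF elim] by linarith
      ultimately show ?case using r(2)[OF elim] by (simp add: abs_mult mult_mono)
    qed
  qed (auto intro!: meas continuous_intros r(1) hc)
  have i1: "integrable M (\<lambda>x. x\<^sup>2 * (h x)\<^sup>2)"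
    by (rule int[where b = "C\<^sup>2"]) (auto intro!: continuous_intros simp: abs_le_square_iff[symmetric] C)
  have i2: "integrable M (\<lambda>x. s * (h x)\<^sup>2)"
    by (rule int[where b = "\<bar>s\<bar>"]) (auto intro!: continuous_intros)
  \<comment> \<open>The factor s - x^2 coincides with h wherever h is nonzero. So the assumed
    inequality, in the limit, bounds the integral of the nonnegative function h^3 by 0.\<close>
  have cube: "s * (h x)\<^sup>2 - x\<^sup>2 * (h x)\<^sup>2 = (h x) ^ 3" for x
    by (simp add: h_def max_def power3_eq_cube power2_eq_square algebra_simps)
  have i3: "integrable M (\<lambda>x. (h x) ^ 3)" unfolding cube[symmetric] using i1 i2 by simp
  have "(\<integral>x. (h x) ^ 3 \<partial>M) \<le> 0" unfolding cube[symmetric] using i1 i2 le by simp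
  moreover have "0 \<le> (\<integral>x. (h x) ^ 3 \<partial>M)" using h0 by (intro integral_nonneg_AE) simp
  ultimately have "AE x in M. (h x) ^ 3 = 0"
    using integral_nonneg_eq_0_iff_AE[OF i3] h0 by simp
  then show ?thesis by eventually_elim (auto simp: h_def max_def split: if_splits)
qed

section \<open>The discrete magnetic Laplacian\<close>

definition arcs_from :: "('v, 'e) pre_digraph \<Rightarrow> 'v \<Rightarrow> 'v \<Rightarrow> 'e set" where
  "arcs_from \<G> x y = {e. e \<in> in_arcs \<G> x \<and> tail \<G> e = y}"

text \<open>The kernel of the Laplacian minus mu. Summation over all oriented arcs from y to x
  removes the orientation, since the conjugated terms of the Laplacian belong to reversed arcs. A
  loop enters the diagonal through both of its arcs.\<close>

definition magnetic_kernel ::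
  "('v, 'e) pre_digraph \<Rightarrow> ('e \<Rightarrow> complex) \<Rightarrow> real \<Rightarrow> 'v \<Rightarrow> 'v \<Rightarrow> complex" where
  "magnetic_kernel \<G> \<sigma> \<mu> x y =
     (if x = y then of_nat (in_degree \<G> x) - of_real \<mu> else 0) - (\<Sum>e\<in>arcs_from \<G> x y. \<sigma> e)"

definition nbhd :: "('v, 'e) pre_digraph \<Rightarrow> 'v \<Rightarrow> 'v set" where
  "nbhd \<G> x = insert x (tail \<G> ` in_arcs \<G> x)"

locale magnetic_graph = bidirected_digraph \<G> arev
  for \<G> :: "('v, 'e) pre_digraph" and arev +
  fixes \<sigma> :: "'e \<Rightarrow> complex" and D :: nat
  assumes weight: "weight_function \<G> arev \<sigma>"
    and in_arcs_finite: "\<And>x. x \<in> verts \<G> \<Longrightarrow> finite (in_arcs \<G> x)"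
    and in_arcs_card: "\<And>x. x \<in> verts \<G> \<Longrightarrow> card (in_arcs \<G> x) \<le> D"
begin

lemma weight_arev: "e \<in> arcs \<G> \<Longrightarrow> \<sigma> (arev e) = cnj (\<sigma> e)"
  and weight_norm: "e \<in> arcs \<G> \<Longrightarrow> cmod (\<sigma> e) = 1"
proof -
  assume e: "e \<in> arcs \<G>"
  then show n: "cmod (\<sigma> e) = 1" using weight by (auto simp: weight_function_def)
  have "\<sigma> (arev e) = inverse (\<sigma> e)" using e weight by (auto simp: weight_function_def)
  also have "\<dots> = cnj (\<sigma> e)"
    using n complex_norm_square[of "\<sigma> e"] by (intro inverse_unique) (simp add: mult.commute)
  finally show "\<sigma> (arev e) = cnj (\<sigma> e)" .
qed

lemma sum_arcs_from:
  assumes "x \<in> verts \<G>"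
  shows "(\<Sum>y\<in>nbhd \<G> x. sum h (arcs_from \<G> x y)) = sum h (in_arcs \<G> x)"
  unfolding arcs_from_def nbhd_def using in_arcs_finite[OF assms] by (intro sum.group) auto

text \<open>Reversal matches the chosen arcs leaving x with the unchosen arcs entering x and
  conjugates their weights. The function has to vanish off the vertices because
  \<open>shift_op\<close> subtracts its multiple there too.\<close>

lemma dml_eq_kernel_op:
  fixes \<mu> :: real
  assumes Ep: "orientation \<G> arev Ep" and f: "\<And>x. x \<notin> verts \<G> \<Longrightarrow> f x = 0"
  shows "shift_op (dml \<G> Ep \<sigma>) (complex_of_real \<mu>) f = kernel_op (magnetic_kernel \<G> \<sigma> \<mu>) (nbhd \<G>) (verts \<G>) f"
proof
  fix x
  show "shift_op (dml \<G> Ep \<sigma>) (complex_of_real \<mu>) f x =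
      kernel_op (magnetic_kernel \<G> \<sigma> \<mu>) (nbhd \<G>) (verts \<G>) f x"
  proof (cases "x \<in> verts \<G>")
    case False
    then show ?thesis by (simp add: shift_op_def dml_def kernel_op_def f)
  next
    case x: True
    let ?I = "in_arcs \<G> x"
    have Ep1: "arev e \<in> Ep \<longleftrightarrow> e \<notin> Ep" if "e \<in> arcs \<G>" for e
    proof -
      have "\<forall>e\<in>arcs \<G>. (e \<in> Ep) \<noteq> (arev e \<in> Ep)" 
        using Ep unfolding orientation_def by (rule conjunct2)
      from bspec[OF this that] show ?thesis by blast
    qed
    have "(\<Sum>e\<in>Ep \<inter> out_arcs \<G> x. cnj (\<sigma> e) * f (head \<G> e)) = (\<Sum>e\<in>?I - Ep. \<sigma> e * f (tail \<G> e))"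
    proof (rule sum.reindex_bij_witness[of _ arev arev])
      fix e assume e: "e \<in> Ep \<inter> out_arcs \<G> x"
      then have "e \<in> arcs \<G>" by simp
      then show "arev e \<in> ?I - Ep" "\<sigma> (arev e) * f (tail \<G> (arev e)) = cnj (\<sigma> e) * f (head \<G> e)"
        using e Ep1[of e] by (simp_all add: weight_arev)
    next
      fix e assume e: "e \<in> ?I - Ep"
      then have "e \<in> arcs \<G>" by simp
      then show "arev e \<in> Ep \<inter> out_arcs \<G> x" using e Ep1[of e] by simp
    qed simp_all
    moreover have "(\<Sum>e\<in>?I. \<sigma> e * f (tail \<G> e)) = (\<Sum>e\<in>Ep \<inter> ?I. \<sigma> e * f (tail \<G> e)) + (\<Sum>e\<in>?I - Ep. \<sigma> e * f (tail \<G> e))"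
      using sum.Int_Diff[OF in_arcs_finite[OF x], of "\<lambda>e. \<sigma> e * f (tail \<G> e)" Ep] by (simp add: Int_commute)
    ultimately have lhs: "shift_op (dml \<G> Ep \<sigma>) (complex_of_real \<mu>) f x =
        (of_nat (in_degree \<G> x) - of_real \<mu>) * f x - (\<Sum>e\<in>?I. \<sigma> e * f (tail \<G> e))"
      using x by (simp add: shift_op_def dml_def algebra_simps)
    have sub: "nbhd \<G> x \<inter> verts \<G> = nbhd \<G> x" using x by (auto simp: nbhd_def)
    have fin: "finite (nbhd \<G> x)" using in_arcs_finite[OF x] by (simp add: nbhd_def)
    have "kernel_op (magnetic_kernel \<G> \<sigma> \<mu>) (nbhd \<G>) (verts \<G>) f x =
        (\<Sum>y\<in>nbhd \<G> x. magnetic_kernel \<G> \<sigma> \<mu> x y * f y)"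
      using x by (simp only: kernel_op_def sub if_True)
    also have "\<dots> = (\<Sum>y\<in>nbhd \<G> x. (if x = y then (of_nat (in_degree \<G> x) - of_real \<mu>) * f x else 0) -
          (\<Sum>e\<in>arcs_from \<G> x y. \<sigma> e * f (tail \<G> e)))"
    proof (intro sum.cong refl)
      fix y
      have "(\<Sum>e\<in>arcs_from \<G> x y. \<sigma> e) * f y = (\<Sum>e\<in>arcs_from \<G> x y. \<sigma> e * f (tail \<G> e))"
        unfolding sum_distrib_right by (intro sum.cong refl) (simp add: arcs_from_def)
      then show "magnetic_kernel \<G> \<sigma> \<mu> x y * f y =
          (if x = y then (of_nat (in_degree \<G> x) - of_real \<mu>) * f x else 0) -
          (\<Sum>e\<in>arcs_from \<G> x y. \<sigma> e * f (tail \<G> e))"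
        by (simp add: magnetic_kernel_def left_diff_distrib)
    qed
    also have "\<dots> = (of_nat (in_degree \<G> x) - of_real \<mu>) * f x - (\<Sum>e\<in>?I. \<sigma> e * f (tail \<G> e))"
      unfolding sum_subtractf sum_arcs_from[OF x] using fin by (simp add: nbhd_def)
    finally show ?thesis using lhs by simp
  qed
qed

text \<open>In the constant, D + |mu| bounds the diagonal term, a further D bounds the number of
  arcs in a row, and 1 makes it positive.\<close>

lemma hermitian_kernel_magnetic:
  fixes \<mu> :: real
  shows "hermitian_kernel (verts \<G>) (magnetic_kernel \<G> \<sigma> \<mu>) (nbhd \<G>) (2 * real D + \<bar>\<mu>\<bar> + 1)"
proof
  fix x assume x: "x \<in> verts \<G>"
  show fin: "finite (nbhd \<G> x)" using in_arcs_finite[OF x] by (simp add: nbhd_def)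
  show "nbhd \<G> x \<subseteq> verts \<G>" using x by (auto simp: nbhd_def)
  have le: "cmod (magnetic_kernel \<G> \<sigma> \<mu> x y) \<le> (if x = y then real D + \<bar>\<mu>\<bar> else 0) + (\<Sum>e\<in>arcs_from \<G> x y. 1)" for y
  proof -
    have "cmod (magnetic_kernel \<G> \<sigma> \<mu> x y) \<le>
        cmod (if x = y then of_nat (in_degree \<G> x) - of_real \<mu> else 0) + cmod (\<Sum>e\<in>arcs_from \<G> x y. \<sigma> e)"
      unfolding magnetic_kernel_def by (rule norm_triangle_ineq4)
    also have "cmod (\<Sum>e\<in>arcs_from \<G> x y. \<sigma> e) \<le> (\<Sum>e\<in>arcs_from \<G> x y. 1)"
      by (intro sum_norm_le) (auto simp: arcs_from_def weight_norm)
    also have "cmod (if x = y then of_nat (in_degree \<G> x) - of_real \<mu> else 0) \<le> (if x = y then real D + \<bar>\<mu>\<bar> else 0)"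
      using in_arcs_card[OF x] norm_triangle_ineq4[of "of_nat (in_degree \<G> x)" "complex_of_real \<mu>"]
      by (auto simp: in_degree_def)
    finally show ?thesis by simp
  qed
  have "(\<Sum>y\<in>nbhd \<G> x. cmod (magnetic_kernel \<G> \<sigma> \<mu> x y)) \<le>
      (\<Sum>y\<in>nbhd \<G> x. (if x = y then real D + \<bar>\<mu>\<bar> else 0) + (\<Sum>e\<in>arcs_from \<G> x y. 1))"
    by (rule sum_mono) (rule le)
  also have "\<dots> = real D + \<bar>\<mu>\<bar> + real (card (in_arcs \<G> x))"
    unfolding sum.distrib sum_arcs_from[OF x] using fin by (simp add: nbhd_def)
  finally show "(\<Sum>y\<in>nbhd \<G> x. cmod (magnetic_kernel \<G> \<sigma> \<mu> x y)) \<le> 2 * real D + \<bar>\<mu>\<bar> + 1"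
    using in_arcs_card[OF x] by simp
next
  fix x y assume x: "x \<in> verts \<G>" and y: "y \<in> verts \<G>"
  have arev_mem: "arev e \<in> arcs_from \<G> y x" if "e \<in> arcs_from \<G> x y" for x y e
    using that by (auto simp: arcs_from_def)
  show "x \<in> nbhd \<G> y" if "y \<in> nbhd \<G> x"
  proof (cases "y = x")
    case False
    then have "y \<in> tail \<G> ` in_arcs \<G> x" using that by (simp add: nbhd_def)
    then obtain e where "e \<in> in_arcs \<G> x" "y = tail \<G> e" by blast
    then have "e \<in> arcs_from \<G> x y" by (simp add: arcs_from_def)
    from arev_mem[OF this] show ?thesis by (force simp: nbhd_def arcs_from_def)
  qed (simp add: nbhd_def)
  show "magnetic_kernel \<G> \<sigma> \<mu> x y = 0" if "y \<notin> nbhd \<G> x"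
  proof -
    have "arcs_from \<G> x y = {}" "x \<noteq> y" using that by (auto simp: nbhd_def arcs_from_def)
    then show ?thesis by (simp add: magnetic_kernel_def)
  qed
  have "(\<Sum>e\<in>arcs_from \<G> y x. \<sigma> e) = (\<Sum>e\<in>arcs_from \<G> x y. cnj (\<sigma> e))"
    by (rule sum.reindex_bij_witness[of _ arev arev])
      (auto simp: arcs_from_def weight_arev)
  then show "magnetic_kernel \<G> \<sigma> \<mu> y x = cnj (magnetic_kernel \<G> \<sigma> \<mu> x y)"
    by (simp add: magnetic_kernel_def)
qed simp

lemma arcs_from_card:
  assumes "x \<in> verts \<G>" "inj_on u J" "finite J"
  shows "(\<Sum>j\<in>J. card (arcs_from \<G> x (u j))) \<le> D"
proof -
  have fin: "finite (arcs_from \<G> x y)" for y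
    using in_arcs_finite[OF assms(1)] by (rule rev_finite_subset) (auto simp: arcs_from_def)
  have "(\<Sum>j\<in>J. card (arcs_from \<G> x (u j))) = card (\<Union>j\<in>J. arcs_from \<G> x (u j))"
    using assms fin by (intro card_UN_disjoint[symmetric]) (auto simp: arcs_from_def inj_on_def)
  also have "\<dots> \<le> card (in_arcs \<G> x)"
    using in_arcs_finite[OF assms(1)] by (intro card_mono) (auto simp: arcs_from_def)
  finally show ?thesis using in_arcs_card[OF assms(1)] by simp
qed

end

text \<open>Move each arc entering x into the fundamental domain by some group element. If two arcs
  have the same image, their group elements move the common head x to the same vertex; by freeness
  they are equal, and so are the arcs.\<close>

lemma free_action_in_arcs_finite:
  assumes bd: "bidirected_digraph \<G> arev" and act: "graph_action \<Gamma> \<G> arev \<alpha> \<beta>"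
    and free: "free_action \<Gamma> \<G> arev \<alpha> \<beta>" and fd: "fundamental_domain \<Gamma> \<G> arev \<alpha> \<beta> FV FE"
    and x: "x \<in> verts \<G>"
  shows "finite (in_arcs \<G> x) \<and> card (in_arcs \<G> x) \<le> card (\<Union>FE)"
proof -
  interpret bidirected_digraph \<G> arev by (rule bd)
  interpret av: group_action \<Gamma> "verts \<G>" \<alpha> using act by (simp add: graph_action_def)
  interpret ae: group_action \<Gamma> "arcs \<G>" \<beta> using act by (simp add: graph_action_def)
  interpret \<Gamma>: group \<Gamma> using av.group_hom group_hom.axioms(1) by blast
  have heads: "head \<G> (\<beta> g e) = \<alpha> g (head \<G> e)" if "g \<in> carrier \<Gamma>" "e \<in> arcs \<G>" for g e
    using act that by (auto simp: graph_action_def)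
  have "finite FE" "FE \<subseteq> unoriented_edges \<G> arev"
    using fd by (simp_all only: fundamental_domain_def)
  then have fin: "finite (\<Union>FE)" by (auto simp: unoriented_edges_def)
  have "\<exists>g. g \<in> carrier \<Gamma> \<and> \<beta> g e \<in> \<Union>FE" if "e \<in> in_arcs \<G> x" for e
  proof -
    have u: "{e, arev e} \<in> unoriented_edges \<G> arev" using that by (auto simp: unoriented_edges_def)
    have "\<forall>u\<in>unoriented_edges \<G> arev. \<exists>!w. w \<in> FE \<and> (\<exists>g\<in>carrier \<Gamma>. w = \<beta> g ` u)"
      using fd unfolding fundamental_domain_def by (elim conjE) assumption
    from bspec[OF this u] obtain w g where wg: "w \<in> FE" "g \<in> carrier \<Gamma>" "w = \<beta> g ` {e, arev e}"
      by (elim ex1E conjE bexE)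
    have "\<beta> g e \<in> w" unfolding wg(3) by simp
    then show ?thesis using wg(1,2) by blast
  qed
  then obtain g where g: "\<And>e. e \<in> in_arcs \<G> x \<Longrightarrow> g e \<in> carrier \<Gamma>" "\<And>e. e \<in> in_arcs \<G> x \<Longrightarrow> \<beta> (g e) e \<in> \<Union>FE"
    by metis
  have inj: "inj_on (\<lambda>e. \<beta> (g e) e) (in_arcs \<G> x)"
  proof (rule inj_onI)
    fix e e' assume e: "e \<in> in_arcs \<G> x" and e': "e' \<in> in_arcs \<G> x" and eq: "\<beta> (g e) e = \<beta> (g e') e'"
    have arcs: "e \<in> arcs \<G>" "e' \<in> arcs \<G>" using e e' by auto
    have ax: "\<alpha> (g e) x = \<alpha> (g e') x"
      using arg_cong[OF eq, of "head \<G>"] heads[OF g(1)[OF e] arcs(1)] heads[OF g(1)[OF e'] arcs(2)] e e' by simp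
    let ?h = "inv\<^bsub>\<Gamma>\<^esub> (g e') \<otimes>\<^bsub>\<Gamma>\<^esub> g e"
    have h: "?h \<in> carrier \<Gamma>" using g(1)[OF e] g(1)[OF e'] by simp
    have "\<alpha> ?h x = \<alpha> (inv\<^bsub>\<Gamma>\<^esub> (g e')) (\<alpha> (g e') x)"
      using av.composition_rule[OF x, of "inv\<^bsub>\<Gamma>\<^esub> (g e')" "g e"] g(1)[OF e] g(1)[OF e'] ax by simp
    also have "\<dots> = \<alpha> (inv\<^bsub>\<Gamma>\<^esub> (g e') \<otimes>\<^bsub>\<Gamma>\<^esub> g e') x"
      using av.composition_rule[OF x, of "inv\<^bsub>\<Gamma>\<^esub> (g e')" "g e'"] g(1)[OF e'] by simp
    also have "\<dots> = x" using g(1)[OF e'] av.id_eq_one x by (metis \<Gamma>.l_inv restrict_apply')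
    finally have "?h = \<one>\<^bsub>\<Gamma>\<^esub>" using free h x by (auto simp: free_action_def)
    then have "g e = g e'"
      using g(1)[OF e] g(1)[OF e'] by (metis \<Gamma>.inv_equality \<Gamma>.inv_inv \<Gamma>.inv_closed)
    then show "e = e'"
      using eq ae.inj_prop[OF g(1)[OF e]] arcs by (auto simp: inj_on_def)
  qed
  have sub: "(\<lambda>e. \<beta> (g e) e) ` in_arcs \<G> x \<subseteq> \<Union>FE" using g(2) by blast
  show ?thesis using inj_on_finite[OF inj sub fin] card_inj_on_le[OF inj sub fin] by simp
qed

text \<open>Since x is the head and y the tail, weak invariance is exactly covariance with phases s
  x and cnj (s y). On the diagonal these have product 1, which agrees with the invariance of the
  valence.\<close>

lemma periodic_kernel_magnetic:
  fixes \<Gamma> (structure) and \<mu> :: real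
  assumes mg: "magnetic_graph \<G> arev \<sigma> D" and act: "graph_action \<Gamma> \<G> arev \<alpha> \<beta>"
    and free: "free_action \<Gamma> \<G> arev \<alpha> \<beta>" and fd: "fundamental_domain \<Gamma> \<G> arev \<alpha> \<beta> FV FE"
    and inv: "weakly_invariant \<Gamma> \<G> \<beta> \<sigma>"
  shows "periodic_kernel (verts \<G>) (magnetic_kernel \<G> \<sigma> \<mu>) (nbhd \<G>) (2 * real D + \<bar>\<mu>\<bar> + 1) \<Gamma> \<alpha> FV"
proof -
  interpret magnetic_graph \<G> arev \<sigma> D by (rule mg)
  interpret av: group_action \<Gamma> "verts \<G>" \<alpha> using act by (simp add: graph_action_def)
  interpret ae: group_action \<Gamma> "arcs \<G>" \<beta> using act by (simp add: graph_action_def)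
  interpret \<Gamma>: group \<Gamma> using av.group_hom group_hom.axioms(1) by blast
  have ends: "head \<G> (\<beta> g e) = \<alpha> g (head \<G> e)" "tail \<G> (\<beta> g e) = \<alpha> g (tail \<G> e)" "\<beta> g e \<in> arcs \<G>"
    if "g \<in> carrier \<Gamma>" "e \<in> arcs \<G>" for g e
    using act that ae.element_image by (auto simp: graph_action_def)
  have inj: "\<alpha> g x = \<alpha> g y \<longleftrightarrow> x = y" if "g \<in> carrier \<Gamma>" "x \<in> verts \<G>" "y \<in> verts \<G>" for g x y
    using av.inj_prop that by (auto simp: inj_on_def)
  have in_arcs: "in_arcs \<G> (\<alpha> g x) = \<beta> g ` in_arcs \<G> x" if g: "g \<in> carrier \<Gamma>" and x: "x \<in> verts \<G>" for g x
  proof (intro equalityI subsetI)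
    fix e assume e: "e \<in> in_arcs \<G> (\<alpha> g x)"
    then obtain e' where e': "e' \<in> arcs \<G>" "e = \<beta> g e'" using ae.surj_prop[OF g] by auto
    then have "head \<G> e' = x" using e ends[OF g e'(1)] inj[OF g _ x] by auto
    then show "e \<in> \<beta> g ` in_arcs \<G> x" using e' by auto
  qed (use ends[OF g] in auto)
  have injE: "inj_on (\<beta> g) S" if "g \<in> carrier \<Gamma>" "S \<subseteq> arcs \<G>" for g S
    using ae.inj_prop that inj_on_subset by blast
  have arcs_from: "arcs_from \<G> (\<alpha> g x) (\<alpha> g y) = \<beta> g ` arcs_from \<G> x y"
    if g: "g \<in> carrier \<Gamma>" and x: "x \<in> verts \<G>" and y: "y \<in> verts \<G>" for g x y
    unfolding arcs_from_def in_arcs[OF g x] using ends[OF g] inj[OF g _ y] by auto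
  show ?thesis
  proof (intro periodic_kernel.intro hermitian_kernel_magnetic av.group_action_axioms periodic_kernel_axioms.intro)
    show "finite FV" "FV \<subseteq> verts \<G>" using fd by (auto simp: fundamental_domain_def)
    show "\<exists>!w. w \<in> FV \<and> (\<exists>g\<in>carrier \<Gamma>. w = \<alpha> g v)" if "v \<in> verts \<G>" for v
      using fd that by (simp only: fundamental_domain_def)
    show "g = \<one>" if "g \<in> carrier \<Gamma>" "v \<in> verts \<G>" "\<alpha> g v = v" for g v
      using free that by (auto simp: free_action_def)
    show "nbhd \<G> (\<alpha> g x) = \<alpha> g ` nbhd \<G> x" if g: "g \<in> carrier \<Gamma>" and x: "x \<in> verts \<G>" for g x
      unfolding nbhd_def in_arcs[OF g x] image_insert image_image using ends[OF g] by auto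
    fix g assume g: "g \<in> carrier \<Gamma>"
    then obtain s where s1: "\<forall>v\<in>verts \<G>. cmod (s v) = 1"
      and s: "\<And>e. e \<in> arcs \<G> \<Longrightarrow> \<sigma> (\<beta> g e) = \<sigma> e * s (head \<G> e) * cnj (s (tail \<G> e))"
      using inv by (auto simp: weakly_invariant_def)
    have "magnetic_kernel \<G> \<sigma> \<mu> (\<alpha> g x) (\<alpha> g y) = s x * cnj (s y) * magnetic_kernel \<G> \<sigma> \<mu> x y"
      if x: "x \<in> verts \<G>" and y: "y \<in> verts \<G>" for x y
    proof -
      have deg: "in_degree \<G> (\<alpha> g x) = in_degree \<G> x"
        unfolding in_degree_def in_arcs[OF g x] by (intro card_image injE g) auto
      have "(\<Sum>e\<in>arcs_from \<G> (\<alpha> g x) (\<alpha> g y). \<sigma> e) = (\<Sum>e\<in>arcs_from \<G> x y. \<sigma> (\<beta> g e))"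
        unfolding arcs_from[OF g x y] by (subst sum.reindex) (auto intro!: injE g simp: arcs_from_def)
      also have "\<dots> = (\<Sum>e\<in>arcs_from \<G> x y. s x * cnj (s y) * \<sigma> e)"
        by (intro sum.cong refl) (auto simp: arcs_from_def s)
      finally have sum: "(\<Sum>e\<in>arcs_from \<G> (\<alpha> g x) (\<alpha> g y). \<sigma> e) = s x * cnj (s y) * (\<Sum>e\<in>arcs_from \<G> x y. \<sigma> e)"
        by (simp add: sum_distrib_left)
      have "s x * cnj (s x) = 1" using s1 x complex_norm_square[of "s x"] by simp
      then show ?thesis
        unfolding magnetic_kernel_def sum deg inj[OF g x y] by (cases "x = y") (simp_all add: right_diff_distrib)
    qed
    then show "\<exists>s. (\<forall>v\<in>verts \<G>. cmod (s v) = 1) \<and>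
        (\<forall>x\<in>verts \<G>. \<forall>y\<in>verts \<G>. magnetic_kernel \<G> \<sigma> \<mu> (\<alpha> g x) (\<alpha> g y) = s x * cnj (s y) * magnetic_kernel \<G> \<sigma> \<mu> x y)"
      using s1 by blast
  qed
qed

text \<open>Needed because the shifted Laplacian and the kernel operator agree only on
  square-summable functions on the vertices.\<close>

lemma symmetric_op_cong:
  assumes "symmetric_op W B C" and eq: "\<And>f. f \<in> ell2 W \<Longrightarrow> A f = B f"
  shows "symmetric_op W A C"
proof -
  interpret B: symmetric_op W B C by fact
  show ?thesis
  proof
    show "bounded_op W A"
      using B.bounded unfolding bounded_op_def by (simp add: eq ell2_add ell2_scale)
  qed (simp_all add: eq B.symmetric B.norm_le B.C_pos)
qed

lemma (in symmetric_op) spectral_family_poly_integral: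
  assumes M: "\<And>k. (\<integral>x. x ^ k \<partial>interval_measure F) = (\<Sum>i\<in>I. Re (ell2_inner W ((A ^^ k) (fs i)) (fs i)))"
    and cd: "compact_distribution F a b" and fs: "\<And>i. i \<in> I \<Longrightarrow> fs i \<in> ell2 W"
  shows "(\<integral>x. poly p x \<partial>interval_measure F) = (\<Sum>i\<in>I. Re (ell2_inner W (poly_op A p (fs i)) (fs i)))"
proof -
  interpret compact_distribution F a b by (rule cd)
  have int: "integrable (interval_measure F) (\<lambda>x. x ^ k)" for k
  proof (rule integrable_bounded[where B = "max \<bar>a\<bar> \<bar>b\<bar> ^ k"])
    show "\<bar>x ^ k\<bar> \<le> max \<bar>a\<bar> \<bar>b\<bar> ^ k" if "x \<in> {a..b}" for x
      unfolding power_abs using that by (intro power_mono) auto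
  qed measurable
  have "(\<integral>x. poly p x \<partial>interval_measure F) = (\<Sum>k\<le>degree p. coeff p k * (\<integral>x. x ^ k \<partial>interval_measure F))"
    unfolding poly_altdef by (simp add: int Bochner_Integration.integral_sum)
  also have "\<dots> = (\<Sum>i\<in>I. \<Sum>k\<le>degree p. coeff p k * Re (ell2_inner W ((A ^^ k) (fs i)) (fs i)))"
    unfolding M sum_distrib_left by (rule sum.swap)
  also have "\<dots> = (\<Sum>i\<in>I. Re (ell2_inner W (poly_op A p (fs i)) (fs i)))"
  proof (intro sum.cong refl)
    fix i assume i: "i \<in> I"
    have "ell2_inner W (poly_op A p (fs i)) (fs i) =
        (\<Sum>k\<le>degree p. of_real (coeff p k) * ell2_inner W ((A ^^ k) (fs i)) (fs i))"
      unfolding poly_op_def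
      by (subst ell2_inner_sum_left) (auto simp: ell2_inner_scale_left intro!: ell2_scale funpow_closed fs i)
    then show "(\<Sum>k\<le>degree p. coeff p k * Re (ell2_inner W ((A ^^ k) (fs i)) (fs i))) =
        Re (ell2_inner W (poly_op A p (fs i)) (fs i))"
      by (simp add: Re_sum)
  qed
  finally show ?thesis .
qed

section \<open>Positivity of the determinant\<close>

lemma prod_list_ln:
  fixes es :: "real list"
  assumes "\<And>e. e \<in> set es \<Longrightarrow> e \<noteq> 0"
  shows "ln (\<Prod>e\<leftarrow>es. \<bar>e\<bar>) = (\<Sum>e\<leftarrow>es. ln \<bar>e\<bar>) \<and> 0 < (\<Prod>e\<leftarrow>es. \<bar>e\<bar>)"
  using assms by (induction es) (auto simp: ln_mult)

text \<open>The compressions keep the valence of the whole graph on the diagonal. Hence boundary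
  rows have the same form as inner ones, and \<open>algebraic_char_poly_coeff_bound\<close> yields
  one constant for all m. Row sums at most C confine all eigenvalues to [-C, C].\<close>

lemma approximating_eigenvalues:
  fixes \<Gamma> (structure) and \<mu> :: real
  assumes mg: "magnetic_graph \<G> arev \<sigma> D"
    and pk: "periodic_kernel (verts \<G>) (magnetic_kernel \<G> \<sigma> \<mu>) (nbhd \<G>) C \<Gamma> \<alpha> FV"
    and rat: "rational_weight \<G> \<sigma>" and alg: "algebraic \<mu>"
    and S: "finite S" "S \<subseteq> carrier \<Gamma>" "generate \<Gamma> S = carrier \<Gamma>"
    and exh: "regular_exhaustion \<Gamma> S \<Lambda>"
  obtains es :: "nat \<Rightarrow> real list" and K :: real
  where "\<And>m e. e \<in> set (es m) \<Longrightarrow> \<bar>e\<bar> \<le> C"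
    and "\<And>m. length (es m) = card FV * card (\<Lambda> m)"
    and "\<And>k. (\<lambda>m. (\<Sum>e\<leftarrow>es m. e ^ k) / real (card (\<Lambda> m))) \<longlonglongrightarrow>
      (\<Sum>w\<in>FV. Re ((kernel_op (magnetic_kernel \<G> \<sigma> \<mu>) (nbhd \<G>) (verts \<G>) ^^ k) (delta w) w))"
    and "\<And>m. - K * real (card (\<Lambda> m)) \<le> (\<Sum>e\<leftarrow>filter (\<lambda>e. e \<noteq> 0) (es m). ln \<bar>e\<bar>)"
proof -
  interpret magnetic_graph \<G> arev \<sigma> D by (rule mg)
  let ?a = "magnetic_kernel \<G> \<sigma> \<mu>" and ?V = "verts \<G>"
  interpret pk: periodic_kernel ?V ?a "nbhd \<G>" C \<Gamma> \<alpha> FV by (rule pk)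
  have L: "finite (\<Lambda> m)" "\<Lambda> m \<noteq> {}" "\<Lambda> m \<subseteq> carrier \<Gamma>" for m
    using exh unfolding regular_exhaustion_def by blast+
  obtain n where n: "0 < n" "\<And>e. e \<in> arcs \<G> \<Longrightarrow> \<sigma> e ^ n = 1"
    using rat unfolding rational_weight_def by blast
  obtain K where K: "1 \<le> K" and Kb: "\<And>N A dg (E :: nat \<Rightarrow> nat \<Rightarrow> 'b set) \<sigma> k. A \<in> carrier_mat N N \<Longrightarrow>
    (\<forall>i<N. \<forall>j<N. A $$ (i, j) = (if i = j then of_nat (dg i) - complex_of_real \<mu> else 0)
        - (\<Sum>e\<in>E i j. \<sigma> e) \<and> (\<forall>e\<in>E i j. \<sigma> e ^ n = 1)) \<Longrightarrow>
    (\<forall>i<N. dg i \<le> D \<and> (\<Sum>j<N. card (E i j)) \<le> D) \<Longrightarrow>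
    coeff (char_poly A) k \<noteq> 0 \<Longrightarrow> 1 \<le> K ^ N * cmod (coeff (char_poly A) k)"
    using algebraic_char_poly_coeff_bound[OF alg n(1), of D] by blast
  define N where "N = (\<lambda>m. card FV * card (\<Lambda> m))"
  let ?U = "\<lambda>m. pk.translates (\<Lambda> m)"
  have U: "?U m \<subseteq> ?V" for m by (rule pk.translates_subset[OF L(3)])
  have cU: "card (?U m) = N m" and fU: "finite (?U m)" for m
    using bij_betw_same_card[OF pk.translates_bij[OF L(3)], of m] bij_betw_finite[OF pk.translates_bij[OF L(3)], of m]
      L(1) pk.FV(1) by (simp_all add: card_cartesian_product N_def mult.commute)
  have ex: "\<exists>es. length es = N m \<and> (\<forall>e\<in>set es. \<bar>e\<bar> \<le> C) \<and>
      (\<forall>k. (\<Sum>v\<in>?U m. (pk.K (?U m) ^^ k) (delta v) v) = complex_of_real (\<Sum>e\<leftarrow>es. e ^ k)) \<and>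
      - ln K * real (N m) \<le> (\<Sum>e\<leftarrow>filter (\<lambda>e. e \<noteq> 0) es. ln \<bar>e\<bar>)" for m
  proof -
    obtain x where x: "bij_betw x {..<N m} (?U m)"
      using ex_bij_betw_nat_finite[OF fU[of m]] cU[of m] by (auto simp: lessThan_atLeast0)
    have xV: "x i \<in> ?V" if "i < N m" for i using bij_betwE[OF x] that U[of m] by blast
    have xinj: "x i = x j \<longleftrightarrow> i = j" if "i < N m" "j < N m" for i j
      using bij_betw_imp_inj_on[OF x] that by (simp add: inj_on_eq_iff)
    let ?A = "mat (N m) (N m) (\<lambda>(i, j). ?a (x i) (x j))"
    have A: "?A \<in> carrier_mat (N m) (N m)" by simp
    have herm: "?A $$ (j, i) = cnj (?A $$ (i, j))" if "i < N m" "j < N m" for i j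
    proof -
      have e: "?A $$ (j, i) = ?a (x j) (x i)" "?A $$ (i, j) = ?a (x i) (x j)" using that by simp_all
      show ?thesis unfolding e by (rule pk.herm[OF xV[OF that(1)] xV[OF that(2)]])
    qed
    have row: "(\<Sum>j<N m. cmod (?A $$ (i, j))) \<le> C" if i: "i < N m" for i
    proof -
      have "(\<Sum>j<N m. cmod (?A $$ (i, j))) = (\<Sum>j<N m. cmod (?a (x i) (x j)))" using i by simp
      also have "\<dots> = (\<Sum>y\<in>?U m. cmod (?a (x i) y))" by (rule sum.reindex_bij_betw[OF x])
      also have "\<dots> \<le> C" by (rule pk.row_finite[OF xV[OF i] fU U])
      finally show ?thesis .
    qed
    obtain es where es: "length es = N m" "\<And>e. e \<in> set es \<Longrightarrow> \<bar>e\<bar> \<le> C"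
        "\<And>k. (\<Sum>i<N m. (?A ^\<^sub>m k) $$ (i, i)) = complex_of_real (\<Sum>e\<leftarrow>es. e ^ k)"
      and coe: "\<exists>k. coeff (char_poly ?A) k \<noteq> 0 \<and>
        cmod (coeff (char_poly ?A) k) = (\<Prod>e\<leftarrow>filter (\<lambda>e. e \<noteq> 0) es. \<bar>e\<bar>)"
      by (rule hermitian_spectrum[OF A herm row]) blast+
    have tr: "(\<Sum>v\<in>?U m. (pk.K (?U m) ^^ k) (delta v) v) = complex_of_real (\<Sum>e\<leftarrow>es. e ^ k)" for k
    proof -
      have "(\<Sum>v\<in>?U m. (pk.K (?U m) ^^ k) (delta v) v) = (\<Sum>i<N m. (pk.K (?U m) ^^ k) (delta (x i)) (x i))"
        by (rule sum.reindex_bij_betw[OF x, symmetric])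
      also have "\<dots> = (\<Sum>i<N m. (?A ^\<^sub>m k) $$ (i, i))"
        by (intro sum.cong refl) (simp add: pk.K_power_matrix[OF x U])
      finally show ?thesis by (simp only: es(3))
    qed
    obtain k where k: "coeff (char_poly ?A) k \<noteq> 0"
      "cmod (coeff (char_poly ?A) k) = (\<Prod>e\<leftarrow>filter (\<lambda>e. e \<noteq> 0) es. \<bar>e\<bar>)"
      using coe by blast
    have "1 \<le> K ^ N m * cmod (coeff (char_poly ?A) k)"
    proof (rule Kb[of ?A "N m" "\<lambda>i. in_degree \<G> (x i)" \<sigma> "\<lambda>i j. arcs_from \<G> (x i) (x j)" k,
          OF A _ _ k(1)])
      show "\<forall>i<N m. \<forall>j<N m. ?A $$ (i, j) =
          (if i = j then of_nat (in_degree \<G> (x i)) - complex_of_real \<mu> else 0) - (\<Sum>e\<in>arcs_from \<G> (x i) (x j). \<sigma> e) \<and>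
          (\<forall>e\<in>arcs_from \<G> (x i) (x j). \<sigma> e ^ n = 1)"
      proof (intro allI impI conjI ballI)
        fix i j assume ij: "i < N m" "j < N m"
        show "?A $$ (i, j) = (if i = j then of_nat (in_degree \<G> (x i)) - complex_of_real \<mu> else 0) -
            (\<Sum>e\<in>arcs_from \<G> (x i) (x j). \<sigma> e)"
          using ij by (simp add: magnetic_kernel_def xinj)
        show "\<sigma> e ^ n = 1" if "e \<in> arcs_from \<G> (x i) (x j)" for e
          using that by (intro n(2)) (simp add: arcs_from_def)
      qed
      show "\<forall>i<N m. in_degree \<G> (x i) \<le> D \<and> (\<Sum>j<N m. card (arcs_from \<G> (x i) (x j))) \<le> D"
      proof (intro allI impI conjI)
        fix i assume i: "i < N m"
        show "in_degree \<G> (x i) \<le> D" unfolding in_degree_def by (rule in_arcs_card[OF xV[OF i]])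
        show "(\<Sum>j<N m. card (arcs_from \<G> (x i) (x j))) \<le> D"
          using x by (intro arcs_from_card xV i bij_betw_imp_inj_on[OF x]) simp
      qed
    qed
    then have "1 \<le> K ^ N m * (\<Prod>e\<leftarrow>filter (\<lambda>e. e \<noteq> 0) es. \<bar>e\<bar>)" by (simp only: k(2))
    then have "0 \<le> ln (K ^ N m * (\<Prod>e\<leftarrow>filter (\<lambda>e. e \<noteq> 0) es. \<bar>e\<bar>))" by simp
    also have "\<dots> = real (N m) * ln K + (\<Sum>e\<leftarrow>filter (\<lambda>e. e \<noteq> 0) es. ln \<bar>e\<bar>)"
      using K prod_list_ln[of "filter (\<lambda>e. e \<noteq> 0) es"] by (subst ln_mult) (auto simp: ln_realpow)
    finally have "- ln K * real (N m) \<le> (\<Sum>e\<leftarrow>filter (\<lambda>e. e \<noteq> 0) es. ln \<bar>e\<bar>)" by (simp add: mult.commute)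
    then show ?thesis using es(1,2) tr by blast
  qed
  from choice[OF allI[OF ex]] obtain es where es_all: "\<forall>m. length (es m) = N m \<and> (\<forall>e\<in>set (es m). \<bar>e\<bar> \<le> C) \<and>
      (\<forall>k. (\<Sum>v\<in>?U m. (pk.K (?U m) ^^ k) (delta v) v) = complex_of_real (\<Sum>e\<leftarrow>es m. e ^ k)) \<and>
      - ln K * real (N m) \<le> (\<Sum>e\<leftarrow>filter (\<lambda>e. e \<noteq> 0) (es m). ln \<bar>e\<bar>)" ..
  have es: "length (es m) = N m" "e \<in> set (es m) \<Longrightarrow> \<bar>e\<bar> \<le> C"
      "(\<Sum>v\<in>?U m. (pk.K (?U m) ^^ k) (delta v) v) = complex_of_real (\<Sum>e\<leftarrow>es m. e ^ k)"
      "- ln K * real (N m) \<le> (\<Sum>e\<leftarrow>filter (\<lambda>e. e \<noteq> 0) (es m). ln \<bar>e\<bar>)" for m e k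
    using spec[OF es_all, of m] by blast+
  show ?thesis
  proof (rule that[of es "ln K * real (card FV)"])
    show "\<bar>e\<bar> \<le> C" if "e \<in> set (es m)" for m e by (rule es(2)[OF that])
    show "length (es m) = card FV * card (\<Lambda> m)" for m by (simp add: es(1) N_def)
    show "- (ln K * real (card FV)) * real (card (\<Lambda> m)) \<le> (\<Sum>e\<leftarrow>filter (\<lambda>e. e \<noteq> 0) (es m). ln \<bar>e\<bar>)" for m
      using es(4)[of m] by (simp add: N_def mult.assoc)
    show "(\<lambda>m. (\<Sum>e\<leftarrow>es m. e ^ k) / real (card (\<Lambda> m))) \<longlonglongrightarrow>
        (\<Sum>w\<in>FV. Re ((pk.K ?V ^^ k) (delta w) w))" for k
    proof -
      have "Re (complex_of_real r / of_nat c) = r / real c" for r c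
        by (metis Re_complex_of_real of_real_divide of_real_of_nat_eq)
      then show ?thesis
        using tendsto_Re[OF pk.trace_convergence[OF exh S, of k]] by (simp only: es(3) Re_sum)
    qed
  qed
qed

theorem proposition4p4:
  fixes \<G> :: "('v, 'e) pre_digraph" and arev :: "'e \<Rightarrow> 'e"
    and \<Gamma> :: "('g, 'm) monoid_scheme" and S :: "'g set"
    and \<alpha> :: "'g \<Rightarrow> 'v \<Rightarrow> 'v" and \<beta> :: "'g \<Rightarrow> 'e \<Rightarrow> 'e"
    and FV :: "'v set" and FE :: "'e set set"
    and Ep :: "'e set" and \<sigma> :: "'e \<Rightarrow> complex"
    and \<Lambda> :: "nat \<Rightarrow> 'g set" and bc :: boundary_condition and \<mu> :: real
  assumes "bidirected_digraph \<G> arev"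
    and "group \<Gamma>" and "finite S" and "S \<subseteq> carrier \<Gamma>" and "generate \<Gamma> S = carrier \<Gamma>"
    and "amenable \<Gamma>"
    and "graph_action \<Gamma> \<G> arev \<alpha> \<beta>" and "free_action \<Gamma> \<G> arev \<alpha> \<beta>"
    and "finite (orbits \<Gamma> (verts \<G>) \<alpha>)" and "finite (orbits \<Gamma> (arcs \<G>) \<beta>)"
    and "fundamental_domain \<Gamma> \<G> arev \<alpha> \<beta> FV FE"
    and "orientation \<G> arev Ep"
    and "weight_function \<G> arev \<sigma>" and "weakly_invariant \<Gamma> \<G> \<beta> \<sigma>" and "rational_weight \<G> \<sigma>"
    and "regular_exhaustion \<Gamma> S \<Lambda>"
  defines "\<G>\<^sub>m \<equiv> \<lambda>m. translates_subgraph \<G> arev \<alpha> \<beta> FV FE (\<Lambda> m)"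
  assumes "complex_of_real \<mu> \<notin> op_spectrum (verts \<G>) (dml \<G> Ep \<sigma>) \<or>
           \<mu> = 0 \<or>
           (algebraic \<mu> \<and>
            complex_of_real \<mu> \<notin>
              (\<Union>m. op_spectrum (verts (\<G>\<^sub>m m)) (restricted_dml bc \<G> Ep \<sigma> (\<G>\<^sub>m m))))"
  shows "0 < fk_det (verts \<G>) FV (shift_op (dml \<G> Ep \<sigma>) (complex_of_real \<mu>))"
proof -
  let ?V = "verts \<G>" and ?A = "shift_op (dml \<G> Ep \<sigma>) (complex_of_real \<mu>)"
  let ?K = "kernel_op (magnetic_kernel \<G> \<sigma> \<mu>) (nbhd \<G>) ?V"
  define D where "D = card (\<Union>FE)"
  define C where "C = 2 * real D + \<bar>\<mu>\<bar> + 1"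
  have mg: "magnetic_graph \<G> arev \<sigma> D"
    using assms(1,13) free_action_in_arcs_finite[OF assms(1,7,8,11)]
    by (auto simp: magnetic_graph_def magnetic_graph_axioms_def D_def)
  interpret magnetic_graph \<G> arev \<sigma> D by (rule mg)
  have pk: "periodic_kernel ?V (magnetic_kernel \<G> \<sigma> \<mu>) (nbhd \<G>) C \<Gamma> \<alpha> FV"
    unfolding C_def by (rule periodic_kernel_magnetic[OF mg assms(7,8,11,14)])
  interpret pk: periodic_kernel ?V "magnetic_kernel \<G> \<sigma> \<mu>" "nbhd \<G>" C \<Gamma> \<alpha> FV by (rule pk)
  have AK: "?A f = ?K f" if "f \<in> ell2 ?V" for f
    by (rule dml_eq_kernel_op[OF assms(12)]) (rule ell2D(1)[OF that])
  interpret A: symmetric_op ?V ?A C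
    by (rule symmetric_op_cong[OF pk.symmetric_op_K AK])
  \<comment> \<open>This is the very family that enters \<open>fk_det\<close>; the existence theorem
    is what gives the choice its defining properties.\<close>
  define E where "E = spectral_projection ?V ?A"
  have sf: "spectral_family ?V ?A E"
    unfolding E_def spectral_projection_def by (rule someI_ex[OF A.spectral_family_exists])
  have FV: "finite FV" "\<And>v. v \<in> FV \<Longrightarrow> v \<in> ?V" using pk.FV by auto
  have \<delta>: "delta v \<in> ell2 ?V" if "v \<in> FV" for v by (rule ell2_delta[OF FV(2)[OF that]])
  define F where "F = (\<lambda>l. \<Sum>v\<in>FV. Re (ell2_inner ?V (E l (delta v)) (delta v)))"
  let ?M = "interval_measure F"
  obtain a b where cd: "compact_distribution F a b"
    and moments: "\<And>k. (\<integral>x. x ^ k \<partial>?M) = (\<Sum>v\<in>FV. Re (ell2_inner ?V ((?A ^^ k) (delta v)) (delta v)))"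
    unfolding F_def by (rule A.spectral_family_moments[OF sf FV(1) \<delta>]) blast+
  interpret cd: compact_distribution F a b by (rule cd)
  have density: "spectral_density ?V FV ?A = F"
    by (simp add: fun_eq_iff spectral_density_def vn_trace_def F_def E_def)
  have fm: "finite_measure ?M" by (rule cd.M.finite_measure_axioms)
  have sets: "sets ?M = sets borel" by simp
  \<comment> \<open>The interval outside which the chosen family is constant is not known to lie in
    [-C, C]; the maximum serves the measure and the eigenvalues at once.\<close>
  define C' where "C' = max C (max \<bar>a\<bar> \<bar>b\<bar>)"
  have AE: "AE x in ?M. \<bar>x\<bar> \<le> C'" using cd.AE_Ioc by eventually_elim (auto simp: C'_def)
  have int: "set_integrable ?M {x. 0 < \<bar>x\<bar> \<and> \<bar>x\<bar> \<le> L} (\<lambda>x. ln \<bar>x\<bar>)" for L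
  \<comment> \<open>Conditions (2) and (3) make mu algebraic, so a transcendental mu satisfies
    condition (1).\<close>
  proof (cases "algebraic \<mu>")
    case True
    obtain es :: "nat \<Rightarrow> real list" and K :: real where es: "\<And>m e. e \<in> set (es m) \<Longrightarrow> \<bar>e\<bar> \<le> C"
      "\<And>m. length (es m) = card FV * card (\<Lambda> m)"
      "\<And>k. (\<lambda>m. (\<Sum>e\<leftarrow>es m. e ^ k) / real (card (\<Lambda> m))) \<longlonglongrightarrow> (\<Sum>w\<in>FV. Re ((?K ^^ k) (delta w) w))"
      "\<And>m. - K * real (card (\<Lambda> m)) \<le> (\<Sum>e\<leftarrow>filter (\<lambda>e. e \<noteq> 0) (es m). ln \<bar>e\<bar>)"
      by (rule approximating_eigenvalues[OF mg pk assms(15) True assms(3-5,16)]) blast+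
    have pow: "(?A ^^ k) (delta v) = (?K ^^ k) (delta v)" if "v \<in> FV" for k v
    proof (induction k)
      case (Suc k)
      then show ?case using AK[OF A.funpow_closed[OF \<delta>[OF that], of k]] by simp
    qed simp
    show ?thesis
    proof (rule log_integrable[OF fm sets AE, of "\<lambda>m. real (card (\<Lambda> m))" es "real (card FV)" K])
      show "0 < real (card (\<Lambda> m))" for m
        using assms(16) by (simp add: regular_exhaustion_def card_gt_0_iff)
      show "\<bar>e\<bar> \<le> C'" if "e \<in> set (es m)" for m e using es(1)[OF that] by (simp add: C'_def)
      show "(\<lambda>m. (\<Sum>e\<leftarrow>es m. e ^ k) / real (card (\<Lambda> m))) \<longlonglongrightarrow> (\<integral>x. x ^ k \<partial>?M)" for k
        using es(3)[of k] by (simp add: moments pow ell2_inner_delta FV)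
      show "real (length (es m)) \<le> real (card FV) * real (card (\<Lambda> m))" for m by (simp add: es(2))
      show "- K * real (card (\<Lambda> m)) \<le> (\<Sum>e\<leftarrow>filter (\<lambda>e. e \<noteq> 0) (es m). ln \<bar>e\<bar>)" for m by (rule es(4))
    qed
  next
    case False
    have "algebraic (0::real)" by simp
    then have "complex_of_real \<mu> \<notin> op_spectrum ?V (dml \<G> Ep \<sigma>)" using assms(18) False by auto
    then obtain B where B: "bounded_op ?V B" "\<And>f. f \<in> ell2 ?V \<Longrightarrow> B (?A f) = f"
      unfolding op_spectrum_def by blast
    then obtain c where c: "\<And>f. f \<in> ell2 ?V \<Longrightarrow> ell2_norm ?V (B f) \<le> c * ell2_norm ?V f"
      unfolding bounded_op_def by blast
    \<comment> \<open>The bounded inverse bounds the operator from below. Here 1 + |c| replaces the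
      bound c, whose sign is unknown, by something positive.\<close>
    define s where "s = 1 / (1 + \<bar>c\<bar>)\<^sup>2"
    have s0: "0 < s" unfolding s_def by (intro divide_pos_pos zero_less_power) auto
    have below: "s * (ell2_norm ?V f)\<^sup>2 \<le> (ell2_norm ?V (?A f))\<^sup>2" if f: "f \<in> ell2 ?V" for f
    proof -
      have "ell2_norm ?V f \<le> c * ell2_norm ?V (?A f)" using c[OF A.closed[OF f]] B(2)[OF f] by simp
      also have "\<dots> \<le> (1 + \<bar>c\<bar>) * ell2_norm ?V (?A f)"
        by (intro mult_right_mono ell2_norm_nonneg) auto
      finally have "(ell2_norm ?V f)\<^sup>2 \<le> ((1 + \<bar>c\<bar>) * ell2_norm ?V (?A f))\<^sup>2"
        by (intro power_mono ell2_norm_nonneg)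
      then show ?thesis unfolding s_def by (simp add: power_mult_distrib divide_le_eq mult.commute)
    qed
    note poly_int = A.spectral_family_poly_integral[OF moments cd \<delta>]
    have "AE x in ?M. s \<le> x\<^sup>2"
    proof (rule AE_away_from_0[OF fm sets AE])
      show "0 \<le> C'" by (simp add: C'_def le_max_iff_disj)
      fix p :: "real poly"
      have sq: "(\<integral>x. (poly q x)\<^sup>2 \<partial>?M) = (\<Sum>v\<in>FV. (ell2_norm ?V (poly_op ?A q (delta v)))\<^sup>2)" for q
      proof -
        have "(\<integral>x. poly (q * q) x \<partial>?M) = (\<Sum>v\<in>FV. Re (ell2_inner ?V (poly_op ?A (q * q) (delta v)) (delta v)))"
          by (rule poly_int)
        also have "\<dots> = (\<Sum>v\<in>FV. (ell2_norm ?V (poly_op ?A q (delta v)))\<^sup>2)"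
          by (intro sum.cong refl)
            (simp add: A.poly_op_mult A.poly_op_closed \<delta> A.poly_op_symmetric[of _ _ q] norm_sq_eq_inner)
        finally show ?thesis by (simp add: power2_eq_square)
      qed
      have "s * (\<integral>x. (poly p x)\<^sup>2 \<partial>?M) = (\<Sum>v\<in>FV. s * (ell2_norm ?V (poly_op ?A p (delta v)))\<^sup>2)"
        by (simp add: sq sum_distrib_left)
      also have "\<dots> \<le> (\<Sum>v\<in>FV. (ell2_norm ?V (?A (poly_op ?A p (delta v))))\<^sup>2)"
        by (intro sum_mono below A.poly_op_closed \<delta>)
      \<comment> \<open>Applying the operator once more multiplies the polynomial by x, so the lower
        bound for vectors becomes the inequality of integrals tested in
        \<open>AE_away_from_0\<close>.\<close>
      also have "\<dots> = (\<Sum>v\<in>FV. (ell2_norm ?V (poly_op ?A (pCons 0 p) (delta v)))\<^sup>2)"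
        by (intro sum.cong refl) (simp add: A.poly_op_pCons \<delta>)
      also have "\<dots> = (\<integral>x. (x * poly p x)\<^sup>2 \<partial>?M)" unfolding sq[symmetric] by simp
      finally show "s * (\<integral>x. (poly p x)\<^sup>2 \<partial>?M) \<le> (\<integral>x. (x * poly p x)\<^sup>2 \<partial>?M)" .
    qed
    then have AE0: "AE x in ?M. sqrt s \<le> \<bar>x\<bar>"
    proof eventually_elim
      case (elim x)
      then show ?case using real_sqrt_le_mono[OF elim] by simp
    qed
    show ?thesis by (rule log_integrable_away_from_0[OF fm sets AE AE0]) (use s0 in simp)
  qed
  \<comment> \<open>Integrability holds for every L, in particular for the one chosen in
    \<open>fk_det\<close>, and then the determinant is an exponential.\<close>
  show ?thesis unfolding fk_det_def density Let_def using int by simp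
qed

end
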